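(* Let Problem (SLQ) be solvable at $\eta\in H$ with $(\overline X(\cdot),\bar u(\cdot))$ being an optimal pair. Then for the transposition solution $(Y(\cdot),Z(\cdot))$ of the backward stochastic evolution equation $$\begin{cases} dY=-\big(A^*Y+A_1^*Y+C^*Z-M\overline X\big)dt+Z\,dW(t)&\text{in }[0,T),\\ Y(T)=-G\overline X(T),\end{cases}$$ one has $$R\bar u-B^*Y-D^*Z=0\quad\text{for a.e. }(t,\omega)\in[0,T]\times\Omega.$$
   Context: Let $T>0$ and $(\Omega,\mathcal F,\mathbf F,\mathbb P)$, $\mathbf F=\{\mathcal F_t\}_{t\in[0,T]}$, be a complete filtered probability space satisfying the usual condition and carrying a one-dimensional standard Brownian motion $W$ (the filtration need not be the one generated by $W$). "Adapted" means progressively measurable. For a Banach space $X$: $L^p_{\mathcal F_t}(\Omega;X)$ denotes $\mathcal F_t$-measurable $L^p$ random variables; $L^p_{\mathbb F}(s,T;X)$ adapted processes that are $L^p$ on $(s,T)\times\Omega$ (essentially bounded if $p=\infty$); $L^1_{\mathbb F}(s,T;L^2(\Omega;X))$ adapted processes with $\int_s^T(\mathbb E|\varphi|^2)^{1/2}dt<\infty$; $C_{\mathbb F}([s,T];L^2(\Omega;X))$ (resp. $D_{\mathbb F}([s,T];L^2(\Omega;X))$) adapted processes that are continuous (resp. right continuous with left limits) from $[s,T]$ to $L^2_{\mathcal F_T}(\Omega;X)$. $H$ is a separable real Hilbert space, $U$ a real Hilbert space, $A$ generates a $C_0$-semigroup on $H$; $\mathbb S(\cdot)$ denotes the bounded self-adjoint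 operators. $A_1,C\in L^\infty_{\mathbb F}(0,T;\mathcal L(H))$, $B,D\in L^\infty_{\mathbb F}(0,T;\mathcal L(U;H))$, $M\in L^\infty_{\mathbb F}(0,T;\mathbb S(H))$, $R\in L^\infty_{\mathbb F}(0,T;\mathbb S(U))$, $G\in L^\infty_{\mathcal F_T}(\Omega;\mathbb S(H))$, $\mathcal U[0,T]=L^2_{\mathbb F}(0,T;U)$; $^*$ is the pointwise adjoint. For $\eta\in H$, $u\in\mathcal U[0,T]$, $X(\cdot;\eta,u)\in C_{\mathbb F}([0,T];L^2(\Omega;H))$ is the mild solution of $$dX=(AX+A_1X+Bu)\,dt+(CX+Du)\,dW(t),\quad X(0)=\eta,$$ and $$\mathcal J(\eta;u)=\frac12\mathbb E\Big[\int_0^T\big(\langle MX,X\rangle_H+\langle Ru,u\rangle_U\big)dt+\langle GX(T),X(T)\rangle_H\Big].$$ Problem (SLQ) asks to minimize $\mathcal J(\eta;\cdot)$ over $\mathcal U[0,T]$; it is solvable at $\eta$ if a minimizer $\bar u$ exists, and then $(\overline X,\bar u)$ with $\overline X=X(\cdot;\eta,\bar u)$ is called an optimal pair. Transposition solution. For $Y_T\in L^2_{\mathcal F_T}(\Omega;H)$ and $f$, the pair $(Y,Z)\in D_{\mathbb F}([0,T];L^2(\Omega;H))\times L^2_{\mathbb F}(0,T;H)$ is the transposition solution of $dY=-A^*Y\,dt+f(t,Y,Z)\,dt+Z\,dW$, $Y(T)=Y_T$ (here $f=-A_1^*Y-C^*Z+M\overline X$), if for every $t\in[0,T]$, $\psi_1\in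 L^1_{\mathbb F}(t,T;L^2(\Omega;H))$, $\psi_2\in L^2_{\mathbb F}(t,T;H)$, $\zeta\in L^2_{\mathcal F_t}(\Omega;H)$ and the mild solution $\varphi$ of $d\varphi=(A\varphi+\psi_1)ds+\psi_2dW(s)$ on $(t,T]$, $\varphi(t)=\zeta$, $$\mathbb E\langle\varphi(T),Y_T\rangle_H-\mathbb E\int_t^T\langle\varphi,f(s,Y,Z)\rangle_Hds=\mathbb E\langle\zeta,Y(t)\rangle_H+\mathbb E\int_t^T\langle\psi_1,Y\rangle_Hds+\mathbb E\int_t^T\langle\psi_2,Z\rangle_Hds.$$ It exists and is unique. *)

theory Defs
  imports "HOL-Probability.Probability"
begin

text \<open>
  A Hilbert space is a type of sort \<open>{real_inner, banach}\<close>; it is separable if the sort also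
  includes \<open>second_countable_topology\<close>.  Elements of the various \<open>L\<^sup>p\<close>-spaces are represented by
  functions, not by equivalence classes.
\<close>

section \<open>Strong measurability\<close>

text \<open>
  Measurability for functions with values in a possibly non-separable Banach space (the control
  space, and spaces of bounded operators in the operator norm) is meant in the sense of Bochner;
  by Pettis this is Borel measurability together with a separable range.
\<close>

definition strongly_measurable :: "'a measure \<Rightarrow> ('a \<Rightarrow> 'b::metric_space) \<Rightarrow> bool"
  where "strongly_measurable M f \<longleftrightarrow>
    f \<in> borel_measurable M \<and> (\<exists>D. countable D \<and> f ` space M \<subseteq> closure D)"

definition self_adjoint :: "('h::real_inner \<Rightarrow>\<^sub>L 'h) \<Rightarrow> bool"
  where "self_adjoint K \<longleftrightarrow> adjoint (blinfun_apply K) = blinfun_apply K"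

section \<open>Semigroups and generators\<close>

definition C0_semigroup :: "(real \<Rightarrow> 'h::banach \<Rightarrow>\<^sub>L 'h) \<Rightarrow> bool"
  where "C0_semigroup S \<longleftrightarrow>
    S 0 = id_blinfun \<and>
    (\<forall>s\<ge>0. \<forall>t\<ge>0. S (s + t) = S s o\<^sub>L S t) \<and>
    (\<forall>x. continuous_on {0..} (\<lambda>t. S t x))"

text \<open>The (in general unbounded) operator \<open>A\<close> has domain \<open>domA\<close>; values of \<open>A\<close> outside \<open>domA\<close>
  are irrelevant.\<close>

definition generates_C0_semigroup ::
    "('h::banach \<Rightarrow> 'h) \<Rightarrow> 'h set \<Rightarrow> (real \<Rightarrow> 'h \<Rightarrow>\<^sub>L 'h) \<Rightarrow> bool"
  where "generates_C0_semigroup A domA S \<longleftrightarrow>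
    C0_semigroup S \<and>
    domA = {x. \<exists>y. ((\<lambda>h. (S h x - x) /\<^sub>R h) \<longlongrightarrow> y) (at_right 0)} \<and>
    (\<forall>x\<in>domA. ((\<lambda>h. (S h x - x) /\<^sub>R h) \<longlongrightarrow> A x) (at_right 0))"

section \<open>Filtered probability spaces and spaces of processes\<close>

text \<open>Only the \<open>\<sigma>\<close>-algebra of \<open>F t\<close> for \<open>0 \<le> t \<le> T\<close> is relevant.\<close>

locale usual_filtration = prob_space P + complete_measure P for P :: "'w measure" +
  fixes T :: real and F :: "real \<Rightarrow> 'w measure"
  assumes T_pos: "0 < T"
    and subalgebra_F: "\<And>t. t \<in> {0..T} \<Longrightarrow> subalgebra P (F t)"
    and sets_F_mono: "\<And>s t. 0 \<le> s \<Longrightarrow> s \<le> t \<Longrightarrow> t \<le> T \<Longrightarrow> sets (F s) \<subseteq> sets (F t)"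
    and right_continuous_F:
      "\<And>t. 0 \<le> t \<Longrightarrow> t < T \<Longrightarrow> sets (F t) = (\<Inter>r\<in>{t<..T}. sets (F r))"
    and null_sets_F: "null_sets P \<subseteq> sets (F 0)"
begin

definition dt_dP :: "real \<Rightarrow> real \<Rightarrow> (real \<times> 'w) measure"
  where "dt_dP s t = restrict_space lborel {s..t} \<Otimes>\<^sub>M P"

definition prog_measurable :: "real \<Rightarrow> real \<Rightarrow> (real \<Rightarrow> 'w \<Rightarrow> 'b::metric_space) \<Rightarrow> bool"
  where "prog_measurable s t \<phi> \<longleftrightarrow> (\<forall>r\<in>{s..t}.
    strongly_measurable (restrict_space borel {s..r} \<Otimes>\<^sub>M F r) (\<lambda>(q, \<omega>). \<phi> q \<omega>))"

definition L2_rv :: "real \<Rightarrow> ('w \<Rightarrow> 'b::real_normed_vector) \<Rightarrow> bool"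
  where "L2_rv t \<xi> \<longleftrightarrow> strongly_measurable (F t) \<xi> \<and> integrable P (\<lambda>\<omega>. (norm (\<xi> \<omega>))\<^sup>2)"

definition Linf_rv :: "real \<Rightarrow> ('w \<Rightarrow> 'b::real_normed_vector) \<Rightarrow> bool"
  where "Linf_rv t \<xi> \<longleftrightarrow> strongly_measurable (F t) \<xi> \<and> (\<exists>K. AE \<omega> in P. norm (\<xi> \<omega>) \<le> K)"

definition L2_F :: "real \<Rightarrow> real \<Rightarrow> (real \<Rightarrow> 'w \<Rightarrow> 'b::real_normed_vector) \<Rightarrow> bool"
  where "L2_F s t \<phi> \<longleftrightarrow> prog_measurable s t \<phi> \<and>
    integrable (dt_dP s t) (\<lambda>(r, \<omega>). (norm (\<phi> r \<omega>))\<^sup>2)"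

definition Linf_F :: "real \<Rightarrow> real \<Rightarrow> (real \<Rightarrow> 'w \<Rightarrow> 'b::real_normed_vector) \<Rightarrow> bool"
  where "Linf_F s t \<phi> \<longleftrightarrow> prog_measurable s t \<phi> \<and>
    (\<exists>K. AE (r, \<omega>) in dt_dP s t. norm (\<phi> r \<omega>) \<le> K)"

definition L1_F_L2 :: "real \<Rightarrow> real \<Rightarrow> (real \<Rightarrow> 'w \<Rightarrow> 'b::real_normed_vector) \<Rightarrow> bool"
  where "L1_F_L2 s t \<phi> \<longleftrightarrow> prog_measurable s t \<phi> \<and>
    (AE r in restrict_space lborel {s..t}. integrable P (\<lambda>\<omega>. (norm (\<phi> r \<omega>))\<^sup>2)) \<and>
    set_integrable lborel {s..t} (\<lambda>r. sqrt (\<integral>\<omega>. (norm (\<phi> r \<omega>))\<^sup>2 \<partial>P))"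

definition C_F :: "real \<Rightarrow> real \<Rightarrow> (real \<Rightarrow> 'w \<Rightarrow> 'b::real_normed_vector) \<Rightarrow> bool"
  where "C_F s t \<phi> \<longleftrightarrow> prog_measurable s t \<phi> \<and> (\<forall>r\<in>{s..t}. L2_rv T (\<phi> r)) \<and>
    (\<forall>r\<in>{s..t}. ((\<lambda>q. \<integral>\<omega>. (norm (\<phi> q \<omega> - \<phi> r \<omega>))\<^sup>2 \<partial>P) \<longlongrightarrow> 0) (at r within {s..t}))"

definition D_F :: "real \<Rightarrow> real \<Rightarrow> (real \<Rightarrow> 'w \<Rightarrow> 'b::real_normed_vector) \<Rightarrow> bool"
  where "D_F s t \<phi> \<longleftrightarrow> prog_measurable s t \<phi> \<and> (\<forall>r\<in>{s..t}. L2_rv T (\<phi> r)) \<and>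
    (\<forall>r\<in>{s..<t}. ((\<lambda>q. \<integral>\<omega>. (norm (\<phi> q \<omega> - \<phi> r \<omega>))\<^sup>2 \<partial>P) \<longlongrightarrow> 0) (at r within {r<..t})) \<and>
    (\<forall>r\<in>{s<..t}. \<exists>\<xi>. L2_rv T \<xi> \<and>
       ((\<lambda>q. \<integral>\<omega>. (norm (\<phi> q \<omega> - \<xi> \<omega>))\<^sup>2 \<partial>P) \<longlongrightarrow> 0) (at r within {s..<r}))"

end

section \<open>Brownian motion and the Ito integral\<close>

locale brownian_motion = usual_filtration P T F
    for P :: "'w measure" and T :: real and F :: "real \<Rightarrow> 'w measure" +
  fixes W :: "real \<Rightarrow> 'w \<Rightarrow> real"
  assumes W_adapted: "\<And>t. t \<in> {0..T} \<Longrightarrow> W t \<in> borel_measurable (F t)"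
    and W_zero: "AE \<omega> in P. W 0 \<omega> = 0"
    and W_continuous: "AE \<omega> in P. continuous_on {0..T} (\<lambda>t. W t \<omega>)"
    and W_indep: "\<And>s t. 0 \<le> s \<Longrightarrow> s < t \<Longrightarrow> t \<le> T \<Longrightarrow>
      indep_set (sets (F s)) {(\<lambda>\<omega>. W t \<omega> - W s \<omega>) -` E \<inter> space P | E. E \<in> sets borel}"
    and W_normal: "\<And>s t. 0 \<le> s \<Longrightarrow> s < t \<Longrightarrow> t \<le> T \<Longrightarrow>
      distributed P lborel (\<lambda>\<omega>. W t \<omega> - W s \<omega>) (normal_density 0 (sqrt (t - s)))"
begin

text \<open>A simple integrand on \<open>[s, t]\<close> takes the bounded value \<open>\<xi> i\<close> on \<open>[\<tau> i, \<tau> (i + 1))\<close>,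
  where \<open>s = \<tau> 0 < \<dots> < \<tau> n = t\<close>.\<close>

definition simple_integrand ::
    "real \<Rightarrow> real \<Rightarrow> nat \<Rightarrow> (nat \<Rightarrow> real) \<Rightarrow> (nat \<Rightarrow> 'w \<Rightarrow> 'b::real_normed_vector) \<Rightarrow> bool"
  where "simple_integrand s t n \<tau> \<xi> \<longleftrightarrow>
    \<tau> 0 = s \<and> \<tau> n = t \<and> (\<forall>i<n. \<tau> i < \<tau> (Suc i)) \<and>
    (\<forall>i<n. strongly_measurable (F (\<tau> i)) (\<xi> i) \<and> bounded (\<xi> i ` space P))"

definition simple_process ::
    "nat \<Rightarrow> (nat \<Rightarrow> real) \<Rightarrow> (nat \<Rightarrow> 'w \<Rightarrow> 'b::real_normed_vector) \<Rightarrow> real \<Rightarrow> 'w \<Rightarrow> 'b"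
  where "simple_process n \<tau> \<xi> r \<omega> =
    (\<Sum>i<n. indicator {\<tau> i..<\<tau> (Suc i)} r *\<^sub>R \<xi> i \<omega>)"

definition simple_ito ::
    "nat \<Rightarrow> (nat \<Rightarrow> real) \<Rightarrow> (nat \<Rightarrow> 'w \<Rightarrow> 'b::real_normed_vector) \<Rightarrow> 'w \<Rightarrow> 'b"
  where "simple_ito n \<tau> \<xi> \<omega> = (\<Sum>i<n. (W (\<tau> (Suc i)) \<omega> - W (\<tau> i) \<omega>) *\<^sub>R \<xi> i \<omega>)"

text \<open>\<open>I\<close> is (a version of) the Ito integral of \<open>\<phi>\<close> over \<open>[s, t]\<close>: an \<open>L\<^sup>2\<close>-limit of integrals of
  simple integrands that converge to \<open>\<phi>\<close> in \<open>L\<^sup>2\<close>.\<close>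

definition has_ito_integral ::
    "real \<Rightarrow> real \<Rightarrow> (real \<Rightarrow> 'w \<Rightarrow> 'b::real_normed_vector) \<Rightarrow> ('w \<Rightarrow> 'b) \<Rightarrow> bool"
  where "has_ito_integral s t \<phi> I \<longleftrightarrow> L2_F s t \<phi> \<and> L2_rv t I \<and>
    (\<exists>n \<tau> \<xi>. (\<forall>k::nat. simple_integrand s t (n k) (\<tau> k) (\<xi> k)) \<and>
      ((\<lambda>k. \<integral>\<^sup>+ (r, \<omega>). ennreal ((norm (simple_process (n k) (\<tau> k) (\<xi> k) r \<omega> - \<phi> r \<omega>))\<^sup>2)
         \<partial>dt_dP s t) \<longlonglongrightarrow> 0) \<and>
      ((\<lambda>k. \<integral>\<^sup>+ \<omega>. ennreal ((norm (simple_ito (n k) (\<tau> k) (\<xi> k) \<omega> - I \<omega>))\<^sup>2) \<partial>P) \<longlonglongrightarrow> 0))"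

section \<open>Mild and transposition solutions\<close>

text \<open>Mild solution on \<open>[s, T]\<close> of \<open>d\<phi> = (A \<phi> + \<psi>\<^sub>1) dr + \<psi>\<^sub>2 dW\<close>, \<open>\<phi>(s) = \<zeta>\<close>, where \<open>S\<close> is the
  semigroup generated by \<open>A\<close>.\<close>

definition mild_solution ::
    "(real \<Rightarrow> 'h \<Rightarrow>\<^sub>L 'h) \<Rightarrow> real \<Rightarrow> ('w \<Rightarrow> 'h::{real_inner, banach, second_countable_topology}) \<Rightarrow>
     (real \<Rightarrow> 'w \<Rightarrow> 'h) \<Rightarrow> (real \<Rightarrow> 'w \<Rightarrow> 'h) \<Rightarrow> (real \<Rightarrow> 'w \<Rightarrow> 'h) \<Rightarrow> bool"
  where "mild_solution S s \<zeta> \<psi>\<^sub>1 \<psi>\<^sub>2 \<phi> \<longleftrightarrow> C_F s T \<phi> \<and>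
    (\<forall>t\<in>{s..T}. \<exists>I. has_ito_integral s t (\<lambda>r \<omega>. S (t - r) (\<psi>\<^sub>2 r \<omega>)) I \<and>
      (AE \<omega> in P. set_integrable lborel {s..t} (\<lambda>r. S (t - r) (\<psi>\<^sub>1 r \<omega>)) \<and>
        \<phi> t \<omega> = S (t - s) (\<zeta> \<omega>) + (LINT r:{s..t}|lborel. S (t - r) (\<psi>\<^sub>1 r \<omega>)) + I \<omega>))"

text \<open>Transposition solution of \<open>dY = - A\<^sup>* Y dt + f(t, Y, Z) dt + Z dW\<close>, \<open>Y(T) = Y\<^sub>T\<close>, where \<open>S\<close> is
  the semigroup generated by \<open>A\<close>.\<close>

definition transposition_solution ::
    "(real \<Rightarrow> 'h \<Rightarrow>\<^sub>L 'h) \<Rightarrow> ('w \<Rightarrow> 'h::{real_inner, banach, second_countable_topology}) \<Rightarrow>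
     (real \<Rightarrow> 'w \<Rightarrow> 'h \<Rightarrow> 'h \<Rightarrow> 'h) \<Rightarrow> (real \<Rightarrow> 'w \<Rightarrow> 'h) \<Rightarrow> (real \<Rightarrow> 'w \<Rightarrow> 'h) \<Rightarrow> bool"
  where "transposition_solution S Y\<^sub>T f Y Z \<longleftrightarrow> D_F 0 T Y \<and> L2_F 0 T Z \<and>
    (\<forall>t\<in>{0..T}. \<forall>\<psi>\<^sub>1 \<psi>\<^sub>2 \<zeta> \<phi>.
      L1_F_L2 t T \<psi>\<^sub>1 \<longrightarrow> L2_F t T \<psi>\<^sub>2 \<longrightarrow> L2_rv t \<zeta> \<longrightarrow> mild_solution S t \<zeta> \<psi>\<^sub>1 \<psi>\<^sub>2 \<phi> \<longrightarrow>
        (\<integral>\<omega>. \<phi> T \<omega> \<bullet> Y\<^sub>T \<omega> \<partial>P)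
          - (\<integral>\<omega>. (LINT s:{t..T}|lborel. \<phi> s \<omega> \<bullet> f s \<omega> (Y s \<omega>) (Z s \<omega>)) \<partial>P)
        = (\<integral>\<omega>. \<zeta> \<omega> \<bullet> Y t \<omega> \<partial>P)
          + (\<integral>\<omega>. (LINT s:{t..T}|lborel. \<psi>\<^sub>1 s \<omega> \<bullet> Y s \<omega>) \<partial>P)
          + (\<integral>\<omega>. (LINT s:{t..T}|lborel. \<psi>\<^sub>2 s \<omega> \<bullet> Z s \<omega>) \<partial>P))"

end

section \<open>The linear quadratic problem\<close>

locale slq = brownian_motion P T F W
    for P :: "'w measure" and T :: real and F :: "real \<Rightarrow> 'w measure"
      and W :: "real \<Rightarrow> 'w \<Rightarrow> real" +
  fixes A :: "'h::{real_inner, banach, second_countable_topology} \<Rightarrow> 'h" and domA :: "'h set"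
    and S :: "real \<Rightarrow> 'h \<Rightarrow>\<^sub>L 'h"
    and A\<^sub>1 C :: "real \<Rightarrow> 'w \<Rightarrow> 'h \<Rightarrow>\<^sub>L 'h"
    and B D :: "real \<Rightarrow> 'w \<Rightarrow> 'u::{real_inner, banach} \<Rightarrow>\<^sub>L 'h"
    and M :: "real \<Rightarrow> 'w \<Rightarrow> 'h \<Rightarrow>\<^sub>L 'h"
    and R :: "real \<Rightarrow> 'w \<Rightarrow> 'u \<Rightarrow>\<^sub>L 'u"
    and G :: "'w \<Rightarrow> 'h \<Rightarrow>\<^sub>L 'h"
  assumes generator: "generates_C0_semigroup A domA S"
    and Linf_A\<^sub>1: "Linf_F 0 T A\<^sub>1" and Linf_C: "Linf_F 0 T C"
    and Linf_B: "Linf_F 0 T B" and Linf_D: "Linf_F 0 T D"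
    and Linf_M: "Linf_F 0 T M" and M_self_adjoint: "AE (t, \<omega>) in dt_dP 0 T. self_adjoint (M t \<omega>)"
    and Linf_R: "Linf_F 0 T R" and R_self_adjoint: "AE (t, \<omega>) in dt_dP 0 T. self_adjoint (R t \<omega>)"
    and Linf_G: "Linf_rv T G" and G_self_adjoint: "AE \<omega> in P. self_adjoint (G \<omega>)"
begin

definition admissible_control :: "(real \<Rightarrow> 'w \<Rightarrow> 'u) \<Rightarrow> bool"
  where "admissible_control u \<longleftrightarrow> L2_F 0 T u"

definition is_state :: "'h \<Rightarrow> (real \<Rightarrow> 'w \<Rightarrow> 'u) \<Rightarrow> (real \<Rightarrow> 'w \<Rightarrow> 'h) \<Rightarrow> bool"
  where "is_state \<eta> u X \<longleftrightarrow> mild_solution S 0 (\<lambda>_. \<eta>)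
    (\<lambda>t \<omega>. A\<^sub>1 t \<omega> (X t \<omega>) + B t \<omega> (u t \<omega>))
    (\<lambda>t \<omega>. C t \<omega> (X t \<omega>) + D t \<omega> (u t \<omega>)) X"

text \<open>For admissible \<open>u\<close> the state exists and is unique up to modification.\<close>

definition state :: "'h \<Rightarrow> (real \<Rightarrow> 'w \<Rightarrow> 'u) \<Rightarrow> real \<Rightarrow> 'w \<Rightarrow> 'h"
  where "state \<eta> u = (SOME X. is_state \<eta> u X)"

definition cost :: "'h \<Rightarrow> (real \<Rightarrow> 'w \<Rightarrow> 'u) \<Rightarrow> real"
  where "cost \<eta> u = (let X = state \<eta> u in
    1 / 2 * (\<integral>\<omega>. (LINT t:{0..T}|lborel. M t \<omega> (X t \<omega>) \<bullet> X t \<omega> + R t \<omega> (u t \<omega>) \<bullet> u t \<omega>)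
      + G \<omega> (X T \<omega>) \<bullet> X T \<omega> \<partial>P))"

definition optimal_control :: "'h \<Rightarrow> (real \<Rightarrow> 'w \<Rightarrow> 'u) \<Rightarrow> bool"
  where "optimal_control \<eta> u \<longleftrightarrow>
    admissible_control u \<and> (\<forall>v. admissible_control v \<longrightarrow> cost \<eta> u \<le> cost \<eta> v)"

definition solvable_at :: "'h \<Rightarrow> bool"
  where "solvable_at \<eta> \<longleftrightarrow> (\<exists>u. optimal_control \<eta> u)"

definition optimal_pair :: "'h \<Rightarrow> (real \<Rightarrow> 'w \<Rightarrow> 'h) \<Rightarrow> (real \<Rightarrow> 'w \<Rightarrow> 'u) \<Rightarrow> bool"
  where "optimal_pair \<eta> X u \<longleftrightarrow> optimal_control \<eta> u \<and> is_state \<eta> u X"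

end

end

(* Convex variation of an optimal control u in a direction w. The state depends affinely on the
   control, so the cost along u + c w is a quadratic polynomial in c whose linear coefficient must
   vanish. Testing the transposition identity on the state driven by w alone turns this coefficient
   into the integral of <Ru - B*Y - D*Z, w>, and w = Ru - B*Y - D*Z gives the claim.

   Existence and uniqueness of states has to be established first. The Ito isometry is proved for
   two simple integrands on different partitions, which makes the integral well defined and linear
   without passing to common refinements. Density of the simple integrands comes from averages over
   the previous cell of a grid, which are adapted because they look only into the past. States are
   then limits of Picard iterations, made progressively measurable by a pointwise limit along a
   fast converging sequence. *)
theory Submission
  imports Defs
begin

section \<open>Riesz representation, adjoints and uniform boundedness\<close>

text \<open>Three obstacles shape the development. First, controls take values in a possibly
  non-separable space, where Borel measurability is not stable under sums or under applying
  operators; all algebra on controls therefore goes through strong measurability, while on the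
  separable state space Borel measurability suffices. Second, processes are functions and not
  classes, so every limit must be a concrete measurable function. Limits are taken pointwise with
  the total operator \<open>lim\<close>, which keeps measurability with respect to
  \<open>F t\<close> without exceptional sets, and approximations are chosen with errors of order
  \<open>(1/2)^k\<close>, so that the sequence itself converges almost surely. Third,
  \<open>cost\<close> refers to an arbitrarily chosen \<open>state\<close>. Uniqueness up to
  modification lets it be evaluated at \<open>X + c \<phi>\<close>, where \<open>X\<close> comes
  with the optimal pair and \<open>\<phi>\<close> starts at 0; hence existence is proved for initial
  value 0. The final test direction must be an admissible control, so \<open>Y\<close>, which is
  only right continuous with left limits in mean square, has to be shown square integrable in
  time.\<close>

lemma quadratic_nonneg_imp_linear_zero:
  fixes a b :: real
  assumes "\<And>t. 0 \<le> a * t\<^sup>2 + b * t"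
  shows "b = 0"
proof (rule ccontr)
  assume b: "b \<noteq> 0"
  \<comment> \<open>A positive number above \<open>a\<close>, whatever the sign of \<open>a\<close>;
    the point \<open>t\<close> below minimises \<open>c t^2 + b t\<close>, where the value is
    negative.\<close>
  define c where "c = \<bar>a\<bar> + 1"
  have c: "c > 0" "a \<le> c" unfolding c_def by auto
  define t where "t = - b / (2 * c)"
  have "a * t\<^sup>2 + b * t \<le> c * t\<^sup>2 + b * t"
    using c(2) by (intro add_right_mono mult_right_mono) auto
  also have "\<dots> = - (b\<^sup>2 / (4 * c))"
    using c(1) by (simp add: t_def power2_eq_square field_simps)
  also have "\<dots> < 0" using b c(1) by simp
  finally show False using assms[of t] by simp
qed

lemma quadratic_nonneg_imp_discriminant:
  fixes a b c :: real
  assumes a: "0 \<le> a" and q: "\<And>t. 0 \<le> a * t\<^sup>2 + 2 * c * t + b"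
  shows "c\<^sup>2 \<le> a * b"
proof (cases "a = 0")
  case True
  have "c = 0"
  proof (rule ccontr)
    assume "c \<noteq> 0"
    \<comment> \<open>At this point the affine function \<open>2 c t + b\<close> takes the value
      -1.\<close>
    with q[of "- (b + 1) / (2 * c)"] True show False by (simp add: field_simps)
  qed
  then show ?thesis using True by simp
next
  case False
  with a have "a > 0" by simp
  with q[of "- c / a"] show ?thesis
    by (simp add: field_simps power2_eq_square)
qed

text \<open>Dirichlet principle: the representing vector minimises
  \<open>J x = |x|^2 - 2 f x\<close>. The parallelogram law makes a minimising sequence Cauchy, and
  the first-order condition at the minimiser is the representation.\<close>

lemma riesz_representation:
  fixes f :: "'a::{real_inner, banach} \<Rightarrow> real"
  assumes "bounded_linear f"
  shows "\<exists>z. \<forall>x. f x = x \<bullet> z"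
proof -
  interpret f: bounded_linear f by fact
  define J where "J x = (norm x)\<^sup>2 - 2 * f x" for x
  obtain K where K: "\<And>x. norm (f x) \<le> norm x * K" using f.bounded by blast
  have "J x \<ge> - K\<^sup>2" for x
  proof -
    have "f x \<le> norm x * K" using K[of x] by auto
    moreover have "0 \<le> (norm x - K)\<^sup>2" by simp
    ultimately show ?thesis unfolding J_def power2_diff by (simp add: algebra_simps)
  qed
  then have bdd: "bdd_below (range J)" by (intro bdd_belowI[of _ "- K\<^sup>2"]) auto
  define m where "m = (INF x. J x)"
  have m_le: "m \<le> J x" for x unfolding m_def using bdd by (rule cINF_lower) auto
  have "\<exists>x. J x < m + 1 / real (Suc n)" for n
    using cINF_less_iff[OF _ bdd, of "m + 1 / real (Suc n)"] unfolding m_def by auto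
  then obtain x where x: "\<And>n. J (x n) < m + 1 / real (Suc n)" by metis
  have para: "(norm (a - b))\<^sup>2 \<le> 2 * (J a - m) + 2 * (J b - m)" for a b
  proof -
    have "(norm (a - b))\<^sup>2 = 2 * J a + 2 * J b - 4 * J ((1/2) *\<^sub>R (a + b))"
      unfolding J_def power2_norm_eq_inner
      by (simp add: f.add f.scaleR inner_simps inner_commute algebra_simps)
    also have "\<dots> \<le> 2 * J a + 2 * J b - 4 * m"
      by (intro diff_left_mono mult_left_mono m_le) simp
    finally show ?thesis by (simp add: algebra_simps)
  qed
  have "Cauchy x"
  proof (rule metric_CauchyI)
    fix e :: real assume e: "e > 0"
    \<comment> \<open>Beyond \<open>N\<close> the values of \<open>J\<close> lie within
      \<open>e^2 / 4\<close> of \<open>m\<close>, which makes the right-hand side of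
      \<open>para\<close> smaller than \<open>e^2\<close>.\<close>
    obtain N where N: "4 / e\<^sup>2 < real N" using reals_Archimedean2 by blast
    have "dist (x i) (x j) < e" if "i \<ge> N" "j \<ge> N" for i j
    proof -
      have *: "J (x k) - m < e\<^sup>2 / 4" if "k \<ge> N" for k
      proof -
        have "4 / e\<^sup>2 < real (Suc k)" using N that by linarith
        then have "1 / real (Suc k) < e\<^sup>2 / 4" using e by (simp add: field_simps)
        with x[of k] show ?thesis by linarith
      qed
      have "(norm (x i - x j))\<^sup>2 < e\<^sup>2"
        using para[of "x i" "x j"] *[OF that(1)] *[OF that(2)] by argo
      then show ?thesis unfolding dist_norm by (rule power2_less_imp_less) (use e in auto)
    qed
    then show "\<exists>N. \<forall>i\<ge>N. \<forall>j\<ge>N. dist (x i) (x j) < e" by blast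
  qed
  then obtain z where z: "x \<longlonglongrightarrow> z" using Cauchy_convergent_iff convergent_def by blast
  have "(\<lambda>n. J (x n)) \<longlonglongrightarrow> J z"
    unfolding J_def by (intro tendsto_intros z f.tendsto)
  moreover have "(\<lambda>n. m + 1 / real (Suc n)) \<longlonglongrightarrow> m + 0"
    by (intro tendsto_intros LIMSEQ_Suc lim_1_over_n)
  ultimately have "J z \<le> m"
    by (intro LIMSEQ_le[of "\<lambda>n. J (x n)" _ "\<lambda>n. m + 1 / real (Suc n)"]) (use x less_imp_le in auto)
  have "f y = y \<bullet> z" for y
  proof -
    \<comment> \<open>Minimality of \<open>z\<close> along the line through \<open>z\<close> in
      direction \<open>y\<close> leaves a nonnegative quadratic whose linear coefficient must
      vanish.\<close>
    have "2 * (y \<bullet> z - f y) = 0"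
    proof (rule quadratic_nonneg_imp_linear_zero)
      fix t :: real
      have "J z \<le> J (z + t *\<^sub>R y)" using \<open>J z \<le> m\<close> m_le order_trans by blast
      then show "0 \<le> (norm y)\<^sup>2 * t\<^sup>2 + 2 * (y \<bullet> z - f y) * t"
        unfolding J_def power2_norm_eq_inner
        by (simp add: f.add f.scaleR inner_simps inner_commute algebra_simps power2_eq_square)
    qed
    then show ?thesis by simp
  qed
  then show ?thesis by blast
qed

text \<open>\<open>adjoint\<close> is a choice operator that is meaningful only once some map
  satisfies the defining identity; Riesz representation supplies that map in infinite
  dimensions.\<close>

lemma adjoint_blinfun:
  fixes K :: "'a::{real_inner, banach} \<Rightarrow>\<^sub>L 'b::real_inner"
  shows "K x \<bullet> y = x \<bullet> adjoint K y"
proof -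
  have "\<exists>z. \<forall>x. K x \<bullet> y = x \<bullet> z" for y
    by (rule riesz_representation) (intro bounded_linear_intros)
  then have "\<exists>g. \<forall>x y. K x \<bullet> y = x \<bullet> g y" by metis
  then show ?thesis using adjoint_unique by metis
qed

lemma norm_adjoint_blinfun:
  fixes K :: "'a::{real_inner, banach} \<Rightarrow>\<^sub>L 'b::real_inner"
  shows "norm (adjoint K y) \<le> norm K * norm y"
proof (cases "adjoint K y = 0")
  case False
  have "(norm (adjoint K y))\<^sup>2 = K (adjoint K y) \<bullet> y"
    by (simp add: adjoint_blinfun power2_norm_eq_inner)
  also have "\<dots> \<le> norm (K (adjoint K y)) * norm y" by (rule norm_cauchy_schwarz)
  also have "\<dots> \<le> norm K * norm (adjoint K y) * norm y"
    by (intro mult_right_mono norm_blinfun) auto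
  finally show ?thesis using False by (simp add: power2_eq_square)
qed simp

text \<open>Joint continuity in the operator and the vector is what keeps
  \<open>adjoint (B t \<omega>) (Y t \<omega>)\<close> progressively measurable, and the bound keeps
  it square integrable. Each identity is obtained by testing against all vectors.\<close>

lemma bounded_bilinear_adjoint:
  "bounded_bilinear (\<lambda>(K :: 'a::{real_inner, banach} \<Rightarrow>\<^sub>L 'b::real_inner) y. adjoint K y)"
proof -
  have eqI: "a = b" if "\<And>x. x \<bullet> a = x \<bullet> b" for a b :: 'a
    using that vector_eq_ldot[of a b] by simp
  show ?thesis
  proof
    fix K K' :: "'a \<Rightarrow>\<^sub>L 'b" and y y' r
    show "adjoint (K + K') y = adjoint K y + adjoint K' y"
      by (rule eqI) (simp add: inner_add_right adjoint_blinfun[symmetric] blinfun.add_left inner_add_left)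
    show "adjoint K (y + y') = adjoint K y + adjoint K y'"
      by (rule eqI) (simp add: inner_add_right adjoint_blinfun[symmetric])
    show "adjoint (r *\<^sub>R K) y = r *\<^sub>R adjoint K y"
      by (rule eqI) (simp add: adjoint_blinfun[symmetric] blinfun.scaleR_left)
    show "adjoint K (r *\<^sub>R y) = r *\<^sub>R adjoint K y"
      by (rule eqI) (simp add: adjoint_blinfun[symmetric])
  next
    show "\<exists>c. \<forall>(K :: 'a \<Rightarrow>\<^sub>L 'b) y. norm (adjoint (blinfun_apply K) y) \<le> norm K * norm y * c"
      by (rule exI[of _ 1]) (simp add: norm_adjoint_blinfun)
  qed
qed

text \<open>By Baire, one of the closed sets \<open>V n\<close> has interior, so the whole family is
  bounded by \<open>n\<close> on a ball. This bounds a strongly continuous semigroup in operator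
  norm on compact time intervals.\<close>

lemma uniform_boundedness:
  fixes T :: "'i \<Rightarrow> 'a::banach \<Rightarrow>\<^sub>L 'b::real_normed_vector"
  assumes pw: "\<And>x. \<exists>c. \<forall>i\<in>I. norm (T i x) \<le> c"
  shows "\<exists>c. \<forall>i\<in>I. norm (T i) \<le> c"
proof -
  define V where "V n = {x. \<forall>i\<in>I. norm (T i x) \<le> real n}" for n
  have cl: "closed (V n)" for n
  proof -
    have "V n = (\<Inter>i\<in>I. {x. norm (T i x) \<le> real n})" unfolding V_def by auto
    also have "closed \<dots>"
      by (intro closed_INT ballI closed_Collect_le continuous_intros)
    finally show ?thesis .
  qed
  have un: "(\<Union>n. V n) = UNIV"
  proof -
    have "\<exists>n. x \<in> V n" for x
    proof -
      obtain c where c: "\<forall>i\<in>I. norm (T i x) \<le> c" using pw by blast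
      obtain n where "c \<le> real n" using real_arch_simple by blast
      then have "x \<in> V n" unfolding V_def using c by force
      then show ?thesis by blast
    qed
    then show ?thesis by auto
  qed
  have "\<exists>n. interior (V n) \<noteq> {}"
  proof (rule ccontr)
    assume "\<not> ?thesis"
    then have "(euclidean :: 'a topology) interior_of (\<Union>(range V)) = {}"
      by (intro Baire_category_alt) (auto simp: completely_metrizable_space_euclidean cl)
    then show False using un by simp
  qed
  then obtain n x0 where "x0 \<in> interior (V n)" by blast
  then obtain r where r: "r > 0" "cball x0 r \<subseteq> V n" unfolding mem_interior_cball by blast
  have "norm (T i) \<le> 2 * real n / r" if i: "i \<in> I" for i
  proof (rule norm_blinfun_bound)
    fix x
    show "norm (T i x) \<le> 2 * real n / r * norm x"
    proof (cases "x = 0")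
      case False
      define y where "y = (r / norm x) *\<^sub>R x"
      have "norm y = r" using r(1) False by (simp add: y_def)
      then have "x0 + y \<in> cball x0 r" "x0 \<in> cball x0 r" using r(1) by (auto simp: dist_norm)
      then have "x0 + y \<in> V n" "x0 \<in> V n" using r(2) by blast+
      then have "norm (T i (x0 + y)) \<le> real n" "norm (T i x0) \<le> real n"
        unfolding V_def using i by blast+
      \<comment> \<open>Recentring the ball at the origin costs the factor 2; rescaling from radius
        \<open>r\<close> gives the bound \<open>2 n / r\<close>.\<close>
      moreover have "T i y = T i (x0 + y) - T i x0" by (simp add: blinfun.add_right)
      ultimately have "norm (T i y) \<le> 2 * real n"
        using norm_triangle_ineq4[of "T i (x0 + y)" "T i x0"] by simp
      then have "(r / norm x) * norm (T i x) \<le> 2 * real n"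
        using r(1) by (simp add: y_def blinfun.scaleR_right)
      then show ?thesis using r(1) False by (simp add: field_simps)
    qed simp
  qed (use r(1) in simp)
  then show ?thesis by blast
qed

section \<open>Strong measurability\<close>

lemma strongly_measurable_iff_borel:
  fixes f :: "'a \<Rightarrow> 'b::{metric_space, second_countable_topology}"
  shows "strongly_measurable N f \<longleftrightarrow> f \<in> borel_measurable N"
proof -
  obtain D :: "'b set" where D: "countable D" "\<And>X. open X \<Longrightarrow> X \<noteq> {} \<Longrightarrow> \<exists>d\<in>D. d \<in> X"
    using countable_dense_exists by blast
  have "x \<in> closure D" for x
  proof (rule ccontr)
    assume "x \<notin> closure D"
    then have "- closure D \<noteq> {}" by auto
    then obtain d where "d \<in> D" "d \<in> - closure D" using D(2)[of "- closure D"] by auto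
    then show False using closure_subset[of D] by auto
  qed
  then have "closure D = UNIV" by auto
  with D(1) show ?thesis unfolding strongly_measurable_def by auto
qed

text \<open>Take the first point of a countable dense sequence that is close enough. Measurability
  into the discrete space \<open>count_space UNIV\<close> is stronger than Borel measurability and
  is what makes pairs of such functions measurable.\<close>

lemma countably_valued_approximation:
  assumes f: "strongly_measurable N f" and e: "e > 0"
  obtains g where "\<And>x. x \<in> space N \<Longrightarrow> dist (g x) (f x) < e" "countable (range g)"
    "g \<in> measurable N (count_space UNIV)"
proof -
  obtain D where D: "countable D" "f ` space N \<subseteq> closure D" and fm[measurable]: "f \<in> borel_measurable N"
    using f unfolding strongly_measurable_def by blast
  show ?thesis
  proof (cases "D = {}")
    case True
    \<comment> \<open>The closure of the empty set is empty, so the arbitrary value used next is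
      never taken.\<close>
    then have "space N = {}" using D(2) by auto
    then show ?thesis
      by (intro that[of "\<lambda>_. undefined"]) (auto simp: measurable_def)
  next
    case False
    define d where "d = from_nat_into D"
    have rd: "range d = D" unfolding d_def using D(1) False by simp
    define n where "n x = (LEAST n. dist (d n) (f x) < e)" for x
    have [measurable]: "Measurable.pred N (\<lambda>x. dist (d k) (f x) < e)" for k
    proof -
      have "f -` ball (d k) e \<inter> space N \<in> sets N" using fm by (rule measurable_sets) simp
      also have "f -` ball (d k) e \<inter> space N = {x \<in> space N. dist (d k) (f x) < e}" by auto
      finally show ?thesis by (simp add: pred_def)
    qed
    have n_meas: "n \<in> measurable N (count_space UNIV)" unfolding n_def by measurable
    show ?thesis
    proof (rule that[of "\<lambda>x. d (n x)"])
      fix x assume "x \<in> space N"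
      then have "f x \<in> closure D" using D(2) by auto
      then obtain y where "y \<in> D" "dist y (f x) < e"
        using e closure_approachable by blast
      then have "\<exists>k. dist (d k) (f x) < e" using rd by (metis rangeE)
      then show "dist (d (n x)) (f x) < e" unfolding n_def by (rule LeastI_ex)
    next
      show "countable (range (\<lambda>x. d (n x)))"
        using D(1) rd by (auto intro: countable_subset)
      show "(\<lambda>x. d (n x)) \<in> measurable N (count_space UNIV)"
        using n_meas by measurable
    qed
  qed
qed

lemma strongly_measurable_LIMSEQ:
  assumes f: "\<And>i. strongly_measurable N (f i)" and lim: "\<And>x. x \<in> space N \<Longrightarrow> (\<lambda>i. f i x) \<longlonglongrightarrow> g x"
  shows "strongly_measurable N g"
proof -
  have "\<forall>i. \<exists>D. countable D \<and> f i ` space N \<subseteq> closure D"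
    using f unfolding strongly_measurable_def by blast
  then obtain D where D: "\<And>i. countable (D i)" "\<And>i. f i ` space N \<subseteq> closure (D i)" by metis
  have "g x \<in> closure (\<Union>i. D i)" if "x \<in> space N" for x
  proof (rule Lim_in_closed_set[OF _ _ _ lim[OF that]])
    show "\<forall>\<^sub>F i in sequentially. f i x \<in> closure (\<Union>i. D i)"
      using D(2) that closure_mono[of "D _" "\<Union>i. D i"] by (intro always_eventually) blast
  qed auto
  then have "g ` space N \<subseteq> closure (\<Union>i. D i)" by blast
  moreover have "g \<in> borel_measurable N"
  proof (rule borel_measurable_LIMSEQ_metric)
    show "f i \<in> borel_measurable N" for i using f strongly_measurable_def by blast
  qed (rule lim)
  moreover have "countable (\<Union>i. D i)" using D(1) by simp
  ultimately show ?thesis unfolding strongly_measurable_def by blast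
qed

lemma LIMSEQ_inverse_Suc_bound:
  fixes k :: "nat \<Rightarrow> 'a::metric_space"
  assumes "\<And>n. dist (k n) l < 1 / real (Suc n)"
  shows "k \<longlonglongrightarrow> l"
proof (rule metric_tendsto_imp_tendsto[of "\<lambda>n. 1 / real (Suc n)" 0])
  show "(\<lambda>n. 1 / real (Suc n)) \<longlonglongrightarrow> 0" by (intro LIMSEQ_Suc lim_1_over_n)
  show "\<forall>\<^sub>F n in sequentially. dist (k n) l \<le> dist (1 / real (Suc n)) 0"
    using assms by (intro always_eventually) (auto intro: less_imp_le)
qed

text \<open>Without separability, the Borel \<open>\<sigma>\<close>-algebra of a product may exceed the product \<open>\<sigma>\<close>-algebra,
  so both arguments are approximated by functions with countable range.\<close>

lemma strongly_measurable_continuous2: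
  fixes h :: "'b::metric_space \<Rightarrow> 'c::metric_space \<Rightarrow> 'd::metric_space"
  assumes f: "strongly_measurable N f" and g: "strongly_measurable N g"
    and h: "continuous_on UNIV (\<lambda>(x, y). h x y)"
  shows "strongly_measurable N (\<lambda>x. h (f x) (g x))"
proof -
  have "\<exists>f'. (\<forall>x\<in>space N. dist (f' x) (f x) < 1 / real (Suc n)) \<and> countable (range f') \<and>
      f' \<in> measurable N (count_space UNIV)" for n
    by (rule countably_valued_approximation[OF f, of "1 / real (Suc n)"]) auto
  then obtain F where F: "\<And>n x. x \<in> space N \<Longrightarrow> dist (F n x) (f x) < 1 / real (Suc n)"
      "\<And>n. countable (range (F n))" "\<And>n. F n \<in> measurable N (count_space UNIV)" by metis
  have "\<exists>f'. (\<forall>x\<in>space N. dist (f' x) (g x) < 1 / real (Suc n)) \<and> countable (range f') \<and>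
      f' \<in> measurable N (count_space UNIV)" for n
    by (rule countably_valued_approximation[OF g, of "1 / real (Suc n)"]) auto
  then obtain G where G: "\<And>n x. x \<in> space N \<Longrightarrow> dist (G n x) (g x) < 1 / real (Suc n)"
      "\<And>n. countable (range (G n))" "\<And>n. G n \<in> measurable N (count_space UNIV)" by metis
  show ?thesis
  proof (rule strongly_measurable_LIMSEQ[of _ "\<lambda>n x. h (F n x) (G n x)"])
    fix n
    let ?R = "range (F n) \<times> range (G n)"
    have R: "countable ?R" using F(2) G(2) by auto
    \<comment> \<open>For a countable discrete target it is enough to treat preimages of single
      pairs, which are intersections of two measurable sets; every function on the discrete space,
      in particular \<open>h\<close>, is then measurable.\<close>
    have "(\<lambda>x. (F n x, G n x)) \<in> measurable N (count_space ?R)"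
    proof (subst measurable_count_space_eq_countable)
      have "(\<lambda>x. (F n x, G n x)) -` {a} \<inter> space N \<in> sets N" for a
      proof -
        have "(\<lambda>x. (F n x, G n x)) -` {a} \<inter> space N =
            (F n -` {fst a} \<inter> space N) \<inter> (G n -` {snd a} \<inter> space N)" by (cases a) auto
        also have "\<dots> \<in> sets N"
          using F(3)[of n] G(3)[of n] by (intro sets.Int measurable_sets[of _ _ "count_space UNIV"]) auto
        finally show ?thesis .
      qed
      then show "(\<lambda>x. (F n x, G n x)) \<in> space N \<rightarrow> ?R \<and> (\<forall>a\<in>?R. (\<lambda>x. (F n x, G n x)) -` {a} \<inter> space N \<in> sets N)"
        by auto
    qed (use R in auto)
    then have "(\<lambda>x. (\<lambda>(a, b). h a b) (F n x, G n x)) \<in> borel_measurable N"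
      by (rule measurable_compose) auto
    moreover have "countable ((\<lambda>(a, b). h a b) ` ?R)" using R by auto
    moreover have "(\<lambda>x. h (F n x) (G n x)) ` space N \<subseteq> closure ((\<lambda>(a, b). h a b) ` ?R)"
      using closure_subset by fastforce
    ultimately show "strongly_measurable N (\<lambda>x. h (F n x) (G n x))"
      unfolding strongly_measurable_def by (auto simp: case_prod_beta)
  next
    fix x assume x: "x \<in> space N"
    have "(\<lambda>n. (F n x, G n x)) \<longlonglongrightarrow> (f x, g x)"
      using F(1)[OF x] G(1)[OF x] by (intro tendsto_Pair LIMSEQ_inverse_Suc_bound)
    from continuous_on_tendsto_compose[OF h this]
    show "(\<lambda>n. h (F n x) (G n x)) \<longlonglongrightarrow> h (f x) (g x)" by simp
  qed
qed

lemma strongly_measurable_compose: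
  assumes "strongly_measurable N f" "g \<in> measurable L N"
  shows "strongly_measurable L (\<lambda>x. f (g x))"
proof -
  obtain D where D: "countable D" "f ` space N \<subseteq> closure D" and f: "f \<in> borel_measurable N"
    using assms(1) unfolding strongly_measurable_def by blast
  have "(\<lambda>x. f (g x)) ` space L \<subseteq> closure D" using D(2) measurable_space[OF assms(2)] by blast
  with D(1) measurable_compose[OF assms(2) f] show ?thesis
    unfolding strongly_measurable_def by (intro conjI exI[of _ D])
qed

section \<open>Square integrable functions\<close>

definition square_integrable :: "'a measure \<Rightarrow> ('a \<Rightarrow> 'b::real_normed_vector) \<Rightarrow> bool"
  where "square_integrable N f \<longleftrightarrow> f \<in> borel_measurable N \<and> integrable N (\<lambda>x. (norm (f x))\<^sup>2)"

text \<open>Only a seminorm on functions. A non-integrable square gets Bochner integral 0, so the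
  value carries information only together with \<open>square_integrable\<close>.\<close>

definition L2norm :: "'a measure \<Rightarrow> ('a \<Rightarrow> 'b::real_normed_vector) \<Rightarrow> real"
  where "L2norm N f = sqrt (\<integral>x. (norm (f x))\<^sup>2 \<partial>N)"

lemma square_integrable_measurable[measurable_dest]:
  "square_integrable N f \<Longrightarrow> f \<in> borel_measurable N"
  by (simp add: square_integrable_def)

lemma L2norm_nonneg[simp]: "0 \<le> L2norm N f"
  by (simp add: L2norm_def)

lemma L2norm_squared: "(L2norm N f)\<^sup>2 = (\<integral>x. (norm (f x))\<^sup>2 \<partial>N)"
  by (simp add: L2norm_def integral_nonneg_AE)

lemma norm_add_squared_le: "(norm (a + b))\<^sup>2 \<le> 2 * (norm a)\<^sup>2 + 2 * (norm b)\<^sup>2"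
  for a b :: "'a::real_normed_vector"
proof -
  have "(norm (a + b))\<^sup>2 \<le> (norm a + norm b)\<^sup>2"
    by (intro power_mono norm_triangle_ineq) simp
  also have "\<dots> \<le> 2 * (norm a)\<^sup>2 + 2 * (norm b)\<^sup>2"
    using zero_le_power2[of "norm a - norm b"] unfolding power2_sum power2_diff by linarith
  finally show ?thesis .
qed

lemma square_integrable_bound:
  fixes f :: "'a \<Rightarrow> 'b::real_normed_vector" and g :: "'a \<Rightarrow> 'c::real_normed_vector"
  assumes "square_integrable N g" "f \<in> borel_measurable N" "AE x in N. norm (f x) \<le> c * norm (g x)"
  shows "square_integrable N f"
proof -
  have "integrable N (\<lambda>x. (norm (f x))\<^sup>2)"
  proof (rule Bochner_Integration.integrable_bound)
    show "integrable N (\<lambda>x. c\<^sup>2 * (norm (g x))\<^sup>2)"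
      using assms(1) by (simp add: square_integrable_def)
    show "AE x in N. norm ((norm (f x))\<^sup>2) \<le> norm (c\<^sup>2 * (norm (g x))\<^sup>2)"
      using assms(3)
    proof eventually_elim
      case (elim x)
      then have "(norm (f x))\<^sup>2 \<le> (c * norm (g x))\<^sup>2" by (intro power_mono) auto
      then show ?case by (simp add: power_mult_distrib)
    qed
  qed (use assms(2) in measurable)
  with assms(2) show ?thesis by (simp add: square_integrable_def)
qed

lemma square_integrable_add:
  fixes f g :: "'a \<Rightarrow> 'b::{real_normed_vector, second_countable_topology}"
  assumes "square_integrable N f" "square_integrable N g"
  shows "square_integrable N (\<lambda>x. f x + g x)"
proof -
  have [measurable]: "f \<in> borel_measurable N" "g \<in> borel_measurable N"
    using assms by (auto simp: square_integrable_def)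
  have "integrable N (\<lambda>x. (norm (f x + g x))\<^sup>2)"
  proof (rule Bochner_Integration.integrable_bound)
    show "integrable N (\<lambda>x. 2 * (norm (f x))\<^sup>2 + 2 * (norm (g x))\<^sup>2)"
      using assms by (simp add: square_integrable_def)
    show "AE x in N. norm ((norm (f x + g x))\<^sup>2) \<le> norm (2 * (norm (f x))\<^sup>2 + 2 * (norm (g x))\<^sup>2)"
      using norm_add_squared_le by (intro AE_I2) simp
  qed measurable
  then show ?thesis by (simp add: square_integrable_def)
qed

lemma square_integrable_scaleR:
  "square_integrable N f \<Longrightarrow> square_integrable N (\<lambda>x. c *\<^sub>R f x)"
  for f :: "'a \<Rightarrow> 'b::{real_normed_vector, second_countable_topology}"
  by (auto simp: square_integrable_def power_mult_distrib)

lemma square_integrable_minus: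
  "square_integrable N f \<Longrightarrow> square_integrable N (\<lambda>x. - f x)"
  for f :: "'a \<Rightarrow> 'b::{real_normed_vector, second_countable_topology}"
  by (auto simp: square_integrable_def)

lemma square_integrable_diff:
  "square_integrable N f \<Longrightarrow> square_integrable N g \<Longrightarrow> square_integrable N (\<lambda>x. f x - g x)"
  for f :: "'a \<Rightarrow> 'b::{real_normed_vector, second_countable_topology}"
  using square_integrable_add[OF _ square_integrable_minus, of N f g] by simp

lemma square_integrable_zero[simp]: "square_integrable N (\<lambda>_. 0)"
  by (simp add: square_integrable_def)

lemma square_integrable_sum:
  fixes f :: "'i \<Rightarrow> 'a \<Rightarrow> 'b::{real_normed_vector, second_countable_topology}"
  assumes "\<And>i. i \<in> I \<Longrightarrow> square_integrable N (f i)"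
  shows "square_integrable N (\<lambda>x. \<Sum>i\<in>I. f i x)"
  using assms
  by (induction I rule: infinite_finite_induct) (auto intro!: square_integrable_add)

lemma square_integrable_norm_mult:
  assumes f: "square_integrable N f" and g: "square_integrable N g"
  shows "integrable N (\<lambda>x. norm (f x) * norm (g x))"
proof (rule Bochner_Integration.integrable_bound)
  show "integrable N (\<lambda>x. (norm (f x))\<^sup>2 + (norm (g x))\<^sup>2)"
    using f g by (simp add: square_integrable_def)
  have "norm a * norm b \<le> (norm a)\<^sup>2 + (norm b)\<^sup>2" for a :: 'b and b :: 'c
    using zero_le_power2[of "norm a - norm b"] mult_nonneg_nonneg[OF norm_ge_zero norm_ge_zero, of a b]
    unfolding power2_diff by argo
  then show "AE x in N. norm (norm (f x) * norm (g x)) \<le> norm ((norm (f x))\<^sup>2 + (norm (g x))\<^sup>2)"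
    by (intro AE_I2) simp
qed (use f g in \<open>auto simp: square_integrable_def\<close>)

text \<open>The integral of \<open>(t |f| + |g|)^2\<close> is a nonnegative quadratic in
  \<open>t\<close>; its discriminant gives the inequality.\<close>

lemma Cauchy_Schwarz_integral:
  assumes f: "square_integrable N f" and g: "square_integrable N g"
  shows "(\<integral>x. norm (f x) * norm (g x) \<partial>N) \<le> L2norm N f * L2norm N g"
proof -
  let ?a = "\<integral>x. (norm (f x))\<^sup>2 \<partial>N" and ?b = "\<integral>x. (norm (g x))\<^sup>2 \<partial>N"
    and ?c = "\<integral>x. norm (f x) * norm (g x) \<partial>N"
  note [simp] = square_integrable_norm_mult[OF f g]
  have [simp]: "integrable N (\<lambda>x. (norm (f x))\<^sup>2)" "integrable N (\<lambda>x. (norm (g x))\<^sup>2)"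
    using f g by (auto simp: square_integrable_def)
  have "?c\<^sup>2 \<le> ?a * ?b"
  proof (rule quadratic_nonneg_imp_discriminant)
    fix t :: real
    have "0 \<le> (\<integral>x. (t * norm (f x) + norm (g x))\<^sup>2 \<partial>N)" by (intro integral_nonneg_AE) auto
    also have "\<dots> = (\<integral>x. t\<^sup>2 * (norm (f x))\<^sup>2 + 2 * t * (norm (f x) * norm (g x)) + (norm (g x))\<^sup>2 \<partial>N)"
      by (intro Bochner_Integration.integral_cong) (auto simp: power2_sum power_mult_distrib)
    also have "\<dots> = ?a * t\<^sup>2 + 2 * ?c * t + ?b" by simp
    finally show "0 \<le> ?a * t\<^sup>2 + 2 * ?c * t + ?b" .
  qed (auto intro!: integral_nonneg_AE)
  also have "?a * ?b = (L2norm N f * L2norm N g)\<^sup>2" by (simp add: power_mult_distrib L2norm_squared)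
  finally show ?thesis by (rule power2_le_imp_le) simp
qed

lemma L2norm_triangle:
  fixes f g :: "'a \<Rightarrow> 'b::{real_normed_vector, second_countable_topology}"
  assumes f: "square_integrable N f" and g: "square_integrable N g"
  shows "L2norm N (\<lambda>x. f x + g x) \<le> L2norm N f + L2norm N g"
proof -
  note [simp] = square_integrable_norm_mult[OF f g]
  have [simp]: "integrable N (\<lambda>x. (norm (f x))\<^sup>2)" "integrable N (\<lambda>x. (norm (g x))\<^sup>2)"
    using f g by (auto simp: square_integrable_def)
  have "(L2norm N (\<lambda>x. f x + g x))\<^sup>2 \<le> (\<integral>x. (norm (f x))\<^sup>2 + (norm (g x))\<^sup>2 + 2 * (norm (f x) * norm (g x)) \<partial>N)"
    unfolding L2norm_squared
  proof (rule integral_mono)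
    show "integrable N (\<lambda>x. (norm (f x + g x))\<^sup>2)"
      using square_integrable_add[OF f g] by (simp add: square_integrable_def)
    fix x
    have "(norm (f x + g x))\<^sup>2 \<le> (norm (f x) + norm (g x))\<^sup>2"
      by (intro power_mono norm_triangle_ineq) simp
    then show "(norm (f x + g x))\<^sup>2 \<le> (norm (f x))\<^sup>2 + (norm (g x))\<^sup>2 + 2 * (norm (f x) * norm (g x))"
      by (simp add: power2_sum)
  qed simp
  also have "\<dots> = (L2norm N f)\<^sup>2 + (L2norm N g)\<^sup>2 + 2 * (\<integral>x. norm (f x) * norm (g x) \<partial>N)"
    by (simp add: L2norm_squared)
  also have "\<dots> \<le> (L2norm N f)\<^sup>2 + (L2norm N g)\<^sup>2 + 2 * (L2norm N f * L2norm N g)"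
    using Cauchy_Schwarz_integral[OF f g] by simp
  also have "\<dots> = (L2norm N f + L2norm N g)\<^sup>2" by (simp add: power2_sum)
  finally show ?thesis by (rule power2_le_imp_le) simp
qed

lemma L2norm_cong_AE:
  assumes "AE x in N. f x = g x" "f \<in> borel_measurable N" "g \<in> borel_measurable N"
  shows "L2norm N f = L2norm N g"
proof -
  have "(\<integral>x. (norm (f x))\<^sup>2 \<partial>N) = (\<integral>x. (norm (g x))\<^sup>2 \<partial>N)"
    using assms by (intro integral_cong_AE) auto
  then show ?thesis by (simp add: L2norm_def)
qed

lemma L2norm_minus_commute: "L2norm N (\<lambda>x. f x - g x) = L2norm N (\<lambda>x. g x - f x)"
  by (simp add: L2norm_def norm_minus_commute)

lemma L2norm_triangle_diff:
  fixes f g h :: "'a \<Rightarrow> 'b::{real_normed_vector, second_countable_topology}"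
  assumes "square_integrable N f" "square_integrable N g" "square_integrable N h"
  shows "L2norm N (\<lambda>x. f x - h x) \<le> L2norm N (\<lambda>x. f x - g x) + L2norm N (\<lambda>x. g x - h x)"
  using L2norm_triangle[OF square_integrable_diff[OF assms(1,2)] square_integrable_diff[OF assms(2,3)]]
  by simp

lemma L2norm_eq_0_iff:
  assumes "square_integrable N f"
  shows "L2norm N f = 0 \<longleftrightarrow> (AE x in N. f x = 0)"
  using assms unfolding L2norm_def square_integrable_def
  by (subst real_sqrt_eq_0_iff, subst integral_nonneg_eq_0_iff_AE) auto

lemma square_integrable_inner:
  fixes f g :: "'a \<Rightarrow> 'b::{real_inner, second_countable_topology}"
  assumes f: "square_integrable N f" and g: "square_integrable N g"
  shows "integrable N (\<lambda>x. f x \<bullet> g x)"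
proof (rule Bochner_Integration.integrable_bound[OF square_integrable_norm_mult[OF f g]])
  show "AE x in N. norm (f x \<bullet> g x) \<le> norm (norm (f x) * norm (g x))"
    by (intro AE_I2) (simp add: Cauchy_Schwarz_ineq2)
qed (use f g in \<open>auto simp: square_integrable_def\<close>)

lemma integral_inner_le:
  fixes f g :: "'a \<Rightarrow> 'b::{real_inner, second_countable_topology}"
  assumes f: "square_integrable N f" and g: "square_integrable N g"
  shows "\<bar>\<integral>x. f x \<bullet> g x \<partial>N\<bar> \<le> L2norm N f * L2norm N g"
proof -
  have "\<bar>\<integral>x. f x \<bullet> g x \<partial>N\<bar> \<le> (\<integral>x. norm (f x) * norm (g x) \<partial>N)"
    by (rule order_trans[OF integral_abs_bound])
      (intro integral_mono integrable_abs square_integrable_inner square_integrable_norm_mult f g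
        Cauchy_Schwarz_ineq2)
  with Cauchy_Schwarz_integral[OF f g] show ?thesis by linarith
qed

lemma tendsto_integral_inner:
  fixes f g :: "nat \<Rightarrow> 'a \<Rightarrow> 'b::{real_inner, second_countable_topology}"
  assumes f: "\<And>k. square_integrable N (f k)" "square_integrable N f'"
      "(\<lambda>k. L2norm N (\<lambda>x. f k x - f' x)) \<longlonglongrightarrow> 0"
    and g: "\<And>k. square_integrable N (g k)" "square_integrable N g'"
      "(\<lambda>k. L2norm N (\<lambda>x. g k x - g' x)) \<longlonglongrightarrow> 0"
  shows "(\<lambda>k. \<integral>x. f k x \<bullet> g k x \<partial>N) \<longlonglongrightarrow> (\<integral>x. f' x \<bullet> g' x \<partial>N)"
proof -
  note si = square_integrable_inner square_integrable_diff f g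
  let ?df = "\<lambda>k x. f k x - f' x" and ?dg = "\<lambda>k x. g k x - g' x"
  \<comment> \<open>Expanding both factors around their limits leaves three terms, each containing
    at least one difference that tends to 0, and the limit itself.\<close>
  have eq: "(\<integral>x. f k x \<bullet> g k x \<partial>N) = (\<integral>x. ?df k x \<bullet> ?dg k x \<partial>N) + (\<integral>x. ?df k x \<bullet> g' x \<partial>N)
      + (\<integral>x. f' x \<bullet> ?dg k x \<partial>N) + (\<integral>x. f' x \<bullet> g' x \<partial>N)" for k
  proof -
    have "(\<integral>x. f k x \<bullet> g k x \<partial>N) = (\<integral>x. ?df k x \<bullet> ?dg k x + ?df k x \<bullet> g' x + f' x \<bullet> ?dg k x + f' x \<bullet> g' x \<partial>N)"
      by (simp add: inner_diff_left inner_diff_right)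
    also have "\<dots> = (\<integral>x. ?df k x \<bullet> ?dg k x \<partial>N) + (\<integral>x. ?df k x \<bullet> g' x \<partial>N)
      + (\<integral>x. f' x \<bullet> ?dg k x \<partial>N) + (\<integral>x. f' x \<bullet> g' x \<partial>N)"
      using si(1)[OF si(2)[OF f(1)[of k] f(2)] si(2)[OF g(1)[of k] g(2)]]
        si(1)[OF si(2)[OF f(1)[of k] f(2)] g(2)] si(1)[OF f(2) si(2)[OF g(1)[of k] g(2)]] si(1)[OF f(2) g(2)]
      by (subst Bochner_Integration.integral_add; (intro Bochner_Integration.integrable_add)?; simp)+
    finally show ?thesis .
  qed
  have z: "(\<lambda>k. \<integral>x. F k x \<bullet> G k x \<partial>N) \<longlonglongrightarrow> 0"
    if "\<And>k. square_integrable N (F k)" "\<And>k. square_integrable N (G k)"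
      "(\<lambda>k. L2norm N (F k) * L2norm N (G k)) \<longlonglongrightarrow> 0" for F G :: "nat \<Rightarrow> 'a \<Rightarrow> 'b"
    by (rule tendsto_rabs_zero_cancel, rule tendsto_sandwich[OF _ _ tendsto_const that(3)])
       (use integral_inner_le[OF that(1,2)] in auto)
  have "(\<lambda>k. (\<integral>x. ?df k x \<bullet> ?dg k x \<partial>N) + (\<integral>x. ?df k x \<bullet> g' x \<partial>N)
      + (\<integral>x. f' x \<bullet> ?dg k x \<partial>N) + (\<integral>x. f' x \<bullet> g' x \<partial>N)) \<longlonglongrightarrow> 0 + 0 + 0 + (\<integral>x. f' x \<bullet> g' x \<partial>N)"
  proof (intro tendsto_add tendsto_const)
    show "(\<lambda>k. \<integral>x. ?df k x \<bullet> ?dg k x \<partial>N) \<longlonglongrightarrow> 0"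
      by (rule z) (intro square_integrable_diff f g tendsto_mult_zero)+
    show "(\<lambda>k. \<integral>x. ?df k x \<bullet> g' x \<partial>N) \<longlonglongrightarrow> 0"
      by (rule z) (intro square_integrable_diff f g tendsto_mult_left_zero)+
    show "(\<lambda>k. \<integral>x. f' x \<bullet> ?dg k x \<partial>N) \<longlonglongrightarrow> 0"
      by (rule z) (intro square_integrable_diff f g tendsto_mult_right_zero)+
  qed
  then show ?thesis unfolding eq by simp
qed

text \<open>Bridge between the extended-valued integrals in \<open>has_ito_integral\<close> and the
  real seminorm in which all estimates are made.\<close>

lemma tendsto_L2norm_iff_nn_integral:
  assumes "\<And>k. square_integrable N (f k)"
  shows "((\<lambda>k. L2norm N (f k)) \<longlonglongrightarrow> 0) \<longleftrightarrow>
    ((\<lambda>k. \<integral>\<^sup>+ x. ennreal ((norm (f k x))\<^sup>2) \<partial>N) \<longlonglongrightarrow> 0)"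
proof -
  have "(\<integral>\<^sup>+ x. ennreal ((norm (f k x))\<^sup>2) \<partial>N) = ennreal ((L2norm N (f k))\<^sup>2)" for k
    unfolding L2norm_squared using assms[of k]
    by (intro nn_integral_eq_integral) (auto simp: square_integrable_def)
  then have "((\<lambda>k. \<integral>\<^sup>+ x. ennreal ((norm (f k x))\<^sup>2) \<partial>N) \<longlonglongrightarrow> 0) \<longleftrightarrow>
      ((\<lambda>k. ennreal ((L2norm N (f k))\<^sup>2)) \<longlonglongrightarrow> ennreal 0)" by simp
  also have "\<dots> \<longleftrightarrow> ((\<lambda>k. (L2norm N (f k))\<^sup>2) \<longlonglongrightarrow> 0)"
    by (intro tendsto_ennreal_iff) auto
  also have "\<dots> \<longleftrightarrow> ((\<lambda>k. L2norm N (f k)) \<longlonglongrightarrow> 0)"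
  proof
    assume "(\<lambda>k. (L2norm N (f k))\<^sup>2) \<longlonglongrightarrow> 0"
    then show "(\<lambda>k. L2norm N (f k)) \<longlonglongrightarrow> 0"
      using tendsto_real_sqrt[of "\<lambda>k. (L2norm N (f k))\<^sup>2" 0] by simp
  qed (use tendsto_power[of "\<lambda>k. L2norm N (f k)" 0 sequentially 2] in simp)
  finally show ?thesis by blast
qed

section \<open>Rapidly converging sequences of square integrable functions\<close>

lemma (in prob_space) nn_integral_norm_le_L2norm:
  assumes f: "square_integrable M f"
  shows "(\<integral>\<^sup>+ x. ennreal (norm (f x)) \<partial>M) \<le> ennreal (L2norm M f)"
proof -
  have 1: "square_integrable M (\<lambda>_. 1 :: real)" by (simp add: square_integrable_def)
  have "integrable M (\<lambda>x. norm (f x))"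
    using square_integrable_norm_mult[OF f 1] by simp
  then have "(\<integral>\<^sup>+ x. ennreal (norm (f x)) \<partial>M) = ennreal (\<integral>x. norm (f x) \<partial>M)"
    by (intro nn_integral_eq_integral) auto
  also have "\<dots> \<le> ennreal (L2norm M f)"
    using Cauchy_Schwarz_integral[OF f 1] by (intro ennreal_leI) (simp add: L2norm_def prob_space)
  finally show ?thesis .
qed

text \<open>The geometric bound makes the expected sum of the increments' norms finite, so the
  increments are absolutely summable almost surely and no subsequence has to be extracted.\<close>

lemma (in prob_space) fast_Cauchy_AE_convergent:
  fixes f :: "nat \<Rightarrow> 'a \<Rightarrow> 'b::{banach, second_countable_topology}"
  assumes f: "\<And>k. square_integrable M (f k)"
    and fast: "\<And>k. L2norm M (\<lambda>x. f (Suc k) x - f k x) \<le> c * (1/2)^k"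
  shows "AE x in M. convergent (\<lambda>k. f k x)"
proof -
  note [measurable] = square_integrable_measurable[OF f]
  have c: "c \<ge> 0" using order_trans[OF L2norm_nonneg fast[of 0]] by simp
  have "(\<integral>\<^sup>+ x. (\<Sum>k. ennreal (norm (f (Suc k) x - f k x))) \<partial>M) =
      (\<Sum>k. \<integral>\<^sup>+ x. ennreal (norm (f (Suc k) x - f k x)) \<partial>M)"
    by (rule nn_integral_suminf) measurable
  also have "\<dots> \<le> (\<Sum>k. ennreal (c * (1/2)^k))"
    using nn_integral_norm_le_L2norm[OF square_integrable_diff[OF f f]] fast
    by (intro suminf_le summableI) (meson ennreal_leI order_trans)
  also have "\<dots> = ennreal (\<Sum>k. c * (1/2)^k)"
    using c by (intro suminf_ennreal2 summable_mult summable_geometric) auto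
  finally have "(\<integral>\<^sup>+ x. (\<Sum>k. ennreal (norm (f (Suc k) x - f k x))) \<partial>M) \<noteq> \<infinity>"
    by (auto simp: top_unique)
  then have "AE x in M. (\<Sum>k. ennreal (norm (f (Suc k) x - f k x))) \<noteq> \<infinity>"
    by (intro nn_integral_PInf_AE) auto
  then show ?thesis
  proof eventually_elim
    case (elim x)
    then have "summable (\<lambda>k. norm (f (Suc k) x - f k x))"
      by (intro summable_suminf_not_top) auto
    then have "summable (\<lambda>k. f (Suc k) x - f k x)" by (rule summable_norm_cancel)
    then have "convergent (\<lambda>n. \<Sum>k<n. f (Suc k) x - f k x)" by (simp add: summable_iff_convergent)
    then have "convergent (\<lambda>n. f n x - f 0 x)" by (simp only: sum_lessThan_telescope[of "\<lambda>k. f k x"])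
    then show ?case by (simp add: convergent_diff_const_right_iff)
  qed
qed

text \<open>Fatou's lemma carries the geometric tail bound from the sequence to its pointwise limit,
  which is thereby also the limit in mean square.\<close>

lemma fast_Cauchy_L2_limit:
  fixes f :: "nat \<Rightarrow> 'a \<Rightarrow> 'b::{banach, second_countable_topology}"
  assumes f: "\<And>k. square_integrable N (f k)" and g: "g \<in> borel_measurable N"
    and fast: "\<And>k. L2norm N (\<lambda>x. f (Suc k) x - f k x) \<le> c * (1/2)^k"
    and lim: "AE x in N. (\<lambda>k. f k x) \<longlonglongrightarrow> g x"
  shows "square_integrable N g" "L2norm N (\<lambda>x. g x - f k x) \<le> 2 * c * (1/2)^k"
proof -
  note [measurable] = square_integrable_measurable[OF f] g
  have c: "c \<ge> 0" using order_trans[OF L2norm_nonneg fast[of 0]] by simp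
  \<comment> \<open>The factor \<open>1 - (1/2)^j\<close> is the partial geometric sum and makes the
    induction close; only the bound without it is used afterwards.\<close>
  have tail: "L2norm N (\<lambda>x. f (k + j) x - f k x) \<le> 2 * c * (1/2)^k * (1 - (1/2)^j)" for k j
  proof (induction j)
    case 0
    then show ?case by (simp add: L2norm_def)
  next
    case (Suc j)
    have "L2norm N (\<lambda>x. f (k + Suc j) x - f k x) \<le>
        L2norm N (\<lambda>x. f (Suc (k + j)) x - f (k + j) x) + L2norm N (\<lambda>x. f (k + j) x - f k x)"
      using L2norm_triangle_diff[OF f f f] by simp
    also have "\<dots> \<le> c * (1/2)^(k+j) + 2 * c * (1/2)^k * (1 - (1/2)^j)"
      by (intro add_mono fast Suc)
    also have "\<dots> = 2 * c * (1/2)^k * (1 - (1/2)^(Suc j))" by (simp add: power_add algebra_simps)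
    finally show ?case .
  qed
  have bound: "(\<integral>\<^sup>+ x. ennreal ((norm (g x - f k x))\<^sup>2) \<partial>N) \<le> ennreal ((2 * c * (1/2)^k)\<^sup>2)" for k
  proof -
    have "(\<integral>\<^sup>+ x. ennreal ((norm (g x - f k x))\<^sup>2) \<partial>N) =
        (\<integral>\<^sup>+ x. liminf (\<lambda>j. ennreal ((norm (f (k + j) x - f k x))\<^sup>2)) \<partial>N)"
    proof (rule nn_integral_cong_AE)
      show "AE x in N. ennreal ((norm (g x - f k x))\<^sup>2) = liminf (\<lambda>j. ennreal ((norm (f (k + j) x - f k x))\<^sup>2))"
        using lim
      proof eventually_elim
        case (elim x)
        then have "(\<lambda>j. f (k + j) x) \<longlonglongrightarrow> g x" using LIMSEQ_ignore_initial_segment[of "\<lambda>j. f j x" "g x" k] by (simp add: add.commute)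
        then have "(\<lambda>j. ennreal ((norm (f (k + j) x - f k x))\<^sup>2)) \<longlonglongrightarrow> ennreal ((norm (g x - f k x))\<^sup>2)"
          by (intro tendsto_ennrealI tendsto_intros)
        then show ?case by (intro lim_imp_Liminf[symmetric]) auto
      qed
    qed
    also have "\<dots> \<le> liminf (\<lambda>j. \<integral>\<^sup>+ x. ennreal ((norm (f (k + j) x - f k x))\<^sup>2) \<partial>N)"
      by (rule nn_integral_liminf) measurable
    also have "\<dots> \<le> liminf (\<lambda>j. ennreal ((2 * c * (1/2)^k)\<^sup>2))"
    proof (intro Liminf_mono always_eventually allI)
      fix j
      have "(\<integral>\<^sup>+ x. ennreal ((norm (f (k + j) x - f k x))\<^sup>2) \<partial>N) = ennreal ((L2norm N (\<lambda>x. f (k + j) x - f k x))\<^sup>2)"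
        unfolding L2norm_squared using square_integrable_diff[OF f[of "k + j"] f[of k]]
        by (intro nn_integral_eq_integral) (auto simp: square_integrable_def)
      also have "\<dots> \<le> ennreal ((2 * c * (1/2)^k)\<^sup>2)"
      proof (intro ennreal_leI power_mono)
        have "2 * c * (1/2)^k * (1 - (1/2)^j) \<le> 2 * c * (1/2)^k * 1"
          using c by (intro mult_left_mono) auto
        then show "L2norm N (\<lambda>x. f (k + j) x - f k x) \<le> 2 * c * (1/2)^k" using tail[of k j] by simp
      qed simp
      finally show "(\<integral>\<^sup>+ x. ennreal ((norm (f (k + j) x - f k x))\<^sup>2) \<partial>N) \<le> ennreal ((2 * c * (1/2)^k)\<^sup>2)" .
    qed
    also have "\<dots> = ennreal ((2 * c * (1/2)^k)\<^sup>2)" by (simp add: Liminf_const)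
    finally show ?thesis .
  qed
  have si: "square_integrable N (\<lambda>x. g x - f k x)" for k
    unfolding square_integrable_def
  proof (intro conjI integrableI_bounded)
    show "(\<integral>\<^sup>+ x. ennreal (norm ((norm (g x - f k x))\<^sup>2)) \<partial>N) < \<infinity>"
      using bound[of k] by (simp add: le_less_trans)
  qed measurable
  show "square_integrable N g" using square_integrable_add[OF si[of 0] f[of 0]] by simp
  have eq: "ennreal ((L2norm N (\<lambda>x. g x - f k x))\<^sup>2) = (\<integral>\<^sup>+ x. ennreal ((norm (g x - f k x))\<^sup>2) \<partial>N)"
    unfolding L2norm_squared using si[of k]
    by (intro nn_integral_eq_integral[symmetric]) (auto simp: square_integrable_def)
  have "ennreal ((L2norm N (\<lambda>x. g x - f k x))\<^sup>2) \<le> ennreal ((2 * c * (1/2)^k)\<^sup>2)"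
    unfolding eq by (rule bound)
  then have "(L2norm N (\<lambda>x. g x - f k x))\<^sup>2 \<le> (2 * c * (1/2)^k)\<^sup>2"
    by (simp only: ennreal_le_iff[OF zero_le_power2])
  then show "L2norm N (\<lambda>x. g x - f k x) \<le> 2 * c * (1/2)^k"
    by (rule power2_le_imp_le) (use c in simp)
qed

text \<open>Integrating the bound of stage \<open>k\<close> from 0 to \<open>t\<close> raises the
  power of \<open>t\<close> by one and divides by \<open>k + 1\<close>, which builds up the
  factorial. Stating it for a sequence covers both Picard convergence and, with a constant sequence,
  uniqueness.\<close>

lemma iterated_Gronwall:
  fixes e :: "nat \<Rightarrow> real \<Rightarrow> real"
  assumes K: "0 \<le> K" and c: "0 \<le> c" and meas: "\<And>k. continuous_on {0..T} (e k)"
    and e0: "\<And>t. t \<in> {0..T} \<Longrightarrow> e 0 t \<le> c"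
    and step: "\<And>k t. t \<in> {0..T} \<Longrightarrow> e (Suc k) t \<le> K * (LINT r:{0..t}|lborel. e k r)"
    and t: "t \<in> {0..T}"
  shows "e k t \<le> c * (K * t)^k / fact k"
  using t
proof (induction k arbitrary: t)
  case 0
  then show ?case using e0 by simp
next
  case (Suc k)
  have "((\<lambda>x. c * K^k / fact k * (x^Suc k / real (Suc k))) has_real_derivative (c * (K * x)^k / fact k)) (at x within S)" for x S
    by (rule derivative_eq_intros refl | simp add: power_mult_distrib)+
  then have "(\<integral>r. indicator {0..t} r *\<^sub>R (c * (K * r)^k / fact k) \<partial>lborel) =
      c * K^k / fact k * (t^Suc k / real (Suc k)) - c * K^k / fact k * (0^Suc k / real (Suc k))"
    using Suc.prems by (intro integral_FTC_Icc)
      (auto intro!: continuous_intros simp: has_real_derivative_iff_has_vector_derivative[symmetric])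
  then have I: "(LINT r:{0..t}|lborel. c * (K * r)^k / fact k) = c * K^k / fact k * (t^Suc k / real (Suc k))"
    unfolding set_lebesgue_integral_def by simp
  have "e (Suc k) t \<le> K * (LINT r:{0..t}|lborel. e k r)" using step Suc.prems by blast
  also have "\<dots> \<le> K * (LINT r:{0..t}|lborel. c * (K * r)^k / fact k)"
  proof (intro mult_left_mono set_integral_mono K)
    show "set_integrable lborel {0..t} (e k)"
      by (rule borel_integrable_atLeastAtMost') (use continuous_on_subset[OF meas] Suc.prems in auto)
    show "set_integrable lborel {0..t} (\<lambda>r. c * (K * r)^k / fact k)"
      by (rule borel_integrable_atLeastAtMost') (auto intro!: continuous_intros)
  qed (use Suc in auto)
  also have "\<dots> = c * (K * t)^Suc k / fact (Suc k)"
    unfolding I by (simp add: power_mult_distrib field_simps)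
  finally show ?case .
qed

text \<open>\<open>(4 x)^k / k!\<close> is a single term of the exponential series of
  \<open>4 x\<close>. The factor \<open>(1/2)^(2 k)\<close> is meant for squared distances: after
  taking roots the rate is \<open>(1/2)^k\<close>.\<close>

lemma power_over_fact_le_geometric:
  assumes "0 \<le> (x::real)"
  shows "x^k / fact k \<le> exp (4 * x) * (1/2)^(2 * k)"
proof -
  have "(4 * x)^k / fact k \<le> exp (4 * x)"
    using assms exp_lower_Taylor_quadratic
  proof -
    have "(\<Sum>i\<in>{k}. inverse (fact i) * (4 * x)^i) \<le> (\<Sum>i. inverse (fact i) * (4 * x)^i)"
      using assms summable_exp[of "4 * x"] by (intro sum_le_suminf) (auto simp: field_simps)
    then show ?thesis by (simp add: exp_def field_simps scaleR_conv_of_real)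
  qed
  moreover have "(4 * x)^k / fact k = (x^k / fact k) * 4^k" by (simp add: power_mult_distrib)
  moreover have "(1/2::real)^(2 * k) = 1 / 4^k" by (simp add: power_mult power_one_over power2_eq_square)
  ultimately show ?thesis by (simp add: field_simps)
qed

section \<open>Processes\<close>

lemma sets_pair_restrict_space_fst:
  assumes A: "A \<in> sets N"
  shows "sets (restrict_space N A \<Otimes>\<^sub>M L) = sets (restrict_space (N \<Otimes>\<^sub>M L) (A \<times> space L))"
proof (rule antisym)
  have AL: "A \<times> space L \<inter> space (N \<Otimes>\<^sub>M L) \<in> sets (N \<Otimes>\<^sub>M L)"
    using A by (intro sets.Int) auto
  have AN: "A \<inter> space N \<in> sets N" using A by auto
  show "sets (restrict_space N A \<Otimes>\<^sub>M L) \<subseteq> sets (restrict_space (N \<Otimes>\<^sub>M L) (A \<times> space L))"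
  proof (rule sets_pair_in_sets)
    fix X Y assume "X \<in> sets (restrict_space N A)" "Y \<in> sets L"
    then show "X \<times> Y \<in> sets (restrict_space (N \<Otimes>\<^sub>M L) (A \<times> space L))"
      unfolding sets_restrict_space_iff[OF AL] sets_restrict_space_iff[OF AN]
      using sets.sets_into_space[of Y L] by auto
  qed
  show "sets (restrict_space (N \<Otimes>\<^sub>M L) (A \<times> space L)) \<subseteq> sets (restrict_space N A \<Otimes>\<^sub>M L)"
  proof
    fix X assume "X \<in> sets (restrict_space (N \<Otimes>\<^sub>M L) (A \<times> space L))"
    then have X: "X \<subseteq> A \<times> space L" "X \<in> sets (N \<Otimes>\<^sub>M L)"
      unfolding sets_restrict_space_iff[OF AL] by auto
    have "(\<lambda>x. (fst x, snd x)) \<in> measurable (restrict_space N A \<Otimes>\<^sub>M L) (N \<Otimes>\<^sub>M L)"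
      by (intro measurable_Pair measurable_compose[OF measurable_fst] measurable_restrict_space1) auto
    from measurable_sets[OF this X(2)]
    have "(\<lambda>x. (fst x, snd x)) -` X \<inter> space (restrict_space N A \<Otimes>\<^sub>M L) \<in> sets (restrict_space N A \<Otimes>\<^sub>M L)" .
    also have "(\<lambda>x. (fst x, snd x)) -` X \<inter> space (restrict_space N A \<Otimes>\<^sub>M L) = X"
      using X(1) sets.sets_into_space[OF A] by (auto simp: space_pair_measure space_restrict_space)
    finally show "X \<in> sets (restrict_space N A \<Otimes>\<^sub>M L)" .
  qed
qed

text \<open>Extending by zero puts processes on different time intervals on one measure space, so
  that integrands with different upper limits can be subtracted and paired.\<close>

definition zero_ext :: "real \<Rightarrow> real \<Rightarrow> (real \<Rightarrow> 'a \<Rightarrow> 'b::real_vector) \<Rightarrow> real \<times> 'a \<Rightarrow> 'b"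
  where "zero_ext s t \<phi> = (\<lambda>(r, \<omega>). indicator {s..t} r *\<^sub>R \<phi> r \<omega>)"

lemma zero_ext_apply[simp]: "zero_ext s t \<phi> (r, \<omega>) = indicator {s..t} r *\<^sub>R \<phi> r \<omega>"
  by (simp add: zero_ext_def)

lemma borel_measurable_zero_ext_iff:
  fixes \<phi> :: "real \<Rightarrow> 'a \<Rightarrow> 'b::real_normed_vector"
  shows "(\<lambda>(q, \<omega>). \<phi> q \<omega>) \<in> borel_measurable (restrict_space borel {s..t} \<Otimes>\<^sub>M L) \<longleftrightarrow>
    zero_ext s t \<phi> \<in> borel_measurable (borel \<Otimes>\<^sub>M L)"
proof -
  have "(\<lambda>(q, \<omega>). \<phi> q \<omega>) \<in> borel_measurable (restrict_space borel {s..t} \<Otimes>\<^sub>M L) \<longleftrightarrow>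
     (\<lambda>(q, \<omega>). \<phi> q \<omega>) \<in> borel_measurable (restrict_space (borel \<Otimes>\<^sub>M L) ({s..t} \<times> space L))"
    by (rule arg_cong2[where f="(\<in>)", OF refl], intro measurable_cong_sets sets_pair_restrict_space_fst refl) simp
  also have "\<dots> \<longleftrightarrow> (\<lambda>x. indicator ({s..t} \<times> space L) x *\<^sub>R (\<lambda>(q, \<omega>). \<phi> q \<omega>) x) \<in> borel_measurable (borel \<Otimes>\<^sub>M L)"
    by (intro borel_measurable_restrict_space_iff sets.Int) auto
  also have "\<dots> \<longleftrightarrow> zero_ext s t \<phi> \<in> borel_measurable (borel \<Otimes>\<^sub>M L)"
    by (intro measurable_cong) (auto simp: space_pair_measure indicator_def)
  finally show ?thesis .
qed

section \<open>Progressive processes on the product of time and probability\<close>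

context usual_filtration
begin

lemma space_F: "t \<in> {0..T} \<Longrightarrow> space (F t) = space P"
  using subalgebra_F unfolding subalgebra_def by blast

lemma measurable_F_P: "f \<in> measurable (F t) N \<Longrightarrow> t \<in> {0..T} \<Longrightarrow> f \<in> measurable P N"
  using measurable_from_subalg subalgebra_F by blast

lemma measurable_F_mono:
  assumes "f \<in> measurable (F s) N" "0 \<le> s" "s \<le> t" "t \<le> T"
  shows "f \<in> measurable (F t) N"
proof -
  have "subalgebra (F t) (F s)"
    using assms sets_F_mono[of s t] space_F[of s] space_F[of t] by (auto simp: subalgebra_def)
  then show ?thesis using assms(1) measurable_from_subalg by blast
qed

abbreviation time_space :: "(real \<times> 'w) measure"
  where "time_space \<equiv> lborel \<Otimes>\<^sub>M P"

abbreviation time_slab :: "real \<Rightarrow> real \<Rightarrow> (real \<times> 'w) set"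
  where "time_slab s t \<equiv> {s..t} \<times> space P"

lemma time_slab_inter_sets[simp]: "time_slab s t \<inter> space time_space \<in> sets time_space"
  by (intro sets.Int pair_measureI sets.top) auto

sublocale time_space: pair_sigma_finite lborel P
  by unfold_locales

lemma measurable_time_space_subalgebra:
  assumes "f \<in> measurable (borel \<Otimes>\<^sub>M F t) N" "t \<in> {0..T}"
  shows "f \<in> measurable time_space N"
proof -
  have "(\<lambda>\<omega>. \<omega>) \<in> measurable P (F t)"
    using subalgebra_F[OF assms(2)] by (auto simp: measurable_def subalgebra_def)
  then have "(\<lambda>x. (fst x, snd x)) \<in> measurable time_space (borel \<Otimes>\<^sub>M F t)"
    by (intro measurable_Pair measurable_compose[OF measurable_snd] measurable_compose[OF measurable_fst]) auto
  from measurable_compose[OF this assms(1)] show ?thesis by simp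
qed

lemma dt_dP_eq: "dt_dP s t = restrict_space time_space (time_slab s t)"
  unfolding dt_dP_def
proof (rule pair_measure_eqI)
  show "sigma_finite_measure (restrict_space lborel {s..t})"
    by (intro sigma_finite_measure_restrict_space sigma_finite_lborel) simp
  show "sigma_finite_measure P" by unfold_locales
  show "sets (restrict_space lborel {s..t} \<Otimes>\<^sub>M P) = sets (restrict_space time_space (time_slab s t))"
    by (rule sets_pair_restrict_space_fst) simp
  fix A B assume A: "A \<in> sets (restrict_space lborel {s..t})" and B: "B \<in> sets P"
  have A': "A \<subseteq> {s..t}" "A \<in> sets lborel" using A by (auto simp: sets_restrict_space_iff)
  then show "emeasure (restrict_space lborel {s..t}) A * emeasure P B =
      emeasure (restrict_space time_space (time_slab s t)) (A \<times> B)"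
    using B sets.sets_into_space[OF B]
    by (subst (1 2) emeasure_restrict_space) (auto simp: emeasure_pair_measure_Times)
qed

lemma indicator_time_slab: "x \<in> space time_space \<Longrightarrow> indicator (time_slab s t) x = indicator {s..t} (fst x)"
  by (cases x) (auto simp: space_pair_measure indicator_def)

lemma integrable_dt_dP_iff:
  fixes f :: "real \<times> 'w \<Rightarrow> 'b::{banach, second_countable_topology}"
  shows "integrable (dt_dP s t) f \<longleftrightarrow> integrable time_space (\<lambda>x. indicator {s..t} (fst x) *\<^sub>R f x)"
  unfolding dt_dP_eq
  by (subst integrable_restrict_space) (auto intro!: Bochner_Integration.integrable_cong simp: indicator_time_slab)

lemma integral_dt_dP:
  fixes f :: "real \<times> 'w \<Rightarrow> 'b::{banach, second_countable_topology}"
  shows "integral\<^sup>L (dt_dP s t) f = (\<integral>x. indicator {s..t} (fst x) *\<^sub>R f x \<partial>time_space)"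
  unfolding dt_dP_eq
  by (subst integral_restrict_space) (auto intro!: Bochner_Integration.integral_cong simp: indicator_time_slab)

lemma nn_integral_dt_dP:
  "integral\<^sup>N (dt_dP s t) f = (\<integral>\<^sup>+ x. indicator {s..t} (fst x) * f x \<partial>time_space)"
  unfolding dt_dP_eq
  by (subst nn_integral_restrict_space) (auto intro!: nn_integral_cong simp: indicator_time_slab mult.commute)

lemma AE_dt_dP_iff:
  "(AE x in dt_dP s t. Q x) \<longleftrightarrow> (AE x in time_space. fst x \<in> {s..t} \<longrightarrow> Q x)"
  unfolding dt_dP_eq
  by (subst AE_restrict_space_iff, simp) (intro AE_cong, auto simp: space_pair_measure)

lemma integrable_norm_squared_dt_dP_iff:
  fixes \<phi> :: "real \<Rightarrow> 'w \<Rightarrow> 'b::real_normed_vector"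
  shows "integrable (dt_dP s t) (\<lambda>(r, \<omega>). (norm (\<phi> r \<omega>))\<^sup>2) \<longleftrightarrow>
    integrable time_space (\<lambda>x. (norm (zero_ext s t \<phi> x))\<^sup>2)"
  unfolding integrable_dt_dP_iff
  by (intro Bochner_Integration.integrable_cong) (auto simp: zero_ext_def indicator_def)

lemma L2norm_dt_dP:
  fixes \<phi> :: "real \<Rightarrow> 'w \<Rightarrow> 'b::real_normed_vector"
  shows "L2norm (dt_dP s t) (\<lambda>(r, \<omega>). \<phi> r \<omega>) = L2norm time_space (zero_ext s t \<phi>)"
  unfolding L2norm_def integral_dt_dP
  by (intro arg_cong[where f=sqrt] Bochner_Integration.integral_cong) (auto simp: zero_ext_def indicator_def)

lemma prog_measurable_iff:
  fixes \<phi> :: "real \<Rightarrow> 'w \<Rightarrow> 'b::{real_normed_vector, second_countable_topology}"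
  shows "prog_measurable s t \<phi> \<longleftrightarrow> (\<forall>r\<in>{s..t}. zero_ext s r \<phi> \<in> borel_measurable (borel \<Otimes>\<^sub>M F r))"
  unfolding prog_measurable_def strongly_measurable_iff_borel borel_measurable_zero_ext_iff ..

lemma prog_measurable_zero_ext:
  fixes \<phi> :: "real \<Rightarrow> 'w \<Rightarrow> 'b::{real_normed_vector, second_countable_topology}"
  assumes "prog_measurable s t \<phi>" "r \<in> {s..t}"
  shows "zero_ext s r \<phi> \<in> borel_measurable (borel \<Otimes>\<^sub>M F r)"
  using assms unfolding prog_measurable_iff by blast

lemma prog_measurable_zero_ext_time_space:
  fixes \<phi> :: "real \<Rightarrow> 'w \<Rightarrow> 'b::{real_normed_vector, second_countable_topology}"
  assumes "prog_measurable s t \<phi>" "0 \<le> s" "t \<le> T"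
  shows "zero_ext s t \<phi> \<in> borel_measurable time_space"
proof (cases "s \<le> t")
  case True
  then show ?thesis
    using assms by (intro measurable_time_space_subalgebra[of _ t] prog_measurable_zero_ext[of s t]) auto
next
  case False
  then have "zero_ext s t \<phi> = (\<lambda>_. 0)" by (auto simp: zero_ext_def)
  then show ?thesis by simp
qed

lemma prog_measurable_section:
  fixes \<phi> :: "real \<Rightarrow> 'w \<Rightarrow> 'b::{real_normed_vector, second_countable_topology}"
  assumes "prog_measurable s t \<phi>" "r \<in> {s..t}"
  shows "\<phi> r \<in> borel_measurable (F r)"
proof -
  have "(\<lambda>\<omega>. (r, \<omega>)) \<in> measurable (F r) (borel \<Otimes>\<^sub>M F r)" by simp
  from measurable_compose[OF this prog_measurable_zero_ext[OF assms]] show ?thesis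
    using assms(2) by simp
qed

lemma prog_measurable_subinterval:
  "prog_measurable s t \<phi> \<Longrightarrow> t' \<le> t \<Longrightarrow> prog_measurable s t' \<phi>"
  unfolding prog_measurable_def by auto

lemma L2_F_iff:
  fixes \<phi> :: "real \<Rightarrow> 'w \<Rightarrow> 'b::{real_normed_vector, second_countable_topology}"
  assumes "0 \<le> s" "t \<le> T"
  shows "L2_F s t \<phi> \<longleftrightarrow> prog_measurable s t \<phi> \<and> square_integrable time_space (zero_ext s t \<phi>)"
proof -
  have "integrable (dt_dP s t) (\<lambda>(r, \<omega>). (norm (\<phi> r \<omega>))\<^sup>2) \<longleftrightarrow> square_integrable time_space (zero_ext s t \<phi>)"
      if "prog_measurable s t \<phi>"
    unfolding integrable_norm_squared_dt_dP_iff square_integrable_def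
    using prog_measurable_zero_ext_time_space[OF that assms] by simp
  then show ?thesis unfolding L2_F_def by blast
qed

lemma strongly_measurable_dt_dP:
  assumes "prog_measurable s t \<phi>" "0 \<le> s" "s \<le> t" "t \<le> T"
  shows "strongly_measurable (dt_dP s t) (\<lambda>(r, \<omega>). \<phi> r \<omega>)"
proof -
  have 1: "strongly_measurable (restrict_space borel {s..t} \<Otimes>\<^sub>M F t) (\<lambda>(q, \<omega>). \<phi> q \<omega>)"
    using assms unfolding prog_measurable_def by auto
  have "(\<lambda>\<omega>. \<omega>) \<in> measurable P (F t)"
    using subalgebra_F[of t] assms by (auto simp: measurable_def subalgebra_def)
  then have "(\<lambda>x. (fst x, snd x)) \<in> measurable (dt_dP s t) (restrict_space borel {s..t} \<Otimes>\<^sub>M F t)"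
    unfolding dt_dP_def
    by (intro measurable_Pair measurable_compose[OF measurable_snd] measurable_compose[OF measurable_fst])
      (auto intro!: measurable_restrict_space2 measurable_restrict_space1 simp: space_restrict_space)
  from strongly_measurable_compose[OF 1 this] show ?thesis by simp
qed

lemma prog_measurable_continuous2:
  fixes h :: "'b::metric_space \<Rightarrow> 'c::metric_space \<Rightarrow> 'd::metric_space"
  assumes "prog_measurable s t \<phi>" "prog_measurable s t \<psi>" "continuous_on UNIV (\<lambda>(x, y). h x y)"
  shows "prog_measurable s t (\<lambda>r \<omega>. h (\<phi> r \<omega>) (\<psi> r \<omega>))"
  unfolding prog_measurable_def
proof
  fix r assume "r \<in> {s..t}"
  then show "strongly_measurable (restrict_space borel {s..r} \<Otimes>\<^sub>M F r) (\<lambda>(q, \<omega>). h (\<phi> q \<omega>) (\<psi> q \<omega>))"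
    using strongly_measurable_continuous2[OF _ _ assms(3), of _ "\<lambda>(q, \<omega>). \<phi> q \<omega>" "\<lambda>(q, \<omega>). \<psi> q \<omega>"] assms(1,2)
    unfolding prog_measurable_def by (simp add: case_prod_unfold)
qed

text \<open>The values may lie in a non-separable space, where a sum of Borel functions need not be
  Borel; measurability therefore comes from strong measurability of a continuous function of two
  processes.\<close>

lemma L2_F_add:
  fixes \<phi> \<psi> :: "real \<Rightarrow> 'w \<Rightarrow> 'b::real_normed_vector"
  assumes \<phi>: "L2_F s t \<phi>" and \<psi>: "L2_F s t \<psi>" and st: "0 \<le> s" "s \<le> t" "t \<le> T"
  shows "L2_F s t (\<lambda>r \<omega>. \<phi> r \<omega> + \<psi> r \<omega>)"
proof -
  have p: "prog_measurable s t (\<lambda>r \<omega>. \<phi> r \<omega> + \<psi> r \<omega>)"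
    using \<phi> \<psi> unfolding L2_F_def
    by (intro prog_measurable_continuous2[where h="(+)"]) (auto intro!: continuous_intros simp: case_prod_unfold)
  have "integrable (dt_dP s t) (\<lambda>(r, \<omega>). (norm (\<phi> r \<omega> + \<psi> r \<omega>))\<^sup>2)"
  proof (rule Bochner_Integration.integrable_bound)
    show "integrable (dt_dP s t) (\<lambda>x. 2 * (\<lambda>(r, \<omega>). (norm (\<phi> r \<omega>))\<^sup>2) x + 2 * (\<lambda>(r, \<omega>). (norm (\<psi> r \<omega>))\<^sup>2) x)"
      using \<phi> \<psi> by (simp add: L2_F_def)
    have "(\<lambda>(r, \<omega>). \<phi> r \<omega> + \<psi> r \<omega>) \<in> borel_measurable (dt_dP s t)"
      using strongly_measurable_dt_dP[OF p st] by (simp add: strongly_measurable_def)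
    then have "(\<lambda>x. (norm ((\<lambda>(r, \<omega>). \<phi> r \<omega> + \<psi> r \<omega>) x))\<^sup>2) \<in> borel_measurable (dt_dP s t)" by measurable
    then show "(\<lambda>(r, \<omega>). (norm (\<phi> r \<omega> + \<psi> r \<omega>))\<^sup>2) \<in> borel_measurable (dt_dP s t)"
      by (simp add: case_prod_unfold)
    show "AE x in dt_dP s t. norm (case x of (r, \<omega>) \<Rightarrow> (norm (\<phi> r \<omega> + \<psi> r \<omega>))\<^sup>2)
        \<le> norm (2 * (case x of (r, \<omega>) \<Rightarrow> (norm (\<phi> r \<omega>))\<^sup>2) + 2 * (case x of (r, \<omega>) \<Rightarrow> (norm (\<psi> r \<omega>))\<^sup>2))"
      using norm_add_squared_le by (intro AE_I2) (auto simp: case_prod_unfold)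
  qed
  with p show ?thesis by (simp add: L2_F_def)
qed

text \<open>One statement for applying operators and for applying their adjoints. The second
  conclusion bounds all vectors simultaneously outside one null set, so the same constant serves
  every process.\<close>

lemma L2_F_bounded_bilinear:
  fixes K :: "real \<Rightarrow> 'w \<Rightarrow> 'a::real_normed_vector" and \<phi> :: "real \<Rightarrow> 'w \<Rightarrow> 'b::real_normed_vector"
    and h :: "'a \<Rightarrow> 'b \<Rightarrow> 'c::real_normed_vector"
  assumes h: "bounded_bilinear h" and K: "Linf_F s t K" and \<phi>: "L2_F s t \<phi>"
    and st: "0 \<le> s" "s \<le> t" "t \<le> T"
  shows "L2_F s t (\<lambda>r \<omega>. h (K r \<omega>) (\<phi> r \<omega>))"
    "\<exists>c\<ge>0. AE (r, \<omega>) in dt_dP s t. \<forall>x. norm (h (K r \<omega>) x) \<le> c * norm x"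
proof -
  interpret h: bounded_bilinear h by fact
  obtain b where b: "b > 0" "\<And>x y. norm (h x y) \<le> norm x * norm y * b" using h.pos_bounded by blast
  obtain k where k: "AE (r, \<omega>) in dt_dP s t. norm (K r \<omega>) \<le> k" using K unfolding Linf_F_def by blast
  define c where "c = \<bar>k\<bar> * b"
  have c: "AE x in dt_dP s t. \<forall>y. norm (h (K (fst x) (snd x)) y) \<le> c * norm y"
    using k
  proof eventually_elim
    case (elim x)
    have "norm (h (K (fst x) (snd x)) y) \<le> c * norm y" for y
    proof -
      have "norm (h (K (fst x) (snd x)) y) \<le> norm (K (fst x) (snd x)) * norm y * b" by (rule b)
      also have "\<dots> \<le> \<bar>k\<bar> * norm y * b"
        using elim b(1) by (intro mult_right_mono) (auto simp: case_prod_unfold)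
      finally show ?thesis by (simp add: c_def mult_ac)
    qed
    then show ?case by blast
  qed
  then show "\<exists>c\<ge>0. AE (r, \<omega>) in dt_dP s t. \<forall>x. norm (h (K r \<omega>) x) \<le> c * norm x"
    using b(1) by (intro exI[of _ c]) (auto simp: c_def case_prod_unfold)
  have p: "prog_measurable s t (\<lambda>r \<omega>. h (K r \<omega>) (\<phi> r \<omega>))"
    by (rule prog_measurable_continuous2[where h=h])
      (use K \<phi> in \<open>auto intro!: h.continuous_on continuous_intros simp: case_prod_unfold Linf_F_def L2_F_def\<close>)
  have "integrable (dt_dP s t) (\<lambda>(r, \<omega>). (norm (h (K r \<omega>) (\<phi> r \<omega>)))\<^sup>2)"
  proof (rule Bochner_Integration.integrable_bound)
    show "integrable (dt_dP s t) (\<lambda>x. c\<^sup>2 * (\<lambda>(r, \<omega>). (norm (\<phi> r \<omega>))\<^sup>2) x)"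
      using \<phi> by (simp add: L2_F_def)
    have "(\<lambda>(r, \<omega>). h (K r \<omega>) (\<phi> r \<omega>)) \<in> borel_measurable (dt_dP s t)"
      using strongly_measurable_dt_dP[OF p st] by (simp add: strongly_measurable_def)
    then have "(\<lambda>x. (norm ((\<lambda>(r, \<omega>). h (K r \<omega>) (\<phi> r \<omega>)) x))\<^sup>2) \<in> borel_measurable (dt_dP s t)" by measurable
    then show "(\<lambda>(r, \<omega>). (norm (h (K r \<omega>) (\<phi> r \<omega>)))\<^sup>2) \<in> borel_measurable (dt_dP s t)"
      by (simp add: case_prod_unfold)
    show "AE x in dt_dP s t. norm (case x of (r, \<omega>) \<Rightarrow> (norm (h (K r \<omega>) (\<phi> r \<omega>)))\<^sup>2)
        \<le> norm (c\<^sup>2 * (case x of (r, \<omega>) \<Rightarrow> (norm (\<phi> r \<omega>))\<^sup>2))"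
      using c
    proof eventually_elim
      case (elim x)
      then have "(norm (h (K (fst x) (snd x)) (\<phi> (fst x) (snd x))))\<^sup>2 \<le> (c * norm (\<phi> (fst x) (snd x)))\<^sup>2"
        by (intro power_mono) auto
      then show ?case by (simp add: case_prod_unfold power_mult_distrib)
    qed
  qed
  with p show "L2_F s t (\<lambda>r \<omega>. h (K r \<omega>) (\<phi> r \<omega>))" by (simp add: L2_F_def)
qed

lemma L2_F_scaleR:
  fixes \<phi> :: "real \<Rightarrow> 'w \<Rightarrow> 'b::real_normed_vector"
  assumes "L2_F s t \<phi>"
  shows "L2_F s t (\<lambda>r \<omega>. c *\<^sub>R \<phi> r \<omega>)"
proof -
  have "prog_measurable s t (\<lambda>r \<omega>. c *\<^sub>R \<phi> r \<omega>)"
    using assms unfolding L2_F_def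
    by (intro prog_measurable_continuous2[of s t \<phi> \<phi> "\<lambda>x y. c *\<^sub>R x"])
      (auto intro!: continuous_intros simp: case_prod_unfold)
  moreover have "integrable (dt_dP s t) (\<lambda>x. c\<^sup>2 * (\<lambda>(r, \<omega>). (norm (\<phi> r \<omega>))\<^sup>2) x)"
    using assms by (simp add: L2_F_def)
  ultimately show ?thesis unfolding L2_F_def by (simp add: case_prod_unfold power_mult_distrib)
qed

lemma L2_F_diff:
  fixes \<phi> \<psi> :: "real \<Rightarrow> 'w \<Rightarrow> 'b::real_normed_vector"
  assumes "L2_F s t \<phi>" "L2_F s t \<psi>" "0 \<le> s" "s \<le> t" "t \<le> T"
  shows "L2_F s t (\<lambda>r \<omega>. \<phi> r \<omega> - \<psi> r \<omega>)"
  using L2_F_add[OF assms(1) L2_F_scaleR[OF assms(2), of "-1"] assms(3-5)] by simp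

lemma L2_F_subinterval:
  fixes \<phi> :: "real \<Rightarrow> 'w \<Rightarrow> 'b::real_normed_vector"
  assumes "L2_F s t \<phi>" "t' \<le> t"
  shows "L2_F s t' \<phi>"
proof -
  have "integrable time_space (\<lambda>x. indicator {s..t} (fst x) *\<^sub>R (\<lambda>(r, \<omega>). (norm (\<phi> r \<omega>))\<^sup>2) x)"
    using assms(1) by (simp only: L2_F_def integrable_dt_dP_iff)
  then have "integrable time_space (\<lambda>x. indicator (time_slab s t') x *\<^sub>R (indicator {s..t} (fst x) *\<^sub>R (\<lambda>(r, \<omega>). (norm (\<phi> r \<omega>))\<^sup>2) x))"
    by (intro integrable_mult_indicator pair_measureI sets.top) auto
  also have "?this \<longleftrightarrow> integrable time_space (\<lambda>x. indicator {s..t'} (fst x) *\<^sub>R (\<lambda>(r, \<omega>). (norm (\<phi> r \<omega>))\<^sup>2) x)"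
    using assms(2) by (intro Bochner_Integration.integrable_cong) (auto simp: indicator_def space_pair_measure)
  finally show ?thesis
    using assms prog_measurable_subinterval unfolding L2_F_def integrable_dt_dP_iff by blast
qed

text \<open>The cost and the transposition identity are written with iterated integrals, the
  variational computation with integrals over the product; Fubini translates in both
  directions.\<close>

lemma integral_dt_dP_iterated:
  fixes g :: "real \<Rightarrow> 'w \<Rightarrow> 'b::{banach, second_countable_topology}"
  assumes "integrable (dt_dP s t) (\<lambda>(r, \<omega>). g r \<omega>)"
  shows "(\<integral>\<omega>. (LINT r:{s..t}|lborel. g r \<omega>) \<partial>P) = integral\<^sup>L (dt_dP s t) (\<lambda>(r, \<omega>). g r \<omega>)"
    "(LINT r:{s..t}|lborel. (\<integral>\<omega>. g r \<omega> \<partial>P)) = integral\<^sup>L (dt_dP s t) (\<lambda>(r, \<omega>). g r \<omega>)"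
    "integrable P (\<lambda>\<omega>. LINT r:{s..t}|lborel. g r \<omega>)"
    "AE \<omega> in P. set_integrable lborel {s..t} (\<lambda>r. g r \<omega>)"
    "set_integrable lborel {s..t} (\<lambda>r. \<integral>\<omega>. g r \<omega> \<partial>P)"
    "AE r in lborel. r \<in> {s..t} \<longrightarrow> integrable P (g r)"
proof -
  let ?f = "\<lambda>(r, \<omega>). indicator {s..t} r *\<^sub>R g r \<omega>"
  have f: "integrable time_space ?f"
    using assms unfolding integrable_dt_dP_iff by (simp add: case_prod_unfold)
  have e: "integral\<^sup>L (dt_dP s t) (\<lambda>(r, \<omega>). g r \<omega>) = integral\<^sup>L time_space ?f"
    unfolding integral_dt_dP by (simp add: case_prod_unfold)
  show "(\<integral>\<omega>. (LINT r:{s..t}|lborel. g r \<omega>) \<partial>P) = integral\<^sup>L (dt_dP s t) (\<lambda>(r, \<omega>). g r \<omega>)"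
    unfolding set_lebesgue_integral_def e by (rule time_space.integral_snd[OF f])
  have "(\<integral>\<omega>. indicator {s..t} r *\<^sub>R g r \<omega> \<partial>P) = indicator {s..t} r *\<^sub>R (\<integral>\<omega>. g r \<omega> \<partial>P)" for r
    by (cases "r \<in> {s..t}") auto
  note i = this
  show "(LINT r:{s..t}|lborel. (\<integral>\<omega>. g r \<omega> \<partial>P)) = integral\<^sup>L (dt_dP s t) (\<lambda>(r, \<omega>). g r \<omega>)"
    unfolding set_lebesgue_integral_def e using time_space.integral_fst[OF f] unfolding i .
  show "integrable P (\<lambda>\<omega>. LINT r:{s..t}|lborel. g r \<omega>)"
    unfolding set_lebesgue_integral_def by (rule time_space.integrable_snd[OF f])
  show "AE \<omega> in P. set_integrable lborel {s..t} (\<lambda>r. g r \<omega>)"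
    unfolding set_integrable_def by (rule time_space.AE_integrable_snd[OF f])
  show "set_integrable lborel {s..t} (\<lambda>r. \<integral>\<omega>. g r \<omega> \<partial>P)"
    unfolding set_integrable_def using time_space.integrable_fst[OF f] unfolding i .
  show "AE r in lborel. r \<in> {s..t} \<longrightarrow> integrable P (g r)"
    using time_space.AE_integrable_fst[OF f] by eventually_elim auto
qed

text \<open>The drift of a state is obtained as a square integrable process, whereas the
  transposition identity asks for a test drift of class \<open>L1_F_L2\<close>.\<close>

lemma L2_F_imp_L1_F_L2:
  fixes \<phi> :: "real \<Rightarrow> 'w \<Rightarrow> 'b::real_normed_vector"
  assumes "L2_F s t \<phi>"
  shows "L1_F_L2 s t \<phi>"
proof -
  note I = integral_dt_dP_iterated[of s t "\<lambda>r \<omega>. (norm (\<phi> r \<omega>))\<^sup>2"]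
  have 0: "integrable (dt_dP s t) (\<lambda>(r, \<omega>). (norm (\<phi> r \<omega>))\<^sup>2)" using assms by (simp add: L2_F_def)
  have "AE r in restrict_space lborel {s..t}. integrable P (\<lambda>\<omega>. (norm (\<phi> r \<omega>))\<^sup>2)"
    using I(6)[OF 0] by (subst AE_restrict_space_iff) auto
  moreover have "set_integrable lborel {s..t} (\<lambda>r. sqrt (\<integral>\<omega>. (norm (\<phi> r \<omega>))\<^sup>2 \<partial>P))"
    unfolding set_integrable_def
  proof (rule Bochner_Integration.integrable_bound)
    let ?e = "\<lambda>r. \<integral>\<omega>. (norm (\<phi> r \<omega>))\<^sup>2 \<partial>P"
    have e: "integrable lborel (\<lambda>r. indicator {s..t} r *\<^sub>R ?e r)"
      using I(5)[OF 0] by (simp add: set_integrable_def)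
    then show "integrable lborel (\<lambda>r. indicator {s..t} r * 1 + indicator {s..t} r *\<^sub>R ?e r)"
      by (intro Bochner_Integration.integrable_add) (auto simp: emeasure_lborel_Icc_eq)
    have "(\<lambda>r. sqrt (indicator {s..t} r *\<^sub>R ?e r)) \<in> borel_measurable lborel"
      using borel_measurable_integrable[OF e] by measurable
    also have "(\<lambda>r. sqrt (indicator {s..t} r *\<^sub>R ?e r)) = (\<lambda>r. indicator {s..t} r *\<^sub>R sqrt (?e r))"
      by (auto simp: indicator_def fun_eq_iff)
    finally show "(\<lambda>r. indicator {s..t} r *\<^sub>R sqrt (?e r)) \<in> borel_measurable lborel" .
    \<comment> \<open>Dominates the root by a function that is integrable because the interval is
      bounded.\<close>
    have "sqrt a \<le> 1 + a" if "a \<ge> 0" for a :: real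
      by (rule real_le_lsqrt) (use that in \<open>auto simp: power2_sum\<close>)
    moreover have "?e r \<ge> 0" for r by (intro integral_nonneg_AE) auto
    ultimately show "AE r in lborel. norm (indicator {s..t} r *\<^sub>R sqrt (?e r)) \<le> norm (indicator {s..t} r * 1 + indicator {s..t} r *\<^sub>R ?e r)"
      by (intro AE_I2) (auto simp: indicator_def abs_of_nonneg)
  qed
  ultimately show ?thesis using assms unfolding L1_F_L2_def L2_F_def by blast
qed

section \<open>Mean square continuity and progressive modifications\<close>

lemma C_F_iff:
  fixes \<phi> :: "real \<Rightarrow> 'w \<Rightarrow> 'b::{real_normed_vector, second_countable_topology}"
  assumes "0 \<le> s" "t \<le> T"
  shows "C_F s t \<phi> \<longleftrightarrow> prog_measurable s t \<phi> \<and> (\<forall>r\<in>{s..t}. square_integrable P (\<phi> r)) \<and>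
    (\<forall>r\<in>{s..t}. ((\<lambda>q. L2norm P (\<lambda>\<omega>. \<phi> q \<omega> - \<phi> r \<omega>)) \<longlongrightarrow> 0) (at r within {s..t}))"
proof -
  have eq: "((\<lambda>q. \<integral>\<omega>. (norm (\<phi> q \<omega> - \<phi> r \<omega>))\<^sup>2 \<partial>P) \<longlongrightarrow> 0) (at r within {s..t}) \<longleftrightarrow>
     ((\<lambda>q. L2norm P (\<lambda>\<omega>. \<phi> q \<omega> - \<phi> r \<omega>)) \<longlongrightarrow> 0) (at r within {s..t})" for r
  proof
    assume "((\<lambda>q. \<integral>\<omega>. (norm (\<phi> q \<omega> - \<phi> r \<omega>))\<^sup>2 \<partial>P) \<longlongrightarrow> 0) (at r within {s..t})"
    from tendsto_real_sqrt[OF this]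
    show "((\<lambda>q. L2norm P (\<lambda>\<omega>. \<phi> q \<omega> - \<phi> r \<omega>)) \<longlongrightarrow> 0) (at r within {s..t})" by (simp add: L2norm_def)
  next
    assume "((\<lambda>q. L2norm P (\<lambda>\<omega>. \<phi> q \<omega> - \<phi> r \<omega>)) \<longlongrightarrow> 0) (at r within {s..t})"
    from tendsto_power[OF this, of 2]
    show "((\<lambda>q. \<integral>\<omega>. (norm (\<phi> q \<omega> - \<phi> r \<omega>))\<^sup>2 \<partial>P) \<longlongrightarrow> 0) (at r within {s..t})" by (simp add: L2norm_squared)
  qed
  have "L2_rv T (\<phi> r) \<longleftrightarrow> square_integrable P (\<phi> r)" if p: "prog_measurable s t \<phi>" and r: "r \<in> {s..t}" for r
  proof -
    have m: "\<phi> r \<in> borel_measurable (F T)"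
      by (rule measurable_F_mono[OF prog_measurable_section[OF p r]]) (use r assms in auto)
    have "\<phi> r \<in> borel_measurable P" by (rule measurable_F_P[OF m]) (use T_pos in auto)
    with m show ?thesis unfolding L2_rv_def square_integrable_def strongly_measurable_iff_borel by simp
  qed
  then show ?thesis unfolding C_F_def eq by blast
qed

lemma continuous_on_L2norm_diff:
  fixes \<phi> \<psi> :: "real \<Rightarrow> 'w \<Rightarrow> 'b::{real_normed_vector, second_countable_topology}"
  assumes \<phi>: "\<And>r. r \<in> S \<Longrightarrow> square_integrable P (\<phi> r)"
      "\<And>r. r \<in> S \<Longrightarrow> ((\<lambda>q. L2norm P (\<lambda>\<omega>. \<phi> q \<omega> - \<phi> r \<omega>)) \<longlongrightarrow> 0) (at r within S)"
    and \<psi>: "\<And>r. r \<in> S \<Longrightarrow> square_integrable P (\<psi> r)"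
      "\<And>r. r \<in> S \<Longrightarrow> ((\<lambda>q. L2norm P (\<lambda>\<omega>. \<psi> q \<omega> - \<psi> r \<omega>)) \<longlongrightarrow> 0) (at r within S)"
  shows "continuous_on S (\<lambda>r. L2norm P (\<lambda>\<omega>. \<phi> r \<omega> - \<psi> r \<omega>))"
  unfolding continuous_on_def
proof
  fix r assume r: "r \<in> S"
  let ?d = "\<lambda>a b. L2norm P (\<lambda>\<omega>. a \<omega> - b \<omega>)"
  show "((\<lambda>r. ?d (\<phi> r) (\<psi> r)) \<longlongrightarrow> ?d (\<phi> r) (\<psi> r)) (at r within S)"
  proof (rule LIM_zero_cancel, rule Lim_null_comparison)
    show "((\<lambda>q. ?d (\<phi> q) (\<phi> r) + ?d (\<psi> q) (\<psi> r)) \<longlongrightarrow> 0) (at r within S)"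
      using tendsto_add[OF \<phi>(2)[OF r] \<psi>(2)[OF r]] by simp
    show "\<forall>\<^sub>F q in at r within S. norm (?d (\<phi> q) (\<psi> q) - ?d (\<phi> r) (\<psi> r)) \<le> ?d (\<phi> q) (\<phi> r) + ?d (\<psi> q) (\<psi> r)"
      unfolding eventually_at_filter
    proof (intro always_eventually allI impI)
      fix q assume q: "q \<in> S"
      have "?d (\<phi> q) (\<psi> q) \<le> ?d (\<phi> q) (\<phi> r) + (?d (\<phi> r) (\<psi> r) + ?d (\<psi> r) (\<psi> q))"
        using L2norm_triangle_diff[OF \<phi>(1)[OF q] \<phi>(1)[OF r] \<psi>(1)[OF q]]
          L2norm_triangle_diff[OF \<phi>(1)[OF r] \<psi>(1)[OF r] \<psi>(1)[OF q]] by linarith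
      moreover have "?d (\<phi> r) (\<psi> r) \<le> ?d (\<phi> r) (\<phi> q) + (?d (\<phi> q) (\<psi> q) + ?d (\<psi> q) (\<psi> r))"
        using L2norm_triangle_diff[OF \<phi>(1)[OF r] \<phi>(1)[OF q] \<psi>(1)[OF r]]
          L2norm_triangle_diff[OF \<phi>(1)[OF q] \<psi>(1)[OF q] \<psi>(1)[OF r]] by linarith
      ultimately show "norm (?d (\<phi> q) (\<psi> q) - ?d (\<phi> r) (\<psi> r)) \<le> ?d (\<phi> q) (\<phi> r) + ?d (\<psi> q) (\<psi> r)"
        using L2norm_minus_commute[of P "\<phi> q" "\<phi> r"] L2norm_minus_commute[of P "\<psi> q" "\<psi> r"] by auto
    qed
  qed
qed

lemma C_F_continuous_on_L2norm_diff:
  fixes \<phi> \<psi> :: "real \<Rightarrow> 'w \<Rightarrow> 'b::{real_normed_vector, second_countable_topology}"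
  assumes "C_F s t \<phi>" "C_F s t \<psi>" "0 \<le> s" "t \<le> T"
  shows "continuous_on {s..t} (\<lambda>r. L2norm P (\<lambda>\<omega>. \<phi> r \<omega> - \<psi> r \<omega>))"
  using assms(1,2) unfolding C_F_iff[OF assms(3,4)] by (intro continuous_on_L2norm_diff) auto

lemma C_F_zero: "C_F s t (\<lambda>_ _. 0 :: 'b::{real_normed_vector, second_countable_topology})"
  if "0 \<le> s" "t \<le> T"
  unfolding C_F_iff[OF that] prog_measurable_iff zero_ext_def by (simp add: L2norm_def)

text \<open>Common source of square integrability in time for mean square continuous processes, for
  processes that are right continuous with left limits, and for the limit of the Picard
  iteration.\<close>

lemma L2_F_of_bounded_L2norm:
  fixes \<phi> :: "real \<Rightarrow> 'w \<Rightarrow> 'b::{real_normed_vector, second_countable_topology}"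
  assumes p: "prog_measurable s t \<phi>" and sq: "\<And>r. r \<in> {s..t} \<Longrightarrow> square_integrable P (\<phi> r)"
    and c: "\<And>r. r \<in> {s..t} \<Longrightarrow> L2norm P (\<phi> r) \<le> c" and st: "0 \<le> s" "s \<le> t" "t \<le> T"
  shows "L2_F s t \<phi>"
proof -
  have m[measurable]: "zero_ext s t \<phi> \<in> borel_measurable time_space"
    by (rule prog_measurable_zero_ext_time_space[OF p st(1,3)])
  have "(\<integral>\<^sup>+ x. ennreal ((norm (zero_ext s t \<phi> x))\<^sup>2) \<partial>time_space) =
      (\<integral>\<^sup>+ r. \<integral>\<^sup>+ \<omega>. ennreal ((norm (zero_ext s t \<phi> (r, \<omega>)))\<^sup>2) \<partial>P \<partial>lborel)"
    by (rule nn_integral_fst[symmetric]) measurable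
  also have "\<dots> \<le> (\<integral>\<^sup>+ r. ennreal (c\<^sup>2) * indicator {s..t} r \<partial>lborel)"
  proof (intro nn_integral_mono)
    fix r
    show "(\<integral>\<^sup>+ \<omega>. ennreal ((norm (zero_ext s t \<phi> (r, \<omega>)))\<^sup>2) \<partial>P) \<le> ennreal (c\<^sup>2) * indicator {s..t} r"
    proof (cases "r \<in> {s..t}")
      case True
      have "(\<integral>\<^sup>+ \<omega>. ennreal ((norm (\<phi> r \<omega>))\<^sup>2) \<partial>P) = ennreal ((L2norm P (\<phi> r))\<^sup>2)"
        unfolding L2norm_squared using sq[OF True]
        by (intro nn_integral_eq_integral) (auto simp: square_integrable_def)
      also have "\<dots> \<le> ennreal (c\<^sup>2)" by (intro ennreal_leI power_mono c True) simp
      finally show ?thesis using True by simp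
    qed simp
  qed
  also have "\<dots> < \<infinity>"
    by (subst nn_integral_cmult_indicator) (auto simp: emeasure_lborel_Icc_eq ennreal_mult_less_top)
  finally have "square_integrable time_space (zero_ext s t \<phi>)"
    using m unfolding square_integrable_def by (intro conjI integrableI_bounded) auto
  with p show ?thesis unfolding L2_F_iff[OF st(1,3)] by blast
qed

lemma C_F_imp_L2_F:
  fixes \<phi> :: "real \<Rightarrow> 'w \<Rightarrow> 'b::{real_normed_vector, second_countable_topology}"
  assumes "C_F s t \<phi>" and st: "0 \<le> s" "s \<le> t" "t \<le> T"
  shows "L2_F s t \<phi>"
proof -
  have "continuous_on {s..t} (\<lambda>r. L2norm P (\<phi> r))"
    using C_F_continuous_on_L2norm_diff[OF assms(1) C_F_zero st(1,3)] st by simp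
  then have "bounded ((\<lambda>r. L2norm P (\<phi> r)) ` {s..t})"
    by (rule compact_imp_bounded[OF compact_continuous_image]) simp
  then obtain c where "\<forall>x\<in>(\<lambda>r. L2norm P (\<phi> r)) ` {s..t}. norm x \<le> c" unfolding bounded_iff by blast
  then have "L2norm P (\<phi> r) \<le> c" if "r \<in> {s..t}" for r using that by auto
  then show ?thesis
    using assms(1) st unfolding C_F_iff[OF st(1,3)] by (intro L2_F_of_bounded_L2norm[of s t \<phi> c]) auto
qed

text \<open>Mean square properties depend only on the law of null sets at each fixed time and so
  pass to a modification; progressive measurability does not, and is a separate hypothesis on
  \<open>\<phi>\<close>.\<close>

lemma C_F_modification:
  fixes \<phi> \<theta> :: "real \<Rightarrow> 'w \<Rightarrow> 'b::{real_normed_vector, second_countable_topology}"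
  assumes \<theta>: "\<And>r. r \<in> {s..t} \<Longrightarrow> square_integrable P (\<theta> r)"
      "\<And>r. r \<in> {s..t} \<Longrightarrow> ((\<lambda>q. L2norm P (\<lambda>\<omega>. \<theta> q \<omega> - \<theta> r \<omega>)) \<longlongrightarrow> 0) (at r within {s..t})"
    and \<phi>: "prog_measurable s t \<phi>" "\<And>r. r \<in> {s..t} \<Longrightarrow> AE \<omega> in P. \<phi> r \<omega> = \<theta> r \<omega>"
    and st: "0 \<le> s" "t \<le> T"
  shows "C_F s t \<phi>"
proof -
  have m: "\<phi> r \<in> borel_measurable P" if "r \<in> {s..t}" for r
    using prog_measurable_section[OF \<phi>(1) that] measurable_F_P[of _ r] that st by auto
  have sq: "square_integrable P (\<phi> r)" if "r \<in> {s..t}" for r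
    using \<phi>(2)[OF that] by (intro square_integrable_bound[OF \<theta>(1) m, of r r 1] that) auto
  have "L2norm P (\<lambda>\<omega>. \<phi> q \<omega> - \<phi> r \<omega>) = L2norm P (\<lambda>\<omega>. \<theta> q \<omega> - \<theta> r \<omega>)" if "q \<in> {s..t}" "r \<in> {s..t}" for q r
    using \<phi>(2)[OF that(1)] \<phi>(2)[OF that(2)] m[OF that(1)] m[OF that(2)] \<theta>(1)[OF that(1)] \<theta>(1)[OF that(2)]
    by (intro L2norm_cong_AE) (auto simp: square_integrable_def)
  then have "((\<lambda>q. L2norm P (\<lambda>\<omega>. \<phi> q \<omega> - \<phi> r \<omega>)) \<longlongrightarrow> 0) (at r within {s..t})" if "r \<in> {s..t}" for r
    using that by (intro Lim_transform_eventually[OF \<theta>(2)[OF that]]) (auto simp: eventually_at_filter)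
  with sq \<phi>(1) show ?thesis unfolding C_F_iff[OF st] by blast
qed

text \<open>Heine-Cantor for a curve in mean square. Its values are functions at a seminorm
  distance, so the argument is carried out directly: two sequences with vanishing gap share a
  cluster point of time.\<close>

lemma L2_uniformly_continuous:
  fixes \<theta> :: "real \<Rightarrow> 'w \<Rightarrow> 'b::{real_normed_vector, second_countable_topology}"
  assumes \<theta>: "\<And>r. r \<in> {s..t} \<Longrightarrow> square_integrable P (\<theta> r)"
      "\<And>r. r \<in> {s..t} \<Longrightarrow> ((\<lambda>q. L2norm P (\<lambda>\<omega>. \<theta> q \<omega> - \<theta> r \<omega>)) \<longlongrightarrow> 0) (at r within {s..t})"
    and e: "e > 0"
  shows "\<exists>d>0. \<forall>q\<in>{s..t}. \<forall>r\<in>{s..t}. \<bar>q - r\<bar> < d \<longrightarrow> L2norm P (\<lambda>\<omega>. \<theta> q \<omega> - \<theta> r \<omega>) < e"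
proof (rule ccontr)
  let ?d = "\<lambda>q r. L2norm P (\<lambda>\<omega>. \<theta> q \<omega> - \<theta> r \<omega>)"
  assume neg: "\<not> (\<exists>d>0. \<forall>q\<in>{s..t}. \<forall>r\<in>{s..t}. \<bar>q - r\<bar> < d \<longrightarrow> ?d q r < e)"
  have "\<exists>q\<in>{s..t}. \<exists>r\<in>{s..t}. \<bar>q - r\<bar> < 1 / real (Suc n) \<and> e \<le> ?d q r" for n
  proof -
    have "1 / real (Suc n) > 0" by simp
    then have "\<not> (\<forall>q\<in>{s..t}. \<forall>r\<in>{s..t}. \<bar>q - r\<bar> < 1 / real (Suc n) \<longrightarrow> ?d q r < e)"
      using neg by blast
    then show ?thesis unfolding not_less[symmetric] by blast
  qed
  then obtain q r where qr: "\<And>n. q n \<in> {s..t}" "\<And>n. r n \<in> {s..t}" "\<And>n. \<bar>q n - r n\<bar> < 1 / real (Suc n)"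
    "\<And>n. e \<le> L2norm P (\<lambda>\<omega>. \<theta> (q n) \<omega> - \<theta> (r n) \<omega>)" by metis
  obtain l \<sigma> where l: "l \<in> {s..t}" "strict_mono (\<sigma> :: nat \<Rightarrow> nat)" "(q \<circ> \<sigma>) \<longlonglongrightarrow> l"
    using compact_Icc[of s t, unfolded compact_def] qr(1) by blast
  have "(\<lambda>n. r n - q n) \<longlonglongrightarrow> 0"
    by (rule LIMSEQ_inverse_Suc_bound) (use qr(3) in \<open>simp add: dist_real_def abs_minus_commute\<close>)
  then have "((\<lambda>n. r n - q n) \<circ> \<sigma>) \<longlonglongrightarrow> 0" using l(2) by (rule LIMSEQ_subseq_LIMSEQ)
  from tendsto_add[OF this l(3)] have r: "(r \<circ> \<sigma>) \<longlonglongrightarrow> l" by (simp add: comp_def)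
  have z: "(\<lambda>n. ?d (p n) l) \<longlonglongrightarrow> 0" if "\<And>n. p n \<in> {s..t}" "p \<longlonglongrightarrow> l" for p
  proof -
    have "continuous (at l within {s..t}) (\<lambda>q. ?d q l)"
      unfolding continuous_within using \<theta>(2)[OF l(1)] by (simp add: L2norm_def)
    then have "(\<lambda>n. ?d (p n) l) \<longlonglongrightarrow> ?d l l"
      using that unfolding continuous_within_sequentially by (auto simp: comp_def)
    then show ?thesis by (simp add: L2norm_def)
  qed
  have "(\<lambda>n. ?d (q (\<sigma> n)) l + ?d (r (\<sigma> n)) l) \<longlonglongrightarrow> 0 + 0"
    using l(3) r qr(1,2) by (intro tendsto_add z) (auto simp: comp_def)
  then have "\<forall>\<^sub>F n in sequentially. ?d (q (\<sigma> n)) l + ?d (r (\<sigma> n)) l < e"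
    using e by (intro order_tendstoD(2)) auto
  then obtain n where "?d (q (\<sigma> n)) l + ?d (r (\<sigma> n)) l < e" by (auto simp: eventually_sequentially)
  moreover have "?d (q (\<sigma> n)) (r (\<sigma> n)) \<le> ?d (q (\<sigma> n)) l + ?d (r (\<sigma> n)) l"
    using L2norm_triangle_diff[OF \<theta>(1)[OF qr(1)] \<theta>(1)[OF l(1)] \<theta>(1)[OF qr(2)]]
      L2norm_minus_commute[of P "\<theta> l"] by simp
  ultimately show False using qr(4)[of "\<sigma> n"] by linarith
qed

text \<open>Sample \<open>\<theta>\<close> at the last grid point before the current time. The step
  processes are progressive because they look only backwards, and uniform continuity allows grids on
  which they approach \<open>\<theta>\<close> geometrically fast at every time.\<close>

lemma progressive_modification:
  fixes \<theta> :: "real \<Rightarrow> 'w \<Rightarrow> 'b::{banach, second_countable_topology}"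
  assumes adapted: "\<And>r. r \<in> {0..T} \<Longrightarrow> \<theta> r \<in> borel_measurable (F r)"
    and \<theta>: "\<And>r. r \<in> {0..T} \<Longrightarrow> square_integrable P (\<theta> r)"
      "\<And>r. r \<in> {0..T} \<Longrightarrow> ((\<lambda>q. L2norm P (\<lambda>\<omega>. \<theta> q \<omega> - \<theta> r \<omega>)) \<longlongrightarrow> 0) (at r within {0..T})"
  obtains \<phi> where "C_F 0 T \<phi>" "\<And>r. r \<in> {0..T} \<Longrightarrow> AE \<omega> in P. \<phi> r \<omega> = \<theta> r \<omega>"
proof -
  have "\<forall>k. \<exists>d>0. \<forall>q\<in>{0..T}. \<forall>r\<in>{0..T}. \<bar>q - r\<bar> < d \<longrightarrow> L2norm P (\<lambda>\<omega>. \<theta> q \<omega> - \<theta> r \<omega>) < (1/2)^k"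
    using L2_uniformly_continuous[OF \<theta>] by simp
  then obtain d where d: "\<And>k. d k > 0"
    "\<And>k q r. q \<in> {0..T} \<Longrightarrow> r \<in> {0..T} \<Longrightarrow> \<bar>q - r\<bar> < d k \<Longrightarrow> L2norm P (\<lambda>\<omega>. \<theta> q \<omega> - \<theta> r \<omega>) < (1/2)^k"
    by metis
  \<comment> \<open>Rounding down on a grid of width \<open>d k / 2\<close>: half of the admissible
    gap, so that the strict bound \<open>d k\<close> holds.\<close>
  define g where "g k r = d k / 2 * real (nat \<lfloor>r / (d k / 2)\<rfloor>)" for k r
  have g: "g k r \<in> {0..r}" "\<bar>g k r - r\<bar> < d k" if "0 \<le> r" for k r
  proof -
    define h where "h = d k / 2"
    have h: "h > 0" "h < d k" using d(1)[of k] by (auto simp: h_def)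
    have "real (nat \<lfloor>r / h\<rfloor>) = of_int \<lfloor>r / h\<rfloor>" using that h by simp
    then have "g k r = h * of_int \<lfloor>r / h\<rfloor>" by (simp add: g_def h_def)
    moreover have "of_int \<lfloor>r / h\<rfloor> * h \<le> r"
      by (simp only: pos_le_divide_eq[OF h(1), symmetric] of_int_floor_le)
    moreover have "r < (of_int \<lfloor>r / h\<rfloor> + 1) * h"
      by (simp only: pos_divide_less_eq[OF h(1), symmetric]) linarith
    ultimately have "g k r \<le> r" "r < g k r + h" by (auto simp: algebra_simps)
    moreover have "0 \<le> g k r" using h by (simp add: g_def h_def)
    ultimately show "g k r \<in> {0..r}" "\<bar>g k r - r\<bar> < d k" using h by auto
  qed
  define X where "X k r = \<theta> (g k r)" for k r
  have gT: "g k r \<in> {0..T}" if "r \<in> {0..T}" for k r using g(1)[of r k] that by auto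
  have Xsq: "square_integrable P (X k r)" if "r \<in> {0..T}" for k r
    unfolding X_def by (intro \<theta> gT that)
  have close: "L2norm P (\<lambda>\<omega>. X k r \<omega> - \<theta> r \<omega>) \<le> (1/2)^k" if "r \<in> {0..T}" for k r
    using d(2)[of "g k r" r k] g[of r k] gT[of r k] that by (auto simp: X_def)
  have fast: "L2norm P (\<lambda>\<omega>. X (Suc k) r \<omega> - X k r \<omega>) \<le> 2 * (1/2)^k" if "r \<in> {0..T}" for k r
  proof -
    have "L2norm P (\<lambda>\<omega>. X (Suc k) r \<omega> - X k r \<omega>) \<le> L2norm P (\<lambda>\<omega>. X (Suc k) r \<omega> - \<theta> r \<omega>) + L2norm P (\<lambda>\<omega>. X k r \<omega> - \<theta> r \<omega>)"
      using L2norm_triangle_diff[OF Xsq[OF that] \<theta>(1)[OF that] Xsq[OF that], of "Suc k" k]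
        L2norm_minus_commute[of P "X k r"] by simp
    also have "\<dots> \<le> (1/2)^Suc k + (1/2)^k" by (intro add_mono close that)
    also have "\<dots> \<le> 2 * (1/2)^k" by simp
    finally show ?thesis .
  qed
  \<comment> \<open>\<open>lim\<close> is defined at every point, with an arbitrary value where the
    samples diverge; this keeps joint measurability exact, and the divergent set is null at each
    fixed time.\<close>
  define \<phi> where "\<phi> r \<omega> = lim (\<lambda>k. X k r \<omega>)" for r \<omega>
  have ae: "AE \<omega> in P. \<phi> r \<omega> = \<theta> r \<omega>" if r: "r \<in> {0..T}" for r
  proof -
    have "AE \<omega> in P. convergent (\<lambda>k. X k r \<omega>)"
      by (rule fast_Cauchy_AE_convergent[OF Xsq[OF r] fast[OF r]])
    then have lim: "AE \<omega> in P. (\<lambda>k. X k r \<omega>) \<longlonglongrightarrow> \<phi> r \<omega>"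
      unfolding \<phi>_def by eventually_elim (simp add: convergent_LIMSEQ_iff)
    have m: "\<phi> r \<in> borel_measurable P"
      using Xsq[OF r] unfolding \<phi>_def by (intro borel_measurable_lim_metric) (auto simp: square_integrable_def)
    note L = fast_Cauchy_L2_limit[OF Xsq[OF r] m fast[OF r] lim]
    \<comment> \<open>The constant 5 is 4 from the distance of \<open>\<phi>\<close> to the samples
      plus 1 from the distance of the samples to \<open>\<theta>\<close>.\<close>
    have "L2norm P (\<lambda>\<omega>. \<phi> r \<omega> - \<theta> r \<omega>) \<le> 5 * (1/2)^k" for k
      using L2norm_triangle_diff[OF L(1) Xsq[OF r] \<theta>(1)[OF r], of k] L(2)[of k] close[OF r, of k] by linarith
    moreover have "(\<lambda>k. 5 * (1/2::real)^k) \<longlonglongrightarrow> 5 * 0"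
      by (intro tendsto_intros LIMSEQ_power_zero) simp
    ultimately have "L2norm P (\<lambda>\<omega>. \<phi> r \<omega> - \<theta> r \<omega>) \<le> 0"
      by (intro LIMSEQ_le_const[of "\<lambda>k. 5 * (1/2::real)^k" "0"]) auto
    then have "L2norm P (\<lambda>\<omega>. \<phi> r \<omega> - \<theta> r \<omega>) = 0" using L2norm_nonneg antisym by blast
    then show ?thesis unfolding L2norm_eq_0_iff[OF square_integrable_diff[OF L(1) \<theta>(1)[OF r]]] by simp
  qed
  have prog: "prog_measurable 0 T \<phi>"
    unfolding prog_measurable_iff
  proof
    fix r assume r: "r \<in> {0..T}"
    \<comment> \<open>Capping the sampling time at \<open>r\<close> makes each of the countably many
      sampled variables measurable for \<open>F r\<close>; on times up to \<open>r\<close> the cap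
      changes nothing, since rounding down never exceeds the current time.\<close>
    have meas: "(\<lambda>(q, \<omega>). \<theta> (min r (d k / 2 * real (nat \<lfloor>q / (d k / 2)\<rfloor>))) \<omega>) \<in> borel_measurable (borel \<Otimes>\<^sub>M F r)" for k
    proof -
      have "(\<lambda>x. (\<lambda>i x. \<theta> (min r (d k / 2 * real i)) (snd x)) (nat \<lfloor>fst x / (d k / 2)\<rfloor>) x) \<in> borel_measurable (borel \<Otimes>\<^sub>M F r)"
      proof (rule measurable_compose_countable)
        fix i :: nat
        have "0 \<le> d k / 2 * real i" using d(1)[of k] by simp
        then have "\<theta> (min r (d k / 2 * real i)) \<in> borel_measurable (F r)"
          using r by (intro measurable_F_mono[OF adapted, of "min r (d k / 2 * real i)" r]) auto
        then show "(\<lambda>x. \<theta> (min r (d k / 2 * real i)) (snd x)) \<in> borel_measurable (borel \<Otimes>\<^sub>M F r)" by measurable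
      qed measurable
      then show ?thesis by (simp add: case_prod_unfold)
    qed
    have "(\<lambda>x. indicator {0..r} (fst x) *\<^sub>R lim (\<lambda>k. (\<lambda>(q, \<omega>). \<theta> (min r (d k / 2 * real (nat \<lfloor>q / (d k / 2)\<rfloor>))) \<omega>) x)) \<in> borel_measurable (borel \<Otimes>\<^sub>M F r)"
      by (intro borel_measurable_scaleR borel_measurable_lim_metric meas) measurable
    also have "(\<lambda>x. indicator {0..r} (fst x) *\<^sub>R lim (\<lambda>k. (\<lambda>(q, \<omega>). \<theta> (min r (d k / 2 * real (nat \<lfloor>q / (d k / 2)\<rfloor>))) \<omega>) x)) = zero_ext 0 r \<phi>"
    proof
      fix x
      show "indicator {0..r} (fst x) *\<^sub>R lim (\<lambda>k. (\<lambda>(q, \<omega>). \<theta> (min r (d k / 2 * real (nat \<lfloor>q / (d k / 2)\<rfloor>))) \<omega>) x) = zero_ext 0 r \<phi> x"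
      proof (cases "fst x \<in> {0..r}")
        case True
        then have "min r (g k (fst x)) = g k (fst x)" for k using g(1)[of "fst x" k] by auto
        then show ?thesis using True unfolding g_def[symmetric] \<phi>_def X_def zero_ext_def by (simp add: case_prod_unfold)
      qed (simp add: zero_ext_def case_prod_unfold)
    qed
    finally show "zero_ext 0 r \<phi> \<in> borel_measurable (borel \<Otimes>\<^sub>M F r)" .
  qed
  show ?thesis
    by (rule that[OF C_F_modification[OF \<theta> prog ae] ae]) auto
qed

end

section \<open>The Ito isometry\<close>

lemma integrable_bounded_mult:
  fixes f g :: "'a \<Rightarrow> real"
  assumes "integrable N f" "g \<in> borel_measurable N" "\<And>x. x \<in> space N \<Longrightarrow> \<bar>g x\<bar> \<le> k"
  shows "integrable N (\<lambda>x. g x * f x)"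
proof (rule Bochner_Integration.integrable_bound)
  show "integrable N (\<lambda>x. k * f x)" using assms(1) by simp
  show "AE x in N. norm (g x * f x) \<le> norm (k * f x)"
  proof (rule AE_I2)
    fix x assume "x \<in> space N"
    then have "\<bar>g x\<bar> \<le> \<bar>k\<bar>" using assms(3) abs_ge_self order_trans by blast
    then show "norm (g x * f x) \<le> norm (k * f x)" by (simp add: abs_mult mult_right_mono)
  qed
qed (use assms in measurable)

lemma L2norm_diff_squared:
  fixes f g :: "'a \<Rightarrow> 'b::{real_inner, second_countable_topology}"
  assumes f: "square_integrable N f" and g: "square_integrable N g"
  shows "(L2norm N (\<lambda>x. f x - g x))\<^sup>2 =
    (\<integral>x. f x \<bullet> f x \<partial>N) - 2 * (\<integral>x. f x \<bullet> g x \<partial>N) + (\<integral>x. g x \<bullet> g x \<partial>N)"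
proof -
  have "(L2norm N (\<lambda>x. f x - g x))\<^sup>2 = (\<integral>x. f x \<bullet> f x - 2 * (f x \<bullet> g x) + g x \<bullet> g x \<partial>N)"
    unfolding L2norm_squared
    by (intro Bochner_Integration.integral_cong) (auto simp: power2_norm_eq_inner inner_diff_left inner_diff_right inner_commute)
  also have "\<dots> = (\<integral>x. f x \<bullet> f x \<partial>N) - 2 * (\<integral>x. f x \<bullet> g x \<partial>N) + (\<integral>x. g x \<bullet> g x \<partial>N)"
    using square_integrable_inner[OF f f] square_integrable_inner[OF f g] square_integrable_inner[OF g g] by simp
  finally show ?thesis .
qed

text \<open>Expresses the distance to a linear combination by pairwise inner products alone, so that
  the isometry can be applied term by term.\<close>

lemma L2norm_diff_lincomb_squared:
  fixes f g h :: "'a \<Rightarrow> 'b::{real_inner, second_countable_topology}"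
  assumes "square_integrable N f" "square_integrable N g" "square_integrable N h"
  shows "(L2norm N (\<lambda>x. f x - (g x + c *\<^sub>R h x)))\<^sup>2 = (\<integral>x. f x \<bullet> f x \<partial>N) - 2 * (\<integral>x. f x \<bullet> g x \<partial>N)
    - 2 * c * (\<integral>x. f x \<bullet> h x \<partial>N) + (\<integral>x. g x \<bullet> g x \<partial>N) + 2 * c * (\<integral>x. g x \<bullet> h x \<partial>N) + c\<^sup>2 * (\<integral>x. h x \<bullet> h x \<partial>N)"
proof -
  note i = square_integrable_inner[OF assms(1) assms(1)] square_integrable_inner[OF assms(1) assms(2)]
    square_integrable_inner[OF assms(1) assms(3)] square_integrable_inner[OF assms(2) assms(2)]
    square_integrable_inner[OF assms(2) assms(3)] square_integrable_inner[OF assms(3) assms(3)]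
  have "(norm (x - (y + c *\<^sub>R z)))\<^sup>2 = x \<bullet> x - 2 * (x \<bullet> y) - 2 * c * (x \<bullet> z) + y \<bullet> y
      + 2 * c * (y \<bullet> z) + c\<^sup>2 * (z \<bullet> z)" for x y z :: 'b
    unfolding power2_norm_eq_inner
    by (simp add: inner_diff_left inner_diff_right inner_add_left inner_add_right inner_commute
        power2_eq_square algebra_simps)
  then have "(L2norm N (\<lambda>x. f x - (g x + c *\<^sub>R h x)))\<^sup>2 = (\<integral>x. f x \<bullet> f x - 2 * (f x \<bullet> g x) - 2 * c * (f x \<bullet> h x)
      + g x \<bullet> g x + 2 * c * (g x \<bullet> h x) + c\<^sup>2 * (h x \<bullet> h x) \<partial>N)"
    unfolding L2norm_squared by simp
  then show ?thesis using i by simp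
qed

context usual_filtration
begin

lemma integral_time_space_product:
  fixes g :: "'w \<Rightarrow> real"
  assumes A[measurable]: "A \<in> sets borel" and fin: "emeasure lborel A < \<infinity>" and g: "integrable P g"
  shows "integrable time_space (\<lambda>(r, \<omega>). indicator A r * g \<omega>)"
    "(\<integral>x. (case x of (r, \<omega>) \<Rightarrow> indicator A r * g \<omega>) \<partial>time_space) = measure lborel A * expectation g"
proof -
  have [measurable]: "g \<in> borel_measurable P" using g by simp
  have I: "integrable lborel (indicator A :: real \<Rightarrow> real)"
    using A fin by (intro integrable_real_indicator) auto
  show int: "integrable time_space (\<lambda>(r, \<omega>). indicator A r * g \<omega>)"
  proof (rule time_space.Fubini_integrable)
    show "integrable lborel (\<lambda>r. \<integral>\<omega>. norm (case (r, \<omega>) of (r, \<omega>) \<Rightarrow> indicator A r * g \<omega>) \<partial>P)"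
      using I by (simp add: abs_mult)
  qed (use g in auto)
  show "(\<integral>x. (case x of (r, \<omega>) \<Rightarrow> indicator A r * g \<omega>) \<partial>time_space) = measure lborel A * expectation g"
    using time_space.integral_fst'[OF int] by simp
qed

end

section \<open>Moments of Brownian increments\<close>

context brownian_motion
begin

definition dW :: "real \<Rightarrow> real \<Rightarrow> 'w \<Rightarrow> real"
  where "dW a b \<omega> = W b \<omega> - W a \<omega>"

lemma dW_measurable_F: "0 \<le> a \<Longrightarrow> a \<le> b \<Longrightarrow> b \<le> c \<Longrightarrow> c \<le> T \<Longrightarrow> dW a b \<in> borel_measurable (F c)"
  unfolding dW_def[abs_def]
  by (intro borel_measurable_diff measurable_F_mono[OF W_adapted]) auto

lemma dW_measurable: "0 \<le> a \<Longrightarrow> a \<le> b \<Longrightarrow> b \<le> T \<Longrightarrow> dW a b \<in> borel_measurable P"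
  by (rule measurable_F_P[OF dW_measurable_F[of a b T]]) (use T_pos in auto)

lemma dW_moments:
  assumes ab: "0 \<le> a" "a < b" "b \<le> T"
  shows "integrable P (dW a b)" "expectation (dW a b) = 0"
    "integrable P (\<lambda>\<omega>. (dW a b \<omega>)\<^sup>2)" "expectation (\<lambda>\<omega>. (dW a b \<omega>)\<^sup>2) = b - a"
proof -
  let ?\<sigma> = "sqrt (b - a)"
  have \<sigma>: "?\<sigma> > 0" using ab by simp
  have D: "distributed P lborel (dW a b) (normal_density 0 ?\<sigma>)"
    unfolding dW_def[abs_def] by (rule W_normal[OF ab])
  show "integrable P (dW a b)"
    using distributed_integrable[OF D, of "\<lambda>x. x"] integrable_normal_moment_nz_1[OF \<sigma>, of 0] by simp
  show "expectation (dW a b) = 0"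
    using distributed_integral[OF D, of "\<lambda>x. x"] integral_normal_moment_nz_1[OF \<sigma>, of 0] by simp
  show "integrable P (\<lambda>\<omega>. (dW a b \<omega>)\<^sup>2)"
    using distributed_integrable[OF D, of "\<lambda>x. x\<^sup>2"] integrable_normal_moment[OF \<sigma>, of 0 2] by simp
  show "expectation (\<lambda>\<omega>. (dW a b \<omega>)\<^sup>2) = b - a"
    using distributed_integral[OF D, of "\<lambda>x. x\<^sup>2"] integral_normal_moment_even[OF \<sigma>, of 0 1] ab
    by simp
qed

lemma integrable_dW: "0 \<le> a \<Longrightarrow> a \<le> b \<Longrightarrow> b \<le> T \<Longrightarrow> integrable P (dW a b)"
  using dW_moments(1)[of a b] by (cases "a = b") (simp_all add: dW_def[abs_def])

lemma square_integrable_dW: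
  assumes "0 \<le> a" "a \<le> b" "b \<le> T"
  shows "square_integrable P (dW a b)"
proof (cases "a = b")
  case True
  then show ?thesis by (simp add: dW_def[abs_def])
next
  case False
  then show ?thesis
    using dW_moments(3)[of a b] dW_measurable[of a b] assms by (simp add: square_integrable_def)
qed

lemma indep_dW:
  fixes g :: "'w \<Rightarrow> real"
  assumes g: "g \<in> borel_measurable (F a)" and ab: "0 \<le> a" "a < b" "b \<le> T"
  shows "indep_var borel g borel (dW a b)"
  unfolding indep_var_eq
proof (intro conjI)
  have a: "a \<in> {0..T}" using ab by auto
  show "random_variable borel g" by (rule measurable_F_P[OF g a])
  show "random_variable borel (dW a b)" by (rule dW_measurable) (use ab in auto)
  let ?G = "sigma_sets (space P) {g -` A \<inter> space P |A. A \<in> sets borel}"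
  let ?W = "{dW a b -` E \<inter> space P |E. E \<in> sets borel}"
  have G: "?G \<subseteq> sets (F a)"
  proof -
    have "{g -` A \<inter> space P |A. A \<in> sets borel} \<subseteq> sets (F a)"
      using measurable_sets[OF g] space_F[OF a] by auto
    then show ?thesis using sets.sigma_sets_subset[of _ "F a"] space_F[OF a] by simp
  qed
  \<comment> \<open>Preimages of Borel sets under one map already form a sigma-algebra, so the
    family in \<open>W_indep\<close> is its own generated sigma-algebra.\<close>
  have W: "sigma_sets (space P) ?W = ?W"
  proof -
    have "?W = sets (vimage_algebra (space P) (dW a b) borel)" by (subst sets_vimage_algebra2) auto
    then show ?thesis using sets.sigma_sets_eq[of "vimage_algebra (space P) (dW a b) borel"] by simp
  qed
  have ind: "indep_set (sets (F a)) ?W" using W_indep[OF ab] unfolding dW_def .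
  show "indep_set ?G (sigma_sets (space P) ?W)"
    unfolding W
  proof (rule indep_setI)
    show "?G \<subseteq> events" using G subalgebra_F[OF a] by (auto simp: subalgebra_def)
    show "?W \<subseteq> events" using \<open>random_variable borel (dW a b)\<close> by (auto intro: measurable_sets)
    fix A B assume "A \<in> ?G" "B \<in> ?W"
    then show "prob (A \<inter> B) = prob A * prob B" using G by (intro indep_setD[OF ind]) auto
  qed
qed

text \<open>Independence makes the product integrable although neither factor has to be bounded;
  later \<open>g\<close> is itself a coefficient times an earlier increment.\<close>

lemma expectation_mult_dW:
  fixes g :: "'w \<Rightarrow> real"
  assumes g: "g \<in> borel_measurable (F a)" "integrable P g" and ab: "0 \<le> a" "a \<le> b" "b \<le> T"
  shows "integrable P (\<lambda>\<omega>. g \<omega> * dW a b \<omega>)" "expectation (\<lambda>\<omega>. g \<omega> * dW a b \<omega>) = 0"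
proof -
  have "integrable P (\<lambda>\<omega>. g \<omega> * dW a b \<omega>) \<and> expectation (\<lambda>\<omega>. g \<omega> * dW a b \<omega>) = 0"
  proof (cases "a = b")
    case True
    then show ?thesis by (simp add: dW_def[abs_def])
  next
    case False
    then have ab': "a < b" using ab by simp
    note I = indep_dW[OF g(1) ab(1) ab' ab(3)] and M = dW_moments[OF ab(1) ab' ab(3)]
    show ?thesis
      using indep_var_integrable[OF I g(2) M(1)] indep_var_lebesgue_integral[OF I g(2) M(1)] M(2) by simp
  qed
  then show "integrable P (\<lambda>\<omega>. g \<omega> * dW a b \<omega>)" "expectation (\<lambda>\<omega>. g \<omega> * dW a b \<omega>) = 0" by auto
qed

lemma expectation_mult_dW_squared:
  fixes g :: "'w \<Rightarrow> real"
  assumes g: "g \<in> borel_measurable (F a)" "integrable P g" and ab: "0 \<le> a" "a \<le> b" "b \<le> T"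
  shows "expectation (\<lambda>\<omega>. g \<omega> * (dW a b \<omega>)\<^sup>2) = (b - a) * expectation g"
proof (cases "a = b")
  case True
  then show ?thesis by (simp add: dW_def[abs_def])
next
  case False
  then have ab': "a < b" using ab by simp
  note I = indep_var_compose[OF indep_dW[OF g(1) ab(1) ab' ab(3)], of "\<lambda>x. x" borel "\<lambda>x. x\<^sup>2" borel]
  show ?thesis
    using indep_var_lebesgue_integral[OF I] g(2) dW_moments(3,4)[OF ab(1) ab' ab(3)]
    by (simp add: comp_def mult.commute)
qed

lemma integrable_mult_dW_dW:
  fixes g :: "'w \<Rightarrow> real"
  assumes "g \<in> borel_measurable P" "\<And>\<omega>. \<omega> \<in> space P \<Longrightarrow> \<bar>g \<omega>\<bar> \<le> k"
    "0 \<le> a" "a \<le> b" "b \<le> T" "0 \<le> c" "c \<le> d" "d \<le> T"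
  shows "integrable P (\<lambda>\<omega>. g \<omega> * (dW a b \<omega> * dW c d \<omega>))"
proof (rule integrable_bounded_mult[OF _ assms(1,2)])
  show "integrable P (\<lambda>\<omega>. dW a b \<omega> * dW c d \<omega>)"
    using square_integrable_inner[OF square_integrable_dW[of a b] square_integrable_dW[of c d]] assms by simp
qed

lemma dW_split: "dW a b \<omega> = dW a c \<omega> + dW c b \<omega>"
  by (simp add: dW_def)

text \<open>Split the longer increment at \<open>b\<close>. The piece after \<open>b\<close> is
  centred and independent of \<open>F b\<close>, with respect to which the remaining factors are
  measurable, so only the square of the shorter increment survives.\<close>

lemma expectation_mult_dW_dW_same_start:
  fixes g :: "'w \<Rightarrow> real"
  assumes g: "g \<in> borel_measurable (F c)" "\<And>\<omega>. \<omega> \<in> space P \<Longrightarrow> \<bar>g \<omega>\<bar> \<le> k"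
    and c: "0 \<le> c" "c \<le> b" "b \<le> d" "d \<le> T"
  shows "expectation (\<lambda>\<omega>. g \<omega> * (dW c b \<omega> * dW c d \<omega>)) = (b - c) * expectation g"
proof -
  have gP: "g \<in> borel_measurable P" by (rule measurable_F_P[OF g(1)]) (use c in auto)
  have gi: "integrable P g" by (rule integrable_const_bound[of _ k]) (use gP g(2) in auto)
  have i: "integrable P (\<lambda>\<omega>. g \<omega> * dW c b \<omega>)" by (rule expectation_mult_dW(1)[OF g(1) gi]) (use c in auto)
  have m: "(\<lambda>\<omega>. g \<omega> * dW c b \<omega>) \<in> borel_measurable (F b)"
    by (intro borel_measurable_times measurable_F_mono[OF g(1)] dW_measurable_F) (use c in auto)
  have "expectation (\<lambda>\<omega>. g \<omega> * (dW c b \<omega> * dW c d \<omega>)) =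
      expectation (\<lambda>\<omega>. g \<omega> * (dW c b \<omega> * dW c b \<omega>) + (g \<omega> * dW c b \<omega>) * dW b d \<omega>)"
    by (intro Bochner_Integration.integral_cong) (auto simp: dW_split[of c d _ b] algebra_simps)
  also have "\<dots> = expectation (\<lambda>\<omega>. g \<omega> * (dW c b \<omega> * dW c b \<omega>)) + expectation (\<lambda>\<omega>. (g \<omega> * dW c b \<omega>) * dW b d \<omega>)"
    by (rule Bochner_Integration.integral_add[OF integrable_mult_dW_dW[OF gP g(2)] expectation_mult_dW(1)[OF m i]]) (use c in auto)
  also have "\<dots> = (b - c) * expectation g"
    using expectation_mult_dW(2)[OF m i, of d] expectation_mult_dW_squared[OF g(1) gi, of b] c
    by (simp add: power2_eq_square)
  finally show ?thesis .
qed

text \<open>Split the first increment at \<open>c\<close>. What happens before \<open>c\<close> is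
  known at time \<open>c\<close> and is annihilated by the centred second increment; what remains is
  a pair with common start, contributing the length of the overlap.\<close>

lemma expectation_mult_dW_dW_ordered:
  fixes g :: "'w \<Rightarrow> real"
  assumes g: "g \<in> borel_measurable (F c)" "\<And>\<omega>. \<omega> \<in> space P \<Longrightarrow> \<bar>g \<omega>\<bar> \<le> k"
    and ab: "0 \<le> a" "a \<le> b" "b \<le> T" and cd: "c \<le> d" "d \<le> T" and ac: "a \<le> c"
  shows "expectation (\<lambda>\<omega>. g \<omega> * (dW a b \<omega> * dW c d \<omega>)) = measure lborel ({a..<b} \<inter> {c..<d}) * expectation g"
proof -
  have gP: "g \<in> borel_measurable P" by (rule measurable_F_P[OF g(1)]) (use assms in auto)
  have gi: "integrable P g" by (rule integrable_const_bound[of _ k]) (use gP g(2) in auto)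
  have shift: "expectation (\<lambda>\<omega>. g \<omega> * (dW a p \<omega> * dW c d \<omega>)) = 0" if p: "a \<le> p" "p \<le> c" for p
  proof -
    have i: "integrable P (\<lambda>\<omega>. g \<omega> * dW a p \<omega>)"
      using integrable_dW[of a p] p assms by (intro integrable_bounded_mult[OF _ gP g(2)]) auto
    have m: "(\<lambda>\<omega>. g \<omega> * dW a p \<omega>) \<in> borel_measurable (F c)"
      by (intro borel_measurable_times g(1) dW_measurable_F) (use p assms in auto)
    show ?thesis using expectation_mult_dW(2)[OF m i, of d] p assms by (simp add: mult.assoc)
  qed
  show ?thesis
  proof (cases "b \<le> c")
    case True
    then have "{a..<b} \<inter> {c..<d} = {}" by auto
    then show ?thesis using shift[of b] True ab by simp
  next
    case False
    then have cb: "c < b" by simp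
    have "expectation (\<lambda>\<omega>. g \<omega> * (dW a b \<omega> * dW c d \<omega>)) =
        expectation (\<lambda>\<omega>. g \<omega> * (dW a c \<omega> * dW c d \<omega>) + g \<omega> * (dW c b \<omega> * dW c d \<omega>))"
      by (intro Bochner_Integration.integral_cong) (auto simp: dW_split[of a b _ c] algebra_simps)
    also have "\<dots> = expectation (\<lambda>\<omega>. g \<omega> * (dW a c \<omega> * dW c d \<omega>)) + expectation (\<lambda>\<omega>. g \<omega> * (dW c b \<omega> * dW c d \<omega>))"
      by (intro Bochner_Integration.integral_add integrable_mult_dW_dW[OF gP g(2)]) (use assms cb in auto)
    also have "\<dots> = expectation (\<lambda>\<omega>. g \<omega> * (dW c b \<omega> * dW c d \<omega>))"
      using shift[of c] ac by simp
    also have "\<dots> = (min b d - c) * expectation g"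
    proof (cases "b \<le> d")
      case True
      then show ?thesis using expectation_mult_dW_dW_same_start[OF g, of b d] assms cb by simp
    next
      case False
      then show ?thesis using expectation_mult_dW_dW_same_start[OF g, of d b] assms cb
        by (simp add: mult.commute min_def)
    qed
    also have "min b d - c = measure lborel ({a..<b} \<inter> {c..<d})"
    proof -
      have "{a..<b} \<inter> {c..<d} = {c..<min b d}" using ac by auto
      then show ?thesis using cb cd by simp
    qed
    finally show ?thesis .
  qed
qed

text \<open>The coefficient is known at the later of the two starting times. The overlap length is
  the time integral of the product of the two cell indicators, which is how it will match the
  integrands.\<close>

lemma expectation_mult_dW_dW:
  fixes g :: "'w \<Rightarrow> real"
  assumes g: "g \<in> borel_measurable (F (max a c))" "\<And>\<omega>. \<omega> \<in> space P \<Longrightarrow> \<bar>g \<omega>\<bar> \<le> k"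
    and ab: "0 \<le> a" "a \<le> b" "b \<le> T" and cd: "0 \<le> c" "c \<le> d" "d \<le> T"
  shows "expectation (\<lambda>\<omega>. g \<omega> * (dW a b \<omega> * dW c d \<omega>)) = measure lborel ({a..<b} \<inter> {c..<d}) * expectation g"
proof (cases "a \<le> c")
  case True
  then show ?thesis using expectation_mult_dW_dW_ordered[of g c k a b d] assms by (simp add: max_def)
next
  case False
  then have "max a c = a" by simp
  then show ?thesis using expectation_mult_dW_dW_ordered[of g a k c d b] assms False
    by (simp add: mult.commute Int_commute)
qed

section \<open>Simple integrands and their integrals\<close>

lemma simple_integrandD:
  fixes \<xi> :: "nat \<Rightarrow> 'w \<Rightarrow> 'b::{real_normed_vector, second_countable_topology}"
  assumes si: "simple_integrand s t n \<tau> \<xi>" and st: "0 \<le> s" "t \<le> T"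
  shows "i \<le> j \<Longrightarrow> j \<le> n \<Longrightarrow> \<tau> i \<le> \<tau> j" "i \<le> n \<Longrightarrow> s \<le> \<tau> i" "i \<le> n \<Longrightarrow> \<tau> i \<le> t" "s \<le> t"
    "i < n \<Longrightarrow> \<xi> i \<in> borel_measurable (F (\<tau> i))" "i < n \<Longrightarrow> \<xi> i \<in> borel_measurable P"
    "\<exists>k. \<forall>i<n. \<forall>\<omega>\<in>space P. norm (\<xi> i \<omega>) \<le> k"
    "i < n \<Longrightarrow> square_integrable P (\<xi> i)"
proof -
  have \<tau>: "\<tau> 0 = s" "\<tau> n = t" "\<And>i. i < n \<Longrightarrow> \<tau> i < \<tau> (Suc i)" using si by (auto simp: simple_integrand_def)
  show mono: "\<tau> i \<le> \<tau> j" if "i \<le> j" "j \<le> n" for i j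
    using that
  proof (induction rule: dec_induct)
    case (step m)
    then show ?case using \<tau>(3)[of m] by simp
  qed simp
  show lo: "i \<le> n \<Longrightarrow> s \<le> \<tau> i" and hi: "i \<le> n \<Longrightarrow> \<tau> i \<le> t" for i
    using mono[of 0 i] mono[of i n] \<tau> by auto
  show "s \<le> t" using lo[of n] \<tau>(2) by simp
  show m: "i < n \<Longrightarrow> \<xi> i \<in> borel_measurable (F (\<tau> i))" for i
    using si by (simp add: simple_integrand_def strongly_measurable_iff_borel)
  show mP: "i < n \<Longrightarrow> \<xi> i \<in> borel_measurable P" for i
    using measurable_F_P[OF m, of i] lo[of i] hi[of i] st by simp
  have "\<forall>i. \<exists>k. i < n \<longrightarrow> (\<forall>\<omega>\<in>space P. norm (\<xi> i \<omega>) \<le> k)"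
    using si by (simp add: simple_integrand_def bounded_iff)
  then obtain k where k: "\<And>i. i < n \<Longrightarrow> \<forall>\<omega>\<in>space P. norm (\<xi> i \<omega>) \<le> k i" by metis
  have "norm (\<xi> i \<omega>) \<le> (\<Sum>j<n. \<bar>k j\<bar>)" if "i < n" "\<omega> \<in> space P" for i \<omega>
  proof -
    have "norm (\<xi> i \<omega>) \<le> \<bar>k i\<bar>" using k that by fastforce
    also have "\<dots> \<le> (\<Sum>j<n. \<bar>k j\<bar>)" using that by (intro member_le_sum) auto
    finally show ?thesis .
  qed
  then show bd: "\<exists>k. \<forall>i<n. \<forall>\<omega>\<in>space P. norm (\<xi> i \<omega>) \<le> k" by blast
  show "square_integrable P (\<xi> i)" if "i < n"
  proof -
    obtain k where "\<And>\<omega>. \<omega> \<in> space P \<Longrightarrow> norm (\<xi> i \<omega>) \<le> k" using bd \<open>i < n\<close> by blast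
    then have "norm ((norm (\<xi> i \<omega>))\<^sup>2) \<le> k\<^sup>2" if "\<omega> \<in> space P" for \<omega> using that by (simp add: power_mono)
    then have "integrable P (\<lambda>\<omega>. (norm (\<xi> i \<omega>))\<^sup>2)"
      using mP[OF that] by (intro integrable_const_bound[of _ "k\<^sup>2"]) auto
    then show ?thesis using mP[OF that] by (simp add: square_integrable_def)
  qed
qed

lemma simple_ito_eq: "simple_ito n \<tau> \<xi> = (\<lambda>\<omega>. \<Sum>i<n. dW (\<tau> i) (\<tau> (Suc i)) \<omega> *\<^sub>R \<xi> i \<omega>)"
  by (simp add: simple_ito_def dW_def fun_eq_iff)

lemma simple_ito_measurable:
  fixes \<xi> :: "nat \<Rightarrow> 'w \<Rightarrow> 'b::{real_normed_vector, second_countable_topology}"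
  assumes si: "simple_integrand s t n \<tau> \<xi>" and st: "0 \<le> s" "t \<le> T"
  shows "simple_ito n \<tau> \<xi> \<in> borel_measurable (F t)"
  unfolding simple_ito_eq
proof (intro borel_measurable_sum borel_measurable_scaleR)
  note D = simple_integrandD[OF si st]
  fix i assume i: "i \<in> {..<n}"
  show "dW (\<tau> i) (\<tau> (Suc i)) \<in> borel_measurable (F t)"
    using D(1)[of i "Suc i"] D(2)[of i] D(3)[of "Suc i"] i st by (intro dW_measurable_F) auto
  show "\<xi> i \<in> borel_measurable (F t)"
    using D(2,3)[of i] i st by (intro measurable_F_mono[OF D(5)]) auto
qed

lemma square_integrable_simple_ito:
  fixes \<xi> :: "nat \<Rightarrow> 'w \<Rightarrow> 'b::{real_normed_vector, second_countable_topology}"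
  assumes si: "simple_integrand s t n \<tau> \<xi>" and st: "0 \<le> s" "t \<le> T"
  shows "square_integrable P (simple_ito n \<tau> \<xi>)"
  unfolding simple_ito_eq
proof (rule square_integrable_sum)
  note D = simple_integrandD[OF si st]
  fix i assume i: "i \<in> {..<n}"
  have w: "square_integrable P (dW (\<tau> i) (\<tau> (Suc i)))"
    using D(1)[of i "Suc i"] D(2)[of i] D(3)[of "Suc i"] i st by (intro square_integrable_dW) auto
  obtain k where k: "\<And>\<omega>. \<omega> \<in> space P \<Longrightarrow> norm (\<xi> i \<omega>) \<le> k" using D(7) i by blast
  show "square_integrable P (\<lambda>\<omega>. dW (\<tau> i) (\<tau> (Suc i)) \<omega> *\<^sub>R \<xi> i \<omega>)"
  proof (rule square_integrable_bound[OF w, where c=k])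
    show "(\<lambda>\<omega>. dW (\<tau> i) (\<tau> (Suc i)) \<omega> *\<^sub>R \<xi> i \<omega>) \<in> borel_measurable P"
      using D(6) i w by (intro borel_measurable_scaleR) (auto simp: square_integrable_def)
    show "AE \<omega> in P. norm (dW (\<tau> i) (\<tau> (Suc i)) \<omega> *\<^sub>R \<xi> i \<omega>) \<le> k * norm (dW (\<tau> i) (\<tau> (Suc i)) \<omega>)"
      using k by (intro AE_I2) (simp add: mult.commute mult_right_mono)
  qed
qed

lemma square_integrable_simple_process:
  fixes \<xi> :: "nat \<Rightarrow> 'w \<Rightarrow> 'b::{real_normed_vector, second_countable_topology}"
  assumes si: "simple_integrand s t n \<tau> \<xi>" and st: "0 \<le> s" "t \<le> T"
  shows "square_integrable time_space (\<lambda>(r, \<omega>). simple_process n \<tau> \<xi> r \<omega>)"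
proof -
  note D = simple_integrandD[OF si st]
  have "square_integrable time_space (\<lambda>x. \<Sum>i<n. indicator {\<tau> i..<\<tau> (Suc i)} (fst x) *\<^sub>R \<xi> i (snd x))"
  proof (rule square_integrable_sum)
    fix i assume "i \<in> {..<n}"
    then have i: "i < n" by simp
    note [measurable] = D(6)[OF i]
    have "integrable time_space (\<lambda>(r, \<omega>). indicator {\<tau> i..<\<tau> (Suc i)} r * (norm (\<xi> i \<omega>))\<^sup>2)"
      using D(8)[OF i] D(1)[of i "Suc i"] i
      by (intro integral_time_space_product) (auto simp: square_integrable_def)
    also have "(\<lambda>(r, \<omega>). indicator {\<tau> i..<\<tau> (Suc i)} r * (norm (\<xi> i \<omega>))\<^sup>2) =
        (\<lambda>x. (norm (indicator {\<tau> i..<\<tau> (Suc i)} (fst x) *\<^sub>R \<xi> i (snd x)))\<^sup>2)"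
      by (auto simp: fun_eq_iff indicator_def)
    finally show "square_integrable time_space (\<lambda>x. indicator {\<tau> i..<\<tau> (Suc i)} (fst x) *\<^sub>R \<xi> i (snd x))"
      unfolding square_integrable_def by (intro conjI) measurable
  qed
  then show ?thesis by (simp add: simple_process_def case_prod_unfold)
qed

lemma simple_process_outside:
  fixes \<xi> :: "nat \<Rightarrow> 'w \<Rightarrow> 'b::{real_normed_vector, second_countable_topology}"
  assumes si: "simple_integrand s t n \<tau> \<xi>" and st: "0 \<le> s" "t \<le> T"
  shows "r \<notin> {s..t} \<Longrightarrow> simple_process n \<tau> \<xi> r \<omega> = 0"
  unfolding simple_process_def
proof (rule sum.neutral, rule ballI)
  note D = simple_integrandD[OF si st]
  fix i assume "r \<notin> {s..t}" "i \<in> {..<n}"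
  then have "r \<notin> {\<tau> i..<\<tau> (Suc i)}" using D(2)[of i] D(3)[of "Suc i"] by auto
  then show "indicator {\<tau> i..<\<tau> (Suc i)} r *\<^sub>R \<xi> i \<omega> = 0" by simp
qed

text \<open>Both sides expand into the same double sum over pairs of cells, weighted by the overlap
  of the cells and the expected inner product of the coefficients.\<close>

lemma simple_ito_inner:
  fixes \<xi> \<xi>' :: "nat \<Rightarrow> 'w \<Rightarrow> 'b::{real_inner, second_countable_topology}"
  assumes si: "simple_integrand s t n \<tau> \<xi>" "0 \<le> s" "t \<le> T"
    and si': "simple_integrand s' t' m \<tau>' \<xi>'" "0 \<le> s'" "t' \<le> T"
  shows "expectation (\<lambda>\<omega>. simple_ito n \<tau> \<xi> \<omega> \<bullet> simple_ito m \<tau>' \<xi>' \<omega>) =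
    (\<integral>x. (\<lambda>(r, \<omega>). simple_process n \<tau> \<xi> r \<omega>) x \<bullet> (\<lambda>(r, \<omega>). simple_process m \<tau>' \<xi>' r \<omega>) x \<partial>time_space)"
proof -
  note D = simple_integrandD[OF si] and D' = simple_integrandD[OF si']
  define g where "g i j \<omega> = \<xi> i \<omega> \<bullet> \<xi>' j \<omega>" for i j \<omega>
  define J where "J i j = {\<tau> i..<\<tau> (Suc i)} \<inter> {\<tau>' j..<\<tau>' (Suc j)}" for i j
  obtain k where k: "\<And>i \<omega>. i < n \<Longrightarrow> \<omega> \<in> space P \<Longrightarrow> norm (\<xi> i \<omega>) \<le> k" using D(7) by blast
  obtain k' where k': "\<And>i \<omega>. i < m \<Longrightarrow> \<omega> \<in> space P \<Longrightarrow> norm (\<xi>' i \<omega>) \<le> k'" using D'(7) by blast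
  have g: "g i j \<in> borel_measurable (F (max (\<tau> i) (\<tau>' j)))" "integrable P (g i j)"
    "\<omega> \<in> space P \<Longrightarrow> \<bar>g i j \<omega>\<bar> \<le> k * k'" if ij: "i < n" "j < m" for i j \<omega>
  proof -
    show "g i j \<in> borel_measurable (F (max (\<tau> i) (\<tau>' j)))"
      unfolding g_def
      using D(2,3)[of i] D'(2,3)[of j] ij si(2,3) si'(2,3)
      by (intro borel_measurable_inner measurable_F_mono[OF D(5)] measurable_F_mono[OF D'(5)]) auto
    show "integrable P (g i j)"
      unfolding g_def by (intro square_integrable_inner D(8) D'(8) ij)
    show "\<bar>g i j \<omega>\<bar> \<le> k * k'" if "\<omega> \<in> space P"
    proof -
      have "\<bar>g i j \<omega>\<bar> \<le> norm (\<xi> i \<omega>) * norm (\<xi>' j \<omega>)" unfolding g_def by (rule Cauchy_Schwarz_ineq2)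
      also have "\<dots> \<le> k * k'"
        using k[OF ij(1) that] k'[OF ij(2) that] order_trans[OF norm_ge_zero k[OF ij(1) that]] by (intro mult_mono) auto
      finally show ?thesis .
    qed
  qed
  let ?w = "\<lambda>i j \<omega>. g i j \<omega> * (dW (\<tau> i) (\<tau> (Suc i)) \<omega> * dW (\<tau>' j) (\<tau>' (Suc j)) \<omega>)"
  have ord: "i < n \<Longrightarrow> 0 \<le> \<tau> i \<and> \<tau> i \<le> \<tau> (Suc i) \<and> \<tau> (Suc i) \<le> T" for i
    using D(1)[of i "Suc i"] D(2)[of i] D(3)[of "Suc i"] si by auto
  have ord': "i < m \<Longrightarrow> 0 \<le> \<tau>' i \<and> \<tau>' i \<le> \<tau>' (Suc i) \<and> \<tau>' (Suc i) \<le> T" for i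
    using D'(1)[of i "Suc i"] D'(2)[of i] D'(3)[of "Suc i"] si' by auto
  have w: "integrable P (?w i j)" "expectation (?w i j) = measure lborel (J i j) * expectation (g i j)"
    if ij: "i < n" "j < m" for i j
  proof -
    show "integrable P (?w i j)"
      using ord[OF ij(1)] ord'[OF ij(2)] borel_measurable_integrable[OF g(2)[OF ij]] g(3)[OF ij]
      by (intro integrable_mult_dW_dW[where k="k * k'"]) auto
    show "expectation (?w i j) = measure lborel (J i j) * expectation (g i j)"
      unfolding J_def
      using ord[OF ij(1)] ord'[OF ij(2)] g(1,3)[OF ij]
      by (intro expectation_mult_dW_dW[where k="k * k'"]) auto
  qed
  have "expectation (\<lambda>\<omega>. simple_ito n \<tau> \<xi> \<omega> \<bullet> simple_ito m \<tau>' \<xi>' \<omega>) = expectation (\<lambda>\<omega>. \<Sum>i<n. \<Sum>j<m. ?w i j \<omega>)"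
    unfolding simple_ito_eq g_def
    by (simp only: inner_sum_left, simp only: inner_sum_right, simp add: mult_ac)
  also have "\<dots> = (\<Sum>i<n. \<Sum>j<m. expectation (?w i j))"
    using w(1) by (subst Bochner_Integration.integral_sum; (intro sum.cong Bochner_Integration.integrable_sum)?)
      (auto intro!: Bochner_Integration.integral_sum)
  also have "\<dots> = (\<Sum>i<n. \<Sum>j<m. measure lborel (J i j) * expectation (g i j))"
    using w(2) by simp
  also have "\<dots> = (\<Sum>i<n. \<Sum>j<m. \<integral>x. (case x of (r, \<omega>) \<Rightarrow> indicator (J i j) r * g i j \<omega>) \<partial>time_space)"
  proof (intro sum.cong refl, goal_cases)
    case (1 i j)
    have "emeasure lborel (J i j) \<le> emeasure lborel {\<tau> i..<\<tau> (Suc i)}"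
      unfolding J_def by (intro emeasure_mono) auto
    then have "emeasure lborel (J i j) < \<infinity>" using ord[of i] 1 by (simp add: le_less_trans)
    then show ?case
      using 1 g(2)[of i j] by (subst integral_time_space_product(2)) (auto simp: J_def)
  qed
  also have "\<dots> = (\<integral>x. (\<Sum>i<n. \<Sum>j<m. (case x of (r, \<omega>) \<Rightarrow> indicator (J i j) r * g i j \<omega>)) \<partial>time_space)"
  proof -
    have "integrable time_space (\<lambda>x. case x of (r, \<omega>) \<Rightarrow> indicator (J i j) r * g i j \<omega>)" if "i < n" "j < m" for i j
    proof -
      have "emeasure lborel (J i j) \<le> emeasure lborel {\<tau> i..<\<tau> (Suc i)}"
        unfolding J_def by (intro emeasure_mono) auto
      then have "emeasure lborel (J i j) < \<infinity>" using ord[of i] that by (simp add: le_less_trans)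
      then show ?thesis using that g(2)[of i j] by (intro integral_time_space_product(1)) (auto simp: J_def)
    qed
    then show ?thesis
      by (subst Bochner_Integration.integral_sum; (intro sum.cong Bochner_Integration.integrable_sum)?)
        (auto intro!: Bochner_Integration.integral_sum[symmetric])
  qed
  also have "\<dots> = (\<integral>x. (\<lambda>(r, \<omega>). simple_process n \<tau> \<xi> r \<omega>) x \<bullet> (\<lambda>(r, \<omega>). simple_process m \<tau>' \<xi>' r \<omega>) x \<partial>time_space)"
    unfolding simple_process_def g_def J_def
  proof (intro Bochner_Integration.integral_cong refl, clarify)
    fix r \<omega>
    show "(\<Sum>i<n. \<Sum>j<m. indicator ({\<tau> i..<\<tau> (Suc i)} \<inter> {\<tau>' j..<\<tau>' (Suc j)}) r * (\<xi> i \<omega> \<bullet> \<xi>' j \<omega>)) =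
      (\<Sum>i<n. indicator {\<tau> i..<\<tau> (Suc i)} r *\<^sub>R \<xi> i \<omega>) \<bullet> (\<Sum>j<m. indicator {\<tau>' j..<\<tau>' (Suc j)} r *\<^sub>R \<xi>' j \<omega>)"
      by (simp only: inner_sum_left, simp only: inner_sum_right,
        simp only: inner_scaleR_left inner_scaleR_right indicator_inter_arith mult_ac)
  qed
  finally show ?thesis .
qed

text \<open>Restates the defining approximation in seminorms on the full product space. This is
  possible because simple integrands vanish outside their interval, just as the zero extension of
  \<open>\<phi>\<close> does.\<close>

lemma has_ito_integralD:
  fixes \<phi> :: "real \<Rightarrow> 'w \<Rightarrow> 'b::{real_inner, second_countable_topology}"
  assumes I: "has_ito_integral s t \<phi> I" and st: "0 \<le> s" "t \<le> T"
  shows "s \<le> t" "square_integrable P I" "I \<in> borel_measurable (F t)" "square_integrable time_space (zero_ext s t \<phi>)"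
    "\<exists>n \<tau> \<xi>. (\<forall>k::nat. simple_integrand s t (n k) (\<tau> k) (\<xi> k)) \<and>
      (\<lambda>k. L2norm time_space (\<lambda>x. (case x of (r, \<omega>) \<Rightarrow> simple_process (n k) (\<tau> k) (\<xi> k) r \<omega>) - zero_ext s t \<phi> x)) \<longlonglongrightarrow> 0 \<and>
      (\<lambda>k. L2norm P (\<lambda>\<omega>. simple_ito (n k) (\<tau> k) (\<xi> k) \<omega> - I \<omega>)) \<longlonglongrightarrow> 0"
proof -
  from I obtain n \<tau> \<xi> where si: "\<And>k::nat. simple_integrand s t (n k) (\<tau> k) (\<xi> k)"
    and c1: "(\<lambda>k. \<integral>\<^sup>+ (r, \<omega>). ennreal ((norm (simple_process (n k) (\<tau> k) (\<xi> k) r \<omega> - \<phi> r \<omega>))\<^sup>2) \<partial>dt_dP s t) \<longlonglongrightarrow> 0"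
    and c2: "(\<lambda>k. \<integral>\<^sup>+ \<omega>. ennreal ((norm (simple_ito (n k) (\<tau> k) (\<xi> k) \<omega> - I \<omega>))\<^sup>2) \<partial>P) \<longlonglongrightarrow> 0"
    unfolding has_ito_integral_def by blast
  show le: "s \<le> t" by (rule simple_integrandD(4)[OF si st])
  have rv: "L2_rv t I" and L2: "L2_F s t \<phi>" using I unfolding has_ito_integral_def by auto
  show m: "I \<in> borel_measurable (F t)" using rv by (simp add: L2_rv_def strongly_measurable_iff_borel)
  have "I \<in> borel_measurable P" by (rule measurable_F_P[OF m]) (use le st in auto)
  then show sq: "square_integrable P I" using rv by (simp add: L2_rv_def square_integrable_def)
  show sq': "square_integrable time_space (zero_ext s t \<phi>)" using L2 unfolding L2_F_iff[OF st] by blast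
  have "(\<integral>\<^sup>+ (r, \<omega>). ennreal ((norm (simple_process (n k) (\<tau> k) (\<xi> k) r \<omega> - \<phi> r \<omega>))\<^sup>2) \<partial>dt_dP s t) =
      (\<integral>\<^sup>+ x. ennreal ((norm ((case x of (r, \<omega>) \<Rightarrow> simple_process (n k) (\<tau> k) (\<xi> k) r \<omega>) - zero_ext s t \<phi> x))\<^sup>2) \<partial>time_space)" for k
    unfolding nn_integral_dt_dP
    by (intro nn_integral_cong) (auto simp: indicator_def simple_process_outside[OF si st])
  then have "(\<lambda>k. L2norm time_space (\<lambda>x. (case x of (r, \<omega>) \<Rightarrow> simple_process (n k) (\<tau> k) (\<xi> k) r \<omega>) - zero_ext s t \<phi> x)) \<longlonglongrightarrow> 0"
    using c1 by (subst tendsto_L2norm_iff_nn_integral)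
      (auto intro!: square_integrable_diff sq' square_integrable_simple_process[OF si st])
  moreover have "(\<lambda>k. L2norm P (\<lambda>\<omega>. simple_ito (n k) (\<tau> k) (\<xi> k) \<omega> - I \<omega>)) \<longlonglongrightarrow> 0"
    using c2 by (subst tendsto_L2norm_iff_nn_integral)
      (auto intro!: square_integrable_diff sq square_integrable_simple_ito[OF si st])
  ultimately show "\<exists>n \<tau> \<xi>. (\<forall>k::nat. simple_integrand s t (n k) (\<tau> k) (\<xi> k)) \<and>
      (\<lambda>k. L2norm time_space (\<lambda>x. (case x of (r, \<omega>) \<Rightarrow> simple_process (n k) (\<tau> k) (\<xi> k) r \<omega>) - zero_ext s t \<phi> x)) \<longlonglongrightarrow> 0 \<and>
      (\<lambda>k. L2norm P (\<lambda>\<omega>. simple_ito (n k) (\<tau> k) (\<xi> k) \<omega> - I \<omega>)) \<longlonglongrightarrow> 0"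
    using si by blast
qed

text \<open>Passes to the limit in the identity for simple integrands. The two intervals may differ,
  which the zero extensions absorb.\<close>

lemma ito_inner:
  fixes \<phi> \<psi> :: "real \<Rightarrow> 'w \<Rightarrow> 'b::{real_inner, second_countable_topology}"
  assumes I: "has_ito_integral s t \<phi> I" "0 \<le> s" "t \<le> T"
    and J: "has_ito_integral s' t' \<psi> J" "0 \<le> s'" "t' \<le> T"
  shows "expectation (\<lambda>\<omega>. I \<omega> \<bullet> J \<omega>) = (\<integral>x. zero_ext s t \<phi> x \<bullet> zero_ext s' t' \<psi> x \<partial>time_space)"
proof -
  note D = has_ito_integralD[OF I] and E = has_ito_integralD[OF J]
  obtain n \<tau> \<xi> where si: "\<And>k::nat. simple_integrand s t (n k) (\<tau> k) (\<xi> k)"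
    and c: "(\<lambda>k. L2norm time_space (\<lambda>x. (case x of (r, \<omega>) \<Rightarrow> simple_process (n k) (\<tau> k) (\<xi> k) r \<omega>) - zero_ext s t \<phi> x)) \<longlonglongrightarrow> 0"
      "(\<lambda>k. L2norm P (\<lambda>\<omega>. simple_ito (n k) (\<tau> k) (\<xi> k) \<omega> - I \<omega>)) \<longlonglongrightarrow> 0"
    using D(5) by blast
  obtain n' \<tau>' \<xi>' where si': "\<And>k::nat. simple_integrand s' t' (n' k) (\<tau>' k) (\<xi>' k)"
    and c': "(\<lambda>k. L2norm time_space (\<lambda>x. (case x of (r, \<omega>) \<Rightarrow> simple_process (n' k) (\<tau>' k) (\<xi>' k) r \<omega>) - zero_ext s' t' \<psi> x)) \<longlonglongrightarrow> 0"
      "(\<lambda>k. L2norm P (\<lambda>\<omega>. simple_ito (n' k) (\<tau>' k) (\<xi>' k) \<omega> - J \<omega>)) \<longlonglongrightarrow> 0"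
    using E(5) by blast
  have "(\<lambda>k. expectation (\<lambda>\<omega>. simple_ito (n k) (\<tau> k) (\<xi> k) \<omega> \<bullet> simple_ito (n' k) (\<tau>' k) (\<xi>' k) \<omega>)) \<longlonglongrightarrow> expectation (\<lambda>\<omega>. I \<omega> \<bullet> J \<omega>)"
    by (intro tendsto_integral_inner D(2) E(2) c(2) c'(2) square_integrable_simple_ito[OF si I(2,3)] square_integrable_simple_ito[OF si' J(2,3)])
  moreover have "(\<lambda>k. expectation (\<lambda>\<omega>. simple_ito (n k) (\<tau> k) (\<xi> k) \<omega> \<bullet> simple_ito (n' k) (\<tau>' k) (\<xi>' k) \<omega>)) \<longlonglongrightarrow>
      (\<integral>x. zero_ext s t \<phi> x \<bullet> zero_ext s' t' \<psi> x \<partial>time_space)"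
    unfolding simple_ito_inner[OF si I(2,3) si' J(2,3)]
    by (intro tendsto_integral_inner D(4) E(4) c(1) c'(1) square_integrable_simple_process[OF si I(2,3)] square_integrable_simple_process[OF si' J(2,3)])
  ultimately show ?thesis by (rule LIMSEQ_unique)
qed

text \<open>Follows from \<open>ito_inner\<close> by expanding the square of the difference. Applied
  to one integrand it gives almost sure uniqueness of the integral; applied to two upper limits it
  controls continuity in time.\<close>

lemma ito_isometry:
  fixes \<phi> \<psi> :: "real \<Rightarrow> 'w \<Rightarrow> 'b::{real_inner, second_countable_topology}"
  assumes I: "has_ito_integral s t \<phi> I" "0 \<le> s" "t \<le> T"
    and J: "has_ito_integral s' t' \<psi> J" "0 \<le> s'" "t' \<le> T"
  shows "L2norm P (\<lambda>\<omega>. I \<omega> - J \<omega>) = L2norm time_space (\<lambda>x. zero_ext s t \<phi> x - zero_ext s' t' \<psi> x)"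
proof -
  note D = has_ito_integralD[OF I] and E = has_ito_integralD[OF J]
  have "(L2norm P (\<lambda>\<omega>. I \<omega> - J \<omega>))\<^sup>2 = (L2norm time_space (\<lambda>x. zero_ext s t \<phi> x - zero_ext s' t' \<psi> x))\<^sup>2"
    unfolding L2norm_diff_squared[OF D(2) E(2)] L2norm_diff_squared[OF D(4) E(4)]
    by (simp only: ito_inner[OF I I] ito_inner[OF I J] ito_inner[OF J J])
  then show ?thesis by (simp add: power2_eq_iff_nonneg)
qed

text \<open>The squared distance of \<open>K\<close> to \<open>I + c J\<close> is a combination of
  inner products of integrals. Each equals the corresponding inner product of integrands, where the
  combination is the norm of an identically zero function.\<close>

lemma ito_linear:
  fixes \<phi> \<psi> :: "real \<Rightarrow> 'w \<Rightarrow> 'b::{real_inner, second_countable_topology}"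
  assumes st: "0 \<le> s" "t \<le> T"
    and I: "has_ito_integral s t \<phi> I" and J: "has_ito_integral s t \<psi> J"
    and K: "has_ito_integral s t (\<lambda>r \<omega>. \<phi> r \<omega> + c *\<^sub>R \<psi> r \<omega>) K"
  shows "AE \<omega> in P. K \<omega> = I \<omega> + c *\<^sub>R J \<omega>"
proof -
  note D = has_ito_integralD[OF I st] and E = has_ito_integralD[OF J st] and L = has_ito_integralD[OF K st]
  note G = ito_inner[OF _ st _ st]
  let ?\<phi> = "zero_ext s t \<phi>" and ?\<psi> = "zero_ext s t \<psi>"
  let ?\<kappa> = "zero_ext s t (\<lambda>r \<omega>. \<phi> r \<omega> + c *\<^sub>R \<psi> r \<omega>)"
  have "(\<lambda>x. ?\<kappa> x - (?\<phi> x + c *\<^sub>R ?\<psi> x)) = (\<lambda>_. 0)" by (auto simp: zero_ext_def fun_eq_iff scaleR_add_right)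
  then have "(L2norm time_space (\<lambda>x. ?\<kappa> x - (?\<phi> x + c *\<^sub>R ?\<psi> x)))\<^sup>2 = 0" by (simp add: L2norm_def)
  then have "(L2norm P (\<lambda>\<omega>. K \<omega> - (I \<omega> + c *\<^sub>R J \<omega>)))\<^sup>2 = 0"
    unfolding L2norm_diff_lincomb_squared[OF L(2) D(2) E(2)] L2norm_diff_lincomb_squared[OF L(4) D(4) E(4)]
    by (simp only: G[OF K K] G[OF K I] G[OF K J] G[OF I I] G[OF I J] G[OF J J])
  then have "L2norm P (\<lambda>\<omega>. K \<omega> - (I \<omega> + c *\<^sub>R J \<omega>)) = 0" by simp
  then show ?thesis
    using D(2) E(2) L(2)
    by (subst (asm) L2norm_eq_0_iff) (auto intro!: square_integrable_diff square_integrable_add square_integrable_scaleR)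
qed

end

section \<open>Delayed averages\<close>

definition grid_cell :: "real \<Rightarrow> real \<Rightarrow> nat \<Rightarrow> real set"
  where "grid_cell a h k = {a + real k * h..<a + real (Suc k) * h}"

text \<open>The first cell has no predecessor inside the interval; the value 0 assigned there
  disappears in the limit because that cell shrinks to a point.\<close>

definition delayed_average :: "real \<Rightarrow> real \<Rightarrow> (real \<Rightarrow> 'b::{banach, second_countable_topology}) \<Rightarrow> nat \<Rightarrow> 'b"
  where "delayed_average a h g k =
    (case k of 0 \<Rightarrow> 0 | Suc j \<Rightarrow> (1 / h) *\<^sub>R (LINT q:grid_cell a h j|lborel. g q))"

definition step_average :: "real \<Rightarrow> real \<Rightarrow> nat \<Rightarrow> (real \<Rightarrow> 'b::{banach, second_countable_topology}) \<Rightarrow> real \<Rightarrow> 'b"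
  where "step_average a h n g r = (\<Sum>k<n. indicator (grid_cell a h k) r *\<^sub>R delayed_average a h g k)"

lemma grid_cell_sets[measurable, simp]: "grid_cell a h k \<in> sets borel"
  by (simp add: grid_cell_def)

lemma sum_indicator_grid_cell:
  assumes "0 < h"
  shows "(\<Sum>k<n. indicator (grid_cell a h k) r :: real) = indicator {a..<a + real n * h} r"
proof (induction n)
  case (Suc n)
  have "0 \<le> real n * h" "0 \<le> h * real n" using assms by simp_all
  then show ?case using assms Suc by (auto simp: indicator_def grid_cell_def algebra_simps)
    (use \<open>0 \<le> h * real n\<close> in linarith)
qed simp

lemma grid_cell_subset:
  assumes "0 < h" "k < n"
  shows "grid_cell a h k \<subseteq> {a..a + real n * h}"
proof -
  have "real (Suc k) * h \<le> real n * h" using assms by (intro mult_right_mono) auto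
  moreover have "0 \<le> real k * h" using assms by simp
  ultimately show ?thesis unfolding grid_cell_def by auto
qed

lemma grid_cell_unique:
  assumes "0 < h" "r \<in> grid_cell a h j" "r \<in> grid_cell a h k"
  shows "j = k"
proof (rule ccontr)
  have aux: "\<not> i < l" if "r \<in> grid_cell a h i" "r \<in> grid_cell a h l" for i l
  proof
    assume "i < l"
    then have "real (Suc i) * h \<le> real l * h" using assms(1) by (intro mult_right_mono) auto
    then show False using that by (auto simp: grid_cell_def)
  qed
  assume "j \<noteq> k"
  then show False using aux[OF assms(2,3)] aux[OF assms(3,2)] by auto
qed

lemma step_average_eq:
  assumes "0 < h" "k < n" "r \<in> grid_cell a h k"
  shows "step_average a h n g r = delayed_average a h g k"
proof -
  have "step_average a h n g r = (\<Sum>j<n. if j = k then delayed_average a h g k else 0)"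
    unfolding step_average_def
  proof (intro sum.cong refl)
    fix j assume "j \<in> {..<n}"
    show "indicator (grid_cell a h j) r *\<^sub>R delayed_average a h g j = (if j = k then delayed_average a h g k else 0)"
      using grid_cell_unique[OF assms(1) _ assms(3), of j] assms(3) by (cases "r \<in> grid_cell a h j") auto
  qed
  then show ?thesis using assms(2) by simp
qed

lemma measure_grid_cell: "0 \<le> h \<Longrightarrow> measure lborel (grid_cell a h k) = h"
  by (simp add: grid_cell_def algebra_simps)

lemma emeasure_grid_cell: "emeasure lborel (grid_cell a h k) < \<infinity>"
  unfolding grid_cell_def by (intro emeasure_bounded_finite bounded_subset[OF bounded_cbox[of "a + real k * h" "a + real (Suc k) * h"]]) auto

lemma norm_delayed_average_le:
  assumes h: "0 < h" and c: "\<And>q. norm (g q) \<le> c" and [measurable]: "g \<in> borel_measurable borel"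
  shows "norm (delayed_average a h g k) \<le> c"
proof (cases k)
  case 0
  then show ?thesis using order_trans[OF norm_ge_zero c] by (simp add: delayed_average_def)
next
  case (Suc j)
  have i: "integrable lborel (\<lambda>q. indicator (grid_cell a h j) q * c)"
    using emeasure_grid_cell by (intro integrable_mult_left integrable_real_indicator) auto
  have "norm (LINT q:grid_cell a h j|lborel. g q) \<le> (\<integral>q. norm (indicator (grid_cell a h j) q *\<^sub>R g q) \<partial>lborel)"
    unfolding set_lebesgue_integral_def by (rule integral_norm_bound)
  also have "\<dots> \<le> (\<integral>q. indicator (grid_cell a h j) q * c \<partial>lborel)"
    by (rule integral_mono[OF Bochner_Integration.integrable_bound[OF i] i])
      (use c order_trans[OF c abs_ge_self] in \<open>auto simp: indicator_def\<close>)
  also have "\<dots> = h * c" using h by (simp add: measure_grid_cell)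
  finally show ?thesis using h by (simp add: delayed_average_def Suc field_simps)
qed

text \<open>Convergence of averages is proved in this norm, for which averaging is a contraction.
  For bounded processes it is later upgraded to mean square by
  \<open>|d|^2 <= 2 m |d|\<close>.\<close>

definition L1norm_on :: "real \<Rightarrow> real \<Rightarrow> (real \<Rightarrow> 'b::real_normed_vector) \<Rightarrow> real"
  where "L1norm_on a b g = (LINT r:{a..b}|lborel. norm (g r))"

lemma step_average_measurable[measurable]: "step_average a h n g \<in> borel_measurable borel"
  unfolding step_average_def[abs_def] by measurable

lemma set_integrable_step_average: "set_integrable lborel {a'..b'} (step_average a h n g)"
proof -
  have "integrable lborel (\<lambda>r. indicator (grid_cell a h k) r *\<^sub>R x)" for k and x :: 'a
    using emeasure_grid_cell by (intro integrable_scaleR_left integrable_real_indicator) auto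
  then have "integrable lborel (step_average a h n g)"
    unfolding step_average_def[abs_def] by (intro Bochner_Integration.integrable_sum)
  then show ?thesis unfolding set_integrable_def by (intro integrable_mult_indicator) auto
qed

text \<open>The contribution of each cell is charged to the integral over the preceding cell, the
  first cell contributes nothing, and the integral over the last cell is left over.\<close>

lemma L1norm_step_average_le:
  fixes g :: "real \<Rightarrow> 'b::{banach, second_countable_topology}"
  assumes h: "0 < h" and g: "set_integrable lborel {a..a + real n * h} g"
  shows "L1norm_on a (a + real n * h) (step_average a h n g) \<le> L1norm_on a (a + real n * h) g"
proof -
  let ?I = "{a..a + real n * h}"
  have gn: "set_integrable lborel ?I (\<lambda>q. norm (g q))" using g by (rule set_integrable_norm)
  have sub: "set_integrable lborel (grid_cell a h k) (\<lambda>q. norm (g q))" if "k < n" for k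
    by (rule set_integrable_subset[OF gn]) (use grid_cell_subset[OF h that] in auto)
  have i: "integrable lborel (\<lambda>r. indicator (grid_cell a h k) r * x)" for k and x :: real
    using emeasure_grid_cell by (intro integrable_mult_left integrable_real_indicator) auto
  have avg: "h * norm (delayed_average a h g (Suc j)) \<le> (LINT q:grid_cell a h j|lborel. norm (g q))" for j
  proof -
    have "norm (LINT q:grid_cell a h j|lborel. g q) \<le> (\<integral>q. norm (indicator (grid_cell a h j) q *\<^sub>R g q) \<partial>lborel)"
      unfolding set_lebesgue_integral_def by (rule integral_norm_bound)
    then show ?thesis using h by (simp add: delayed_average_def set_lebesgue_integral_def)
  qed
  have "L1norm_on a (a + real n * h) (step_average a h n g) \<le>
      (\<integral>r. (\<Sum>k<n. indicator (grid_cell a h k) r * norm (delayed_average a h g k)) \<partial>lborel)"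
    unfolding L1norm_on_def set_lebesgue_integral_def
  proof (rule integral_mono)
    show "integrable lborel (\<lambda>r. indicator ?I r *\<^sub>R norm (step_average a h n g r))"
      using set_integrable_norm[OF set_integrable_step_average] by (simp add: set_integrable_def)
    show "integrable lborel (\<lambda>r. \<Sum>k<n. indicator (grid_cell a h k) r * norm (delayed_average a h g k))"
      by (intro Bochner_Integration.integrable_sum i)
    fix r
    have "norm (step_average a h n g r) \<le> (\<Sum>k<n. indicator (grid_cell a h k) r * norm (delayed_average a h g k))"
      unfolding step_average_def by (rule order_trans[OF norm_sum]) (intro sum_mono, simp)
    then show "indicator ?I r *\<^sub>R norm (step_average a h n g r) \<le> (\<Sum>k<n. indicator (grid_cell a h k) r * norm (delayed_average a h g k))"
      by (auto simp: indicator_def intro!: sum_nonneg)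
  qed
  also have "\<dots> = (\<Sum>k<n. h * norm (delayed_average a h g k))"
    using h i[of _ 1] by (subst Bochner_Integration.integral_sum) (auto intro!: i simp: measure_grid_cell)
  also have "\<dots> \<le> (\<Sum>k<n. LINT q:grid_cell a h k|lborel. norm (g q))"
  proof (cases n)
    case (Suc m)
    \<comment> \<open>The term of index 0 vanishes by the default value, so the remaining sum can be
      shifted to line up averages with the cells they are taken over.\<close>
    have "(\<Sum>k<n. h * norm (delayed_average a h g k)) = (\<Sum>j<m. h * norm (delayed_average a h g (Suc j)))"
      unfolding Suc sum.lessThan_Suc_shift by (simp add: delayed_average_def)
    also have "\<dots> \<le> (\<Sum>j<m. LINT q:grid_cell a h j|lborel. norm (g q))"
      by (intro sum_mono avg)
    also have "\<dots> \<le> (\<Sum>j<n. LINT q:grid_cell a h j|lborel. norm (g q))"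
      unfolding Suc by (simp add: set_lebesgue_integral_def integral_nonneg_AE)
    finally show ?thesis .
  qed simp
  also have "\<dots> = (\<integral>q. (\<Sum>k<n. indicator (grid_cell a h k) q *\<^sub>R norm (g q)) \<partial>lborel)"
    unfolding set_lebesgue_integral_def
    using sub by (subst Bochner_Integration.integral_sum) (auto simp: set_integrable_def)
  also have "\<dots> \<le> L1norm_on a (a + real n * h) g"
    unfolding L1norm_on_def set_lebesgue_integral_def
  proof (rule integral_mono)
    show "integrable lborel (\<lambda>q. \<Sum>k<n. indicator (grid_cell a h k) q *\<^sub>R norm (g q))"
      using sub by (intro Bochner_Integration.integrable_sum) (auto simp: set_integrable_def)
    show "integrable lborel (\<lambda>q. indicator ?I q *\<^sub>R norm (g q))" using gn by (simp add: set_integrable_def)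
    fix q
    have "(\<Sum>k<n. indicator (grid_cell a h k) q *\<^sub>R norm (g q)) = indicator {a..<a + real n * h} q * norm (g q)"
      by (simp add: sum_indicator_grid_cell[OF h, symmetric] sum_distrib_right)
    then show "(\<Sum>k<n. indicator (grid_cell a h k) q *\<^sub>R norm (g q)) \<le> indicator ?I q *\<^sub>R norm (g q)"
      by (auto simp: indicator_def)
  qed
  finally show ?thesis .
qed

lemma delayed_average_add:
  assumes h: "0 < h" and f: "set_integrable lborel {a..a + real n * h} f" and g: "set_integrable lborel {a..a + real n * h} g" and k: "k < n"
  shows "delayed_average a h (\<lambda>r. f r + g r) k = delayed_average a h f k + delayed_average a h g k"
proof (cases k)
  case (Suc j)
  have "j < n" using k Suc by simp
  note s = set_integrable_subset[OF _ _ grid_cell_subset[OF h this]]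
  show ?thesis unfolding Suc delayed_average_def
    by (simp add: set_integral_add[OF s[OF f] s[OF g]] scaleR_add_right)
qed (simp add: delayed_average_def)

lemma step_average_add:
  assumes h: "0 < h" and f: "set_integrable lborel {a..a + real n * h} f" and g: "set_integrable lborel {a..a + real n * h} g"
  shows "step_average a h n (\<lambda>r. f r + g r) r = step_average a h n f r + step_average a h n g r"
  unfolding step_average_def using delayed_average_add[OF h f g]
  by (simp add: sum.distrib scaleR_add_right)

lemma step_average_scaleR:
  fixes c :: "'b::{banach, second_countable_topology}" and f :: "real \<Rightarrow> real"
  assumes "\<And>k. set_integrable lborel (grid_cell a h k) f"
  shows "step_average a h n (\<lambda>r. f r *\<^sub>R c) r = step_average a h n f r *\<^sub>R c"
proof -
  have "(LINT q:grid_cell a h k|lborel. f q *\<^sub>R c) = (LINT q:grid_cell a h k|lborel. f q) *\<^sub>R c" for k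
    unfolding set_lebesgue_integral_def using assms[of k]
    by (subst integral_scaleR_left[symmetric]) (auto simp: set_integrable_def)
  then have "delayed_average a h (\<lambda>r. f r *\<^sub>R c) k = delayed_average a h f k *\<^sub>R c" for k
    by (cases k) (simp_all add: delayed_average_def)
  then show ?thesis unfolding step_average_def
    by (simp only: scaleR_sum_left scaleR_scaleR real_scaleR_def)
qed

lemma step_average_minus: "step_average a h n (\<lambda>r. - g r) r = - step_average a h n g r"
proof -
  have "delayed_average a h (\<lambda>r. - g r) k = - delayed_average a h g k" for k
    by (cases k) (simp_all add: delayed_average_def set_lebesgue_integral_def)
  then show ?thesis unfolding step_average_def by (simp add: sum_negf)
qed

lemma L1norm_on_triangle:
  fixes f g :: "real \<Rightarrow> 'b::{banach, second_countable_topology}"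
  assumes f: "set_integrable lborel {a..b} f" and g: "set_integrable lborel {a..b} g"
  shows "L1norm_on a b (\<lambda>r. f r + g r) \<le> L1norm_on a b f + L1norm_on a b g"
proof -
  note n = set_integrable_norm[OF f] set_integrable_norm[OF g] set_integrable_norm[OF set_integral_add(1)[OF f g]]
  have "L1norm_on a b (\<lambda>r. f r + g r) \<le> (LINT r:{a..b}|lborel. norm (f r) + norm (g r))"
    unfolding L1norm_on_def
    by (intro set_integral_mono n set_integral_add(1)[OF n(1,2)]) (auto intro: norm_triangle_ineq)
  also have "\<dots> = L1norm_on a b f + L1norm_on a b g"
    unfolding L1norm_on_def using n by (intro set_integral_add(2))
  finally show ?thesis .
qed

section \<open>Convergence of the averages as the mesh shrinks\<close>

context
  fixes a b :: real
  assumes ab: "a < b"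
begin

definition "mesh n = (b - a) / real (Suc n)"

lemma mesh_pos: "0 < mesh n" and mesh_end: "a + real (Suc n) * mesh n = b"
  using ab by (auto simp: mesh_def)

lemma mesh_tendsto: "mesh \<longlonglongrightarrow> 0"
proof -
  have "(\<lambda>n. (b - a) * (1 / real (Suc n))) \<longlonglongrightarrow> (b - a) * 0"
    by (intro tendsto_intros LIMSEQ_Suc lim_1_over_n)
  then show ?thesis by (simp add: mesh_def[abs_def])
qed

definition averages_converge :: "(real \<Rightarrow> 'b::{banach, second_countable_topology}) \<Rightarrow> bool"
  where "averages_converge g \<longleftrightarrow>
    (\<lambda>n. L1norm_on a b (\<lambda>r. step_average a (mesh n) (Suc n) g r - g r)) \<longlonglongrightarrow> 0"

lemma contraction:
  fixes g :: "real \<Rightarrow> 'b::{banach, second_countable_topology}"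
  assumes "set_integrable lborel {a..b} g"
  shows "L1norm_on a b (step_average a (mesh n) (Suc n) g) \<le> L1norm_on a b g"
  using L1norm_step_average_le[OF mesh_pos, of a "Suc n" n g] assms unfolding mesh_end by blast

lemma averages_converge_add:
  fixes f g :: "real \<Rightarrow> 'b::{banach, second_countable_topology}"
  assumes f: "set_integrable lborel {a..b} f" "averages_converge f"
    and g: "set_integrable lborel {a..b} g" "averages_converge g"
  shows "averages_converge (\<lambda>r. f r + g r)"
  unfolding averages_converge_def
proof (rule tendsto_sandwich[OF _ _ tendsto_const])
  let ?A = "\<lambda>n. step_average a (mesh n) (Suc n)"
  show "(\<lambda>n. L1norm_on a b (\<lambda>r. ?A n f r - f r) + L1norm_on a b (\<lambda>r. ?A n g r - g r)) \<longlonglongrightarrow> 0"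
    using tendsto_add[OF f(2)[unfolded averages_converge_def] g(2)[unfolded averages_converge_def]] by simp
  have "L1norm_on a b (\<lambda>r. ?A n (\<lambda>r. f r + g r) r - (f r + g r)) \<le>
      L1norm_on a b (\<lambda>r. ?A n f r - f r) + L1norm_on a b (\<lambda>r. ?A n g r - g r)" for n
  proof -
    have eq: "?A n (\<lambda>r. f r + g r) r - (f r + g r) = (?A n f r - f r) + (?A n g r - g r)" for r
      using step_average_add[OF mesh_pos, of a "Suc n" n f g r] f g unfolding mesh_end by simp
    show ?thesis
      unfolding eq
      by (rule L1norm_on_triangle[OF set_integral_diff(1)[OF set_integrable_step_average f(1)]
          set_integral_diff(1)[OF set_integrable_step_average g(1)]])
  qed
  then show "\<forall>\<^sub>F n in sequentially. L1norm_on a b (\<lambda>r. ?A n (\<lambda>r. f r + g r) r - (f r + g r)) \<le>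
      L1norm_on a b (\<lambda>r. ?A n f r - f r) + L1norm_on a b (\<lambda>r. ?A n g r - g r)" by simp
  show "\<forall>\<^sub>F n in sequentially. 0 \<le> L1norm_on a b (\<lambda>r. ?A n (\<lambda>r. f r + g r) r - (f r + g r))"
    by (simp add: L1norm_on_def set_lebesgue_integral_def integral_nonneg_AE)
qed

lemma averages_converge_minus:
  fixes g :: "real \<Rightarrow> 'b::{banach, second_countable_topology}"
  shows "averages_converge g \<Longrightarrow> averages_converge (\<lambda>r. - g r)"
  unfolding averages_converge_def step_average_minus
  by (simp add: L1norm_on_def norm_minus_commute)

text \<open>Approximate \<open>g\<close> by some \<open>s i\<close>. The error enters twice, once
  under averaging and once directly, and the contraction property bounds both by the same small
  number independently of the mesh.\<close>

lemma averages_converge_lim: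
  fixes g :: "real \<Rightarrow> 'b::{banach, second_countable_topology}"
  assumes s: "\<And>i. set_integrable lborel {a..b} (s i)" "\<And>i::nat. averages_converge (s i)"
    and g: "set_integrable lborel {a..b} g"
    and lim: "(\<lambda>i. L1norm_on a b (\<lambda>r. g r - s i r)) \<longlonglongrightarrow> 0"
  shows "averages_converge g"
  unfolding averages_converge_def
proof (rule LIMSEQ_I)
  let ?A = "\<lambda>n. step_average a (mesh n) (Suc n)"
  fix e :: real assume e: "e > 0"
  obtain i where i: "L1norm_on a b (\<lambda>r. g r - s i r) < e / 3"
    using order_tendstoD(2)[OF lim, of "e / 3"] e by (auto simp: eventually_sequentially)
  obtain N where N: "\<And>n. n \<ge> N \<Longrightarrow> L1norm_on a b (\<lambda>r. ?A n (s i) r - s i r) < e / 3"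
    using order_tendstoD(2)[OF s(2)[of i, unfolded averages_converge_def], of "e / 3"] e
    by (auto simp: eventually_sequentially)
  define d where "d r = g r - s i r" for r
  have d: "set_integrable lborel {a..b} d" unfolding d_def using g s(1) by (rule set_integral_diff(1))
  have d': "set_integrable lborel {a..b} (\<lambda>r. - d r)" using d by (simp add: set_integrable_def)
  have gd: "g = (\<lambda>r. s i r + d r)" by (simp add: d_def)
  have "L1norm_on a b (\<lambda>r. ?A n g r - g r) < e" if n: "n \<ge> N" for n
  proof -
    have eq: "?A n g r - g r = (?A n (s i) r - s i r) + (?A n d r + - d r)" for r
      using step_average_add[OF mesh_pos, of a "Suc n" n "s i" d r] s(1)[of i] d unfolding mesh_end gd by simp
    have 1: "L1norm_on a b (\<lambda>r. ?A n g r - g r) \<le> L1norm_on a b (\<lambda>r. ?A n (s i) r - s i r) + L1norm_on a b (\<lambda>r. ?A n d r + - d r)"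
      unfolding eq
      by (intro L1norm_on_triangle set_integral_diff(1) set_integral_add(1) set_integrable_step_average s(1) d')
    have 2: "L1norm_on a b (\<lambda>r. ?A n d r + - d r) \<le> L1norm_on a b (?A n d) + L1norm_on a b (\<lambda>r. - d r)"
      by (intro L1norm_on_triangle set_integrable_step_average d')
    have 3: "L1norm_on a b (\<lambda>r. - d r) = L1norm_on a b d" by (simp add: L1norm_on_def)
    have "L1norm_on a b d < e / 3" using i by (simp add: d_def[abs_def])
    with 1 2 3 contraction[OF d, of n] N[OF n] show ?thesis by linarith
  qed
  then have "norm (L1norm_on a b (\<lambda>r. ?A n g r - g r) - 0) < e" if n: "n \<ge> N" for n
    using that by (simp add: L1norm_on_def set_lebesgue_integral_def integral_nonneg_AE)
  then show "\<exists>N. \<forall>n\<ge>N. norm (L1norm_on a b (\<lambda>r. ?A n g r - g r) - 0) < e" by blast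
qed

lemma set_integrable_bounded:
  fixes g :: "real \<Rightarrow> 'b::{banach, second_countable_topology}"
  assumes [measurable]: "g \<in> borel_measurable borel" and c: "\<And>r. norm (g r) \<le> c"
  shows "set_integrable lborel {a..b} g"
  unfolding set_integrable_def
proof (rule Bochner_Integration.integrable_bound)
  show "integrable lborel (\<lambda>r. indicator {a..b} r * c)"
    by (intro integrable_mult_left integrable_real_indicator) (auto simp: emeasure_lborel_Icc_eq)
  show "AE r in lborel. norm (indicator {a..b} r *\<^sub>R g r) \<le> norm (indicator {a..b} r * c)"
    using c order_trans[OF c abs_ge_self] by (intro AE_I2) (auto simp: indicator_def)
qed measurable

lemma L1norm_on_dominated_convergence:
  fixes g :: "nat \<Rightarrow> real \<Rightarrow> 'b::{banach, second_countable_topology}"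
  assumes [measurable]: "\<And>n. g n \<in> borel_measurable borel" and c: "\<And>n r. norm (g n r) \<le> c"
    and lim: "AE r in lborel. r \<in> {a..b} \<longrightarrow> (\<lambda>n. g n r) \<longlonglongrightarrow> 0"
  shows "(\<lambda>n. L1norm_on a b (g n)) \<longlonglongrightarrow> 0"
proof -
  have "(\<lambda>n. \<integral>r. indicator {a..b} r *\<^sub>R norm (g n r) \<partial>lborel) \<longlonglongrightarrow> (\<integral>(r::real). 0 \<partial>lborel)"
  proof (rule integral_dominated_convergence[where w="\<lambda>r. indicator {a..b} r * c"])
    show "integrable lborel (\<lambda>r. indicator {a..b} r * c)"
      by (intro integrable_mult_left integrable_real_indicator) (auto simp: emeasure_lborel_Icc_eq)
    show "AE r in lborel. (\<lambda>n. indicator {a..b} r *\<^sub>R norm (g n r)) \<longlonglongrightarrow> 0"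
      using lim
    proof eventually_elim
      case (elim r)
      then show ?case by (cases "r \<in> {a..b}") (auto intro: tendsto_norm_zero)
    qed
    show "AE r in lborel. norm (indicator {a..b} r *\<^sub>R norm (g n r)) \<le> indicator {a..b} r * c" for n
      using c by (intro AE_I2) (auto simp: indicator_def)
  qed measurable
  then show ?thesis by (simp add: L1norm_on_def set_lebesgue_integral_def)
qed

text \<open>At a point other than the exceptional one, a fine mesh averages \<open>g\<close> only
  over a neighbourhood where it is constant, so the average is eventually exact; bounded convergence
  finishes. One exceptional point is enough for the indicators of half-lines.\<close>

lemma averages_converge_locally_constant:
  fixes g :: "real \<Rightarrow> real"
  assumes g[measurable]: "g \<in> borel_measurable borel" and c: "\<And>r. norm (g r) \<le> c"
    and lc: "\<And>r. r \<noteq> x \<Longrightarrow> \<exists>\<delta>>0. \<forall>q. \<bar>q - r\<bar> < \<delta> \<longrightarrow> g q = g r"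
  shows "averages_converge g"
  unfolding averages_converge_def
proof (rule L1norm_on_dominated_convergence[where c="c + c"])
  let ?A = "\<lambda>n. step_average a (mesh n) (Suc n)"
  have c0: "0 \<le> c" using order_trans[OF norm_ge_zero c] .
  have "norm (?A n g r) \<le> c" for n r
  proof (cases "\<exists>k<Suc n. r \<in> grid_cell a (mesh n) k")
    case True
    then show ?thesis using step_average_eq[OF mesh_pos, of _ "Suc n" r a n g] norm_delayed_average_le[OF mesh_pos c g] by metis
  next
    case False
    then have "?A n g r = 0" unfolding step_average_def by (intro sum.neutral) auto
    then show ?thesis using c0 by simp
  qed
  then show "norm (?A n g r - g r) \<le> c + c" for n r
    by (rule order_trans[OF norm_triangle_ineq4 add_mono[OF _ c]])
  have "AE r in lborel. r \<noteq> x \<and> r \<noteq> a \<and> r \<noteq> b"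
    using AE_lborel_singleton[of x] AE_lborel_singleton[of a] AE_lborel_singleton[of b] by eventually_elim simp
  then show "AE r in lborel. r \<in> {a..b} \<longrightarrow> (\<lambda>n. ?A n g r - g r) \<longlonglongrightarrow> 0"
  proof eventually_elim
    case (elim r)
    show ?case
    proof
      assume "r \<in> {a..b}"
      then have r: "a < r" "r < b" using elim by auto
      obtain \<delta> where \<delta>: "\<delta> > 0" "\<And>q. \<bar>q - r\<bar> < \<delta> \<Longrightarrow> g q = g r" using lc elim by blast
      \<comment> \<open>A mesh below \<open>\<delta> / 2\<close> keeps the current cell and its
        predecessor within distance \<open>\<delta>\<close> of \<open>r\<close>; a mesh below
        \<open>r - a\<close> keeps \<open>r\<close> out of the first cell, where the average is 0 by
        default.\<close>
      have "\<forall>\<^sub>F n in sequentially. mesh n < min (\<delta> / 2) (r - a)"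
        using \<delta>(1) r by (intro order_tendstoD(2)[OF mesh_tendsto]) auto
      then have "\<forall>\<^sub>F n in sequentially. ?A n g r - g r = 0"
      proof eventually_elim
        case (elim n)
        define h where "h = mesh n"
        have h: "0 < h" "h < \<delta> / 2" "h < r - a" "a + real (Suc n) * h = b" using elim mesh_pos mesh_end by (auto simp: h_def)
        define k where "k = nat \<lfloor>(r - a) / h\<rfloor>"
        have "0 \<le> (r - a) / h" using h r by simp
        then have k1: "real k = of_int \<lfloor>(r - a) / h\<rfloor>" by (simp add: k_def)
        have "real k \<le> (r - a) / h" "(r - a) / h < real k + 1" unfolding k1 by linarith+
        then have k2: "real k * h \<le> r - a" "r - a < (real k + 1) * h"
          using h(1) by (simp_all add: pos_le_divide_eq pos_divide_less_eq)
        have kr: "r \<in> grid_cell a h k" using k2 by (auto simp: grid_cell_def algebra_simps)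
        have "k \<noteq> 0"
        proof
          assume "k = 0"
          then show False using k2(2) h(3) by simp
        qed
        then obtain j where j: "k = Suc j" using not0_implies_Suc by blast
        have kn: "k < Suc n"
        proof (rule ccontr)
          assume "\<not> k < Suc n"
          then have "real (Suc n) * h \<le> real k * h" using h(1) by (intro mult_right_mono) auto
          then show False using k2(1) r(2) h(4) by linarith
        qed
        have near: "g q = g r" if "q \<in> grid_cell a h j" for q
        proof (rule \<delta>(2))
          have "a + real j * h \<le> q" "q < a + real k * h" using that by (auto simp: grid_cell_def j)
          moreover have "real k * h = real j * h + h" by (simp add: j algebra_simps)
          ultimately show "\<bar>q - r\<bar> < \<delta>" using k2 h by (simp add: abs_less_iff algebra_simps)
        qed
        have "(LINT q:grid_cell a h j|lborel. g q) = (LINT q:grid_cell a h j|lborel. g r)"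
          by (intro set_lebesgue_integral_cong) (auto simp: near)
        also have "\<dots> = h * g r"
          unfolding set_lebesgue_integral_def using h(1) by (simp add: measure_grid_cell)
        finally have "delayed_average a h g k = g r" using h(1) by (simp add: delayed_average_def j)
        then show ?case using step_average_eq[OF h(1) kn kr, of g] by (simp add: h_def)
      qed
      then show "(\<lambda>n. ?A n g r - g r) \<longlonglongrightarrow> 0" by (rule tendsto_eventually)
    qed
  qed
qed measurable

text \<open>Dynkin's theorem starting from half-lines. It replaces Lebesgue differentiation:
  convergence in the integral norm is all that is used later.\<close>

lemma averages_converge_indicator:
  assumes "A \<in> sets borel"
  shows "averages_converge (indicator A :: real \<Rightarrow> real)"
proof -
  have I: "set_integrable lborel {a..b} (indicator A :: real \<Rightarrow> real)" if "A \<in> sets borel" for A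
    by (rule set_integrable_bounded[where c=1]) (use that in \<open>auto simp: indicator_def\<close>)
  let ?G = "range (\<lambda>x::real. {..x})"
  have gen: "sets borel = sigma_sets UNIV ?G"
    unfolding borel_eq_atMost by simp
  have "Int_stable ?G"
  proof (rule Int_stableI)
    fix A B assume "A \<in> ?G" "B \<in> ?G"
    then obtain x y where "A = {..x}" "B = {..y}" by blast
    then have "A \<inter> B = {..min x y}" by auto
    then show "A \<inter> B \<in> ?G" by blast
  qed
  then show ?thesis
    using subset_UNIV[of ?G, folded Pow_UNIV] assms[unfolded gen]
  proof (induction rule: sigma_sets_induct_disjoint)
    case (basic A)
    then obtain x where A: "A = {..x}" by blast
    show ?case
      unfolding A
    proof (rule averages_converge_locally_constant[where c=1 and x=x])
      fix r assume "r \<noteq> x"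
      then show "\<exists>\<delta>>0. \<forall>q. \<bar>q - r\<bar> < \<delta> \<longrightarrow> (indicator {..x} q :: real) = indicator {..x} r"
        by (intro exI[of _ "\<bar>r - x\<bar>"]) (auto simp: indicator_def)
    qed (auto simp: indicator_def)
  next
    case empty
    show ?case
      by (rule averages_converge_locally_constant[where c=1 and x=0]) (auto intro: exI[of _ 1])
  next
    case (compl A)
    have A: "A \<in> sets borel" using compl gen by blast
    have "averages_converge (\<lambda>_. 1 :: real)"
      by (rule averages_converge_locally_constant[where c=1 and x=0]) (auto intro: exI[of _ 1])
    moreover have "set_integrable lborel {a..b} (\<lambda>_. 1 :: real)"
      by (rule set_integrable_bounded[where c=1]) auto
    moreover have "set_integrable lborel {a..b} (\<lambda>r. - indicator A r :: real)"
      using I[OF A] by (simp add: set_integrable_def)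
    ultimately have "averages_converge (\<lambda>r. 1 + - indicator A r :: real)"
      using averages_converge_minus[OF compl(2)] by (intro averages_converge_add) auto
    moreover have "(\<lambda>r. 1 + - indicator A r :: real) = indicator (UNIV - A)" by (auto simp: indicator_def)
    ultimately show ?case by simp
  next
    case (union A)
    have A: "A i \<in> sets borel" for i using union(2) gen by blast
    \<comment> \<open>Finite sums of the disjoint indicators converge by additivity; the indicator
      of the union is their limit in the integral norm, by bounded convergence.\<close>
    have s: "averages_converge (\<lambda>r. \<Sum>i<n. indicator (A i) r :: real)
        \<and> set_integrable lborel {a..b} (\<lambda>r. \<Sum>i<n. indicator (A i) r :: real)" for n
    proof (induction n)
      case 0
      have "averages_converge (\<lambda>_. 0 :: real)"
        by (rule averages_converge_locally_constant[where c=1 and x=0]) (auto intro: exI[of _ 1])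
      then show ?case using set_integrable_bounded[of "\<lambda>_. 0::real" 1] by simp
    next
      case (Suc n)
      then show ?case
        using averages_converge_add[of "\<lambda>r. \<Sum>i<n. indicator (A i) r :: real" "indicator (A n)"] union(3)[of n] I[OF A, of n]
        by (simp add: set_integral_add(1))
    qed
    show ?case
    proof (rule averages_converge_lim[where s="\<lambda>n r. \<Sum>i<n. indicator (A i) r :: real"])
      show "set_integrable lborel {a..b} (indicator (\<Union>i. A i) :: real \<Rightarrow> real)" using A by (intro I) auto
      have eq: "(\<Sum>i<n. indicator (A i) r :: real) = indicator (\<Union>i<n. A i) r" for n r
        using union(1) by (intro indicator_UN_disjoint[symmetric]) (auto simp: disjoint_family_on_def)
      show "(\<lambda>n. L1norm_on a b (\<lambda>r. indicator (\<Union>i. A i) r - (\<Sum>i<n. indicator (A i) r :: real))) \<longlonglongrightarrow> 0"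
        unfolding eq
      proof (rule L1norm_on_dominated_convergence[where c=1])
        show "(\<lambda>r. indicator (\<Union>i. A i) r - indicator (\<Union>i<n. A i) r :: real) \<in> borel_measurable borel" for n
          using A by measurable
        show "norm (indicator (\<Union>i. A i) r - indicator (\<Union>i<n. A i) r :: real) \<le> 1" for n r
          by (auto simp: indicator_def)
        show "AE r in lborel. r \<in> {a..b} \<longrightarrow> (\<lambda>n. indicator (\<Union>i. A i) r - indicator (\<Union>i<n. A i) r :: real) \<longlonglongrightarrow> 0"
        proof (intro AE_I2 impI)
          fix r
          have "(\<lambda>n. indicator (\<Union>i<n. A i) r :: real) \<longlonglongrightarrow> indicator (\<Union>i. A i) r"
            by (rule LIMSEQ_indicator_UN)
          from tendsto_diff[OF tendsto_const[of "indicator (\<Union>i. A i) r"] this]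
          show "(\<lambda>n. indicator (\<Union>i. A i) r - indicator (\<Union>i<n. A i) r :: real) \<longlonglongrightarrow> 0" by simp
        qed
      qed
    qed (use s in auto)
  qed
qed

text \<open>The class of functions with convergent averages contains indicators times vectors, is
  closed under sums and under dominated limits, and hence contains every integrable
  function.\<close>

lemma averages_converge_integrable:
  fixes g :: "real \<Rightarrow> 'b::{banach, second_countable_topology}"
  assumes "integrable lborel g"
  shows "averages_converge g"
proof -
  have si: "set_integrable lborel {a..b} f" if "integrable lborel f" for f :: "real \<Rightarrow> 'b"
    using that unfolding set_integrable_def by (intro integrable_mult_indicator) auto
  show ?thesis
    using assms
  proof (induction rule: integrable_induct)
    case (base A c)
    have "set_integrable lborel (grid_cell a h k) (indicator A :: real \<Rightarrow> real)" for h k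
      unfolding set_integrable_def using base by (intro integrable_mult_indicator integrable_real_indicator) auto
    note sc = step_average_scaleR[OF this]
    have "L1norm_on a b (\<lambda>r. step_average a (mesh n) (Suc n) (\<lambda>x. indicator A x *\<^sub>R c) r - indicator A r *\<^sub>R c) =
        L1norm_on a b (\<lambda>r. step_average a (mesh n) (Suc n) (indicator A) r - indicator A r :: real) * norm c" for n
      unfolding sc L1norm_on_def scaleR_diff_left[symmetric] norm_scaleR
      by (simp add: set_lebesgue_integral_def mult.assoc[symmetric])
    then show ?case
      using averages_converge_indicator[of A] base
      unfolding averages_converge_def by (auto intro: tendsto_mult_left_zero)
  next
    case (add f g)
    then show ?case by (intro averages_converge_add si) auto
  next
    case (lim f s)
    show ?case
    proof (rule averages_converge_lim[of s])
      have "(\<lambda>i. \<integral>r. indicator {a..b} r *\<^sub>R norm (f r - s i r) \<partial>lborel) \<longlonglongrightarrow> (\<integral>(r::real). 0 \<partial>lborel)"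
      \<comment> \<open>The approximants in the induction satisfy
        \<open>norm (s i r) <= 2 * norm (f r)\<close>, which yields the factor 3.\<close>
      proof (rule integral_dominated_convergence[where w="\<lambda>r. 3 * norm (f r)"])
        show "AE r in lborel. (\<lambda>i. indicator {a..b} r *\<^sub>R norm (f r - s i r)) \<longlonglongrightarrow> 0"
        proof (rule AE_I2)
          fix r
          have "(\<lambda>i. f r - s i r) \<longlonglongrightarrow> f r - f r" using lim.hyps(2)[of r] by (intro tendsto_intros) auto
          then have "(\<lambda>i. indicator {a..b} r *\<^sub>R norm (f r - s i r)) \<longlonglongrightarrow> indicator {a..b} r *\<^sub>R norm (f r - f r)"
            by (rule tendsto_scaleR[OF tendsto_const tendsto_norm])
          then show "(\<lambda>i. indicator {a..b} r *\<^sub>R norm (f r - s i r)) \<longlonglongrightarrow> 0" by simp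
        qed
        show "AE r in lborel. norm (indicator {a..b} r *\<^sub>R norm (f r - s i r)) \<le> 3 * norm (f r)" for i
        proof (rule AE_I2)
          fix r
          have "norm (f r - s i r) \<le> norm (f r) + norm (s i r)" by (rule norm_triangle_ineq4)
          moreover have "norm (s i r) \<le> 2 * norm (f r)" using lim.hyps(3)[of r i] by simp
          ultimately have "norm (f r - s i r) \<le> 3 * norm (f r)" by simp
          then show "norm (indicator {a..b} r *\<^sub>R norm (f r - s i r)) \<le> 3 * norm (f r)"
            by (auto simp: indicator_def)
        qed
      qed (use lim in auto)
      then show "(\<lambda>i. L1norm_on a b (\<lambda>r. f r - s i r)) \<longlonglongrightarrow> 0"
        by (simp add: L1norm_on_def set_lebesgue_integral_def)
    qed (use lim si in auto)
  qed
qed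

end

section \<open>Existence of the Ito integral\<close>

text \<open>Large values are set to 0 instead of being rescaled: the error is then either 0 or the
  value itself, and truncation preserves 0, so it commutes with extension by zero.\<close>

definition truncate :: "real \<Rightarrow> 'b::real_normed_vector \<Rightarrow> 'b"
  where "truncate m x = (if norm x \<le> m then x else 0)"

lemma truncate_measurable[measurable]: "truncate m \<in> borel_measurable borel"
  unfolding truncate_def[abs_def] by measurable

lemma norm_truncate_le: "0 \<le> m \<Longrightarrow> norm (truncate m x) \<le> m" "norm (truncate m x) \<le> norm x"
  "norm (truncate m x - x) \<le> norm x"
  by (auto simp: truncate_def)

lemma truncate_zero[simp]: "truncate m 0 = 0"
  by (simp add: truncate_def)

lemma zero_ext_truncate: "zero_ext s t (\<lambda>r \<omega>. truncate m (\<phi> r \<omega>)) = (\<lambda>x. truncate m (zero_ext s t \<phi> x))"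
  by (auto simp: zero_ext_def fun_eq_iff indicator_def)

context brownian_motion
begin

lemma L2_F_truncate:
  fixes \<phi> :: "real \<Rightarrow> 'w \<Rightarrow> 'b::{real_normed_vector, second_countable_topology}"
  assumes \<phi>: "L2_F s t \<phi>" and st: "0 \<le> s" "t \<le> T"
  shows "L2_F s t (\<lambda>r \<omega>. truncate m (\<phi> r \<omega>))"
proof -
  have p: "prog_measurable s t \<phi>" and sq: "square_integrable time_space (zero_ext s t \<phi>)"
    using \<phi> unfolding L2_F_iff[OF st] by auto
  have "prog_measurable s t (\<lambda>r \<omega>. truncate m (\<phi> r \<omega>))"
    unfolding prog_measurable_iff zero_ext_truncate
    using prog_measurable_zero_ext[OF p] by (auto intro: measurable_compose[OF _ truncate_measurable])
  moreover have "square_integrable time_space (\<lambda>x. truncate m (zero_ext s t \<phi> x))"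
    by (rule square_integrable_bound[OF sq, where c=1])
      (use sq norm_truncate_le(2) in \<open>auto simp: square_integrable_def intro: measurable_compose[OF _ truncate_measurable]\<close>)
  ultimately show ?thesis unfolding L2_F_iff[OF st] zero_ext_truncate by blast
qed

lemma truncate_tendsto_L2:
  fixes f :: "'a \<Rightarrow> 'b::{real_normed_vector, second_countable_topology}"
  assumes f: "square_integrable N f"
  shows "(\<lambda>k. L2norm N (\<lambda>x. truncate (real k) (f x) - f x)) \<longlonglongrightarrow> 0"
proof -
  have [measurable]: "f \<in> borel_measurable N" using f by (simp add: square_integrable_def)
  have "(\<lambda>k. \<integral>x. (norm (truncate (real k) (f x) - f x))\<^sup>2 \<partial>N) \<longlonglongrightarrow> (\<integral>x. 0 \<partial>N)"
  proof (rule integral_dominated_convergence[where w="\<lambda>x. (norm (f x))\<^sup>2"])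
    show "integrable N (\<lambda>x. (norm (f x))\<^sup>2)" using f by (simp add: square_integrable_def)
    show "AE x in N. norm ((norm (truncate (real k) (f x) - f x))\<^sup>2) \<le> (norm (f x))\<^sup>2" for k
      by (intro AE_I2) (simp add: norm_truncate_le power_mono)
    show "AE x in N. (\<lambda>k. (norm (truncate (real k) (f x) - f x))\<^sup>2) \<longlonglongrightarrow> 0"
    proof (intro AE_I2 tendsto_eventually)
      fix x
      obtain K where "norm (f x) \<le> real K" using real_arch_simple by blast
      then show "\<forall>\<^sub>F k in sequentially. (norm (truncate (real k) (f x) - f x))\<^sup>2 = 0"
        by (intro eventually_sequentiallyI[of K]) (simp add: truncate_def)
    qed
  qed measurable
  from tendsto_real_sqrt[OF this] show ?thesis by (simp add: L2norm_def)
qed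

text \<open>Convergence of averages is applied to each path; boundedness then allows dominated
  convergence over the probability space and the passage to mean square. It also makes the
  coefficients bounded, as simple integrands require.\<close>

lemma simple_approximation_bounded:
  fixes \<phi> :: "real \<Rightarrow> 'w \<Rightarrow> 'b::{banach, second_countable_topology}"
  assumes \<phi>: "L2_F s t \<phi>" and st: "0 \<le> s" "s < t" "t \<le> T" and m: "\<And>r \<omega>. norm (\<phi> r \<omega>) \<le> m"
  defines "\<tau> \<equiv> \<lambda>n k. s + real k * mesh s t n"
    and "\<xi> \<equiv> \<lambda>n k \<omega>. delayed_average s (mesh s t n) (\<lambda>q. zero_ext s t \<phi> (q, \<omega>)) k"
  shows "simple_integrand s t (Suc n) (\<tau> n) (\<xi> n)"
    "(\<lambda>n. L2norm time_space (\<lambda>x. (case x of (r, \<omega>) \<Rightarrow> simple_process (Suc n) (\<tau> n) (\<xi> n) r \<omega>) - zero_ext s t \<phi> x)) \<longlonglongrightarrow> 0"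
proof -
  note h = mesh_pos[OF st(2)] and e = mesh_end[OF st(2)]
  have m0: "0 \<le> m" using order_trans[OF norm_ge_zero m] .
  have p: "prog_measurable s t \<phi>" and sq: "square_integrable time_space (zero_ext s t \<phi>)"
    using \<phi> unfolding L2_F_iff[OF st(1,3)] by auto
  have z[measurable]: "zero_ext s t \<phi> \<in> borel_measurable time_space" using sq by (simp add: square_integrable_def)
  have zb: "norm (zero_ext s t \<phi> x) \<le> m" for x using m m0 by (auto simp: zero_ext_def indicator_def split: prod.split)
  have sec: "(\<lambda>q. zero_ext s t \<phi> (q, \<omega>)) \<in> borel_measurable borel" if "\<omega> \<in> space P" for \<omega>
    using measurable_Pair1[OF z that] by simp
  have \<xi>b: "norm (\<xi> n k \<omega>) \<le> m" if "\<omega> \<in> space P" for n k \<omega>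
    unfolding \<xi>_def using sec[OF that] zb by (intro norm_delayed_average_le h) auto
  have \<xi>m: "\<xi> n k \<in> borel_measurable (F (\<tau> n k))" if "k < Suc n" for n k
  proof (cases k)
    case 0
    then show ?thesis by (simp add: \<xi>_def delayed_average_def)
  next
    case (Suc j)
    have "\<tau> n k \<in> grid_cell s (mesh s t n) k" unfolding \<tau>_def grid_cell_def using h[of n] by (simp add: algebra_simps)
    then have \<tau>: "\<tau> n k \<in> {s..t}" using grid_cell_subset[OF h[of n] that, of s] unfolding e by blast
    \<comment> \<open>Cell \<open>j\<close> ends exactly at \<open>\<tau> n k\<close>, so its
      average depends only on the process up to \<open>\<tau> n k\<close> and inherits measurability
      with respect to \<open>F (\<tau> n k)\<close> from progressive measurability.\<close>
    have sub: "grid_cell s (mesh s t n) j \<subseteq> {s..\<tau> n k}"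
      using grid_cell_subset[OF h[of n], of j k s] unfolding \<tau>_def Suc by simp
    have [measurable]: "zero_ext s (\<tau> n k) \<phi> \<in> borel_measurable (borel \<Otimes>\<^sub>M F (\<tau> n k))"
      by (rule prog_measurable_zero_ext[OF p \<tau>])
    have "(\<lambda>\<omega>. \<integral>q. indicator (grid_cell s (mesh s t n) j) q *\<^sub>R zero_ext s (\<tau> n k) \<phi> (q, \<omega>) \<partial>lborel)
        \<in> borel_measurable (F (\<tau> n k))"
      by (rule lborel.borel_measurable_lebesgue_integral) measurable
    also have "(\<lambda>\<omega>. \<integral>q. indicator (grid_cell s (mesh s t n) j) q *\<^sub>R zero_ext s (\<tau> n k) \<phi> (q, \<omega>) \<partial>lborel) =
        (\<lambda>\<omega>. LINT q:grid_cell s (mesh s t n) j|lborel. zero_ext s t \<phi> (q, \<omega>))"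
      unfolding set_lebesgue_integral_def
      using sub \<tau> by (intro ext Bochner_Integration.integral_cong) (auto simp: indicator_def subset_iff)
    finally show ?thesis by (simp add: \<xi>_def delayed_average_def Suc)
  qed
  show si: "simple_integrand s t (Suc n) (\<tau> n) (\<xi> n)" for n
    unfolding simple_integrand_def
  proof (intro conjI allI impI)
    show "\<tau> n 0 = s" by (simp add: \<tau>_def)
    show "\<tau> n (Suc n) = t" using e by (simp add: \<tau>_def)
    fix i assume i: "i < Suc n"
    show "\<tau> n i < \<tau> n (Suc i)" using h[of n] by (simp add: \<tau>_def algebra_simps)
    show "strongly_measurable (F (\<tau> n i)) (\<xi> n i)"
      using \<xi>m[OF i] by (simp add: strongly_measurable_iff_borel)
    show "bounded (\<xi> n i ` space P)" using \<xi>b by (auto simp: bounded_iff)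
  qed
  have sp: "simple_process (Suc n) (\<tau> n) (\<xi> n) r \<omega> =
      step_average s (mesh s t n) (Suc n) (\<lambda>q. zero_ext s t \<phi> (q, \<omega>)) r" for n r \<omega>
    by (simp add: simple_process_def step_average_def grid_cell_def \<tau>_def \<xi>_def)
  let ?d = "\<lambda>n x. (case x of (r, \<omega>) \<Rightarrow> simple_process (Suc n) (\<tau> n) (\<xi> n) r \<omega>) - zero_ext s t \<phi> x"
  have sqd: "square_integrable time_space (?d n)" for n
    by (intro square_integrable_diff sq square_integrable_simple_process[OF si] st)
  have dm[measurable]: "?d n \<in> borel_measurable time_space" for n
    using sqd[of n] by (simp add: square_integrable_def)
  have d_eq: "(\<lambda>(r, \<omega>). norm (?d n (r, \<omega>))) = (\<lambda>x. norm (?d n x))" for n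
    by (auto simp del: zero_ext_apply)
  have out: "?d n (r, \<omega>) = 0" if "r \<notin> {s..t}" for n r \<omega>
    using simple_process_outside[OF si st(1,3) that] that by simp
  have db: "norm (?d n (r, \<omega>)) \<le> 2 * m" if w: "\<omega> \<in> space P" for n r \<omega>
  proof -
    have "norm (simple_process (Suc n) (\<tau> n) (\<xi> n) r \<omega>) \<le> m"
    proof (cases "\<exists>k<Suc n. r \<in> grid_cell s (mesh s t n) k")
      case True
      then obtain k where "k < Suc n" "r \<in> grid_cell s (mesh s t n) k" by blast
      then show ?thesis unfolding sp step_average_eq[OF h] using \<xi>b[OF w, of n k] by (simp add: \<xi>_def step_average_eq[OF h])
    next
      case False
      then have "simple_process (Suc n) (\<tau> n) (\<xi> n) r \<omega> = 0"
        unfolding sp step_average_def by (intro sum.neutral) auto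
      then show ?thesis using m0 by simp
    qed
    with zb[of "(r, \<omega>)"] show ?thesis
      using norm_triangle_ineq4[of "simple_process (Suc n) (\<tau> n) (\<xi> n) r \<omega>" "zero_ext s t \<phi> (r, \<omega>)"] by simp
  qed
  have i1: "integrable time_space (\<lambda>(r, \<omega>). norm (?d n (r, \<omega>)))" for n
  proof (rule Bochner_Integration.integrable_bound)
    show "integrable time_space (\<lambda>(r, \<omega>). indicator {s..t} r * (2 * m))"
      by (intro integral_time_space_product) (auto simp: emeasure_lborel_Icc_eq)
    show "AE x in time_space. norm (case x of (r, \<omega>) \<Rightarrow> norm (?d n (r, \<omega>))) \<le> norm (case x of (r, \<omega>) \<Rightarrow> indicator {s..t} r * (2 * m))"
    proof (rule AE_I2)
      fix x assume "x \<in> space time_space"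
      then obtain r \<omega> where x: "x = (r, \<omega>)" "\<omega> \<in> space P" by (auto simp: space_pair_measure)
      show "norm (case x of (r, \<omega>) \<Rightarrow> norm (?d n (r, \<omega>))) \<le> norm (case x of (r, \<omega>) \<Rightarrow> indicator {s..t} r * (2 * m))"
        using db[OF x(2), of n r] out[of r n \<omega>] m0 unfolding x(1) by (cases "r \<in> {s..t}") auto
    qed
    show "(\<lambda>(r, \<omega>). norm (?d n (r, \<omega>))) \<in> borel_measurable time_space"
      unfolding d_eq by (rule measurable_compose[OF dm[of n] borel_measurable_norm])
  qed
  let ?L = "\<lambda>n \<omega>. L1norm_on s t (\<lambda>r. step_average s (mesh s t n) (Suc n) (\<lambda>q. zero_ext s t \<phi> (q, \<omega>)) r - zero_ext s t \<phi> (r, \<omega>))"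
  have L: "?L n \<omega> = (\<integral>r. norm (?d n (r, \<omega>)) \<partial>lborel)" for n \<omega>
    unfolding L1norm_on_def set_lebesgue_integral_def
    using out by (intro Bochner_Integration.integral_cong) (auto simp: sp indicator_def)
  have iL: "integrable P (?L n)" "expectation (?L n) = (\<integral>x. norm (?d n x) \<partial>time_space)" for n
    unfolding L using time_space.integrable_snd[OF i1[of n]] time_space.integral_snd[OF i1[of n]]
    unfolding d_eq .
  \<comment> \<open>The pathwise distances tend to 0 almost surely and are all bounded by the length
    of the interval times \<open>2 m\<close>.\<close>
  have "(\<lambda>n. expectation (?L n)) \<longlonglongrightarrow> (\<integral>\<omega>. 0 \<partial>P)"
  proof (rule integral_dominated_convergence[where w="\<lambda>_. (t - s) * (2 * m)"])
    have ae: "AE \<omega> in P. integrable lborel (\<lambda>r. zero_ext s t \<phi> (r, \<omega>))"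
    proof (rule AE_I2)
      fix \<omega> assume w: "\<omega> \<in> space P"
      have "set_integrable lborel {s..t} (\<lambda>r. zero_ext s t \<phi> (r, \<omega>))"
        by (rule set_integrable_bounded[OF st(2) sec[OF w] zb])
      then show "integrable lborel (\<lambda>r. zero_ext s t \<phi> (r, \<omega>))"
        unfolding set_integrable_def
        by (rule Bochner_Integration.integrable_cong[THEN iffD1, rotated -1]) (auto simp: indicator_def)
    qed
    then show "AE \<omega> in P. (\<lambda>n. ?L n \<omega>) \<longlonglongrightarrow> 0"
    proof eventually_elim
      case (elim \<omega>)
      from averages_converge_integrable[OF st(2) elim] show ?case
        unfolding averages_converge_def[OF st(2)] .
    qed
    show "AE \<omega> in P. norm (?L n \<omega>) \<le> (t - s) * (2 * m)" for n
    proof (rule AE_I2)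
      fix \<omega> assume w: "\<omega> \<in> space P"
      have "?L n \<omega> \<le> (\<integral>r. indicator {s..t} r * (2 * m) \<partial>lborel)"
        unfolding L
      proof (rule integral_mono_AE')
        show "integrable lborel (\<lambda>r. indicator {s..t} r * (2 * m))"
          by (intro integrable_mult_left integrable_real_indicator) (auto simp: emeasure_lborel_Icc_eq)
        show "AE r in lborel. norm (?d n (r, \<omega>)) \<le> indicator {s..t} r * (2 * m)"
        proof (rule AE_I2)
          fix r
          show "norm (?d n (r, \<omega>)) \<le> indicator {s..t} r * (2 * m)"
            using db[OF w, of n r] out[of r n \<omega>] by (cases "r \<in> {s..t}") auto
        qed
      qed (use m0 in \<open>auto simp: mult_nonneg_nonneg\<close>)
      also have "\<dots> = (t - s) * (2 * m)" using st by simp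
      finally show "norm (?L n \<omega>) \<le> (t - s) * (2 * m)"
        unfolding L by (simp add: integral_nonneg_AE)
    qed
  qed (use iL in auto)
  then have lim: "(\<lambda>n. 2 * m * (\<integral>x. norm (?d n x) \<partial>time_space)) \<longlonglongrightarrow> 0"
    unfolding iL by (intro tendsto_mult_right_zero) simp
  \<comment> \<open>Upgrade to mean square: one factor of the squared norm is bounded by
    \<open>2 m\<close>.\<close>
  have le: "(L2norm time_space (?d n))\<^sup>2 \<le> 2 * m * (\<integral>x. norm (?d n x) \<partial>time_space)" for n
  proof -
    have i1': "integrable time_space (\<lambda>x. norm (?d n x))" using i1[of n] unfolding d_eq .
    have "(L2norm time_space (?d n))\<^sup>2 \<le> (\<integral>x. 2 * m * norm (?d n x) \<partial>time_space)"
      unfolding L2norm_squared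
    proof (rule integral_mono)
      show "integrable time_space (\<lambda>x. (norm (?d n x))\<^sup>2)" using sqd[of n] by (simp add: square_integrable_def)
      show "integrable time_space (\<lambda>x. 2 * m * norm (?d n x))" using i1' by simp
      fix x assume "x \<in> space time_space"
      then obtain r \<omega> where x: "x = (r, \<omega>)" "\<omega> \<in> space P" by (auto simp: space_pair_measure)
      show "(norm (?d n x))\<^sup>2 \<le> 2 * m * norm (?d n x)"
        using mult_right_mono[OF db[OF x(2), of n r] norm_ge_zero[of "?d n (r, \<omega>)"]] unfolding x(1) power2_eq_square .
    qed
    then show ?thesis by simp
  qed
  have "(\<lambda>n. (L2norm time_space (?d n))\<^sup>2) \<longlonglongrightarrow> 0"
    by (rule tendsto_sandwich[OF _ _ tendsto_const lim]) (use le in auto)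
  from tendsto_real_sqrt[OF this] show "(\<lambda>n. L2norm time_space (?d n)) \<longlonglongrightarrow> 0" by simp
qed

lemma simple_approximation:
  fixes \<phi> :: "real \<Rightarrow> 'w \<Rightarrow> 'b::{banach, second_countable_topology}"
  assumes \<phi>: "L2_F s t \<phi>" and st: "0 \<le> s" "s \<le> t" "t \<le> T" and e: "0 < e"
  shows "\<exists>n \<tau> \<xi>. simple_integrand s t n \<tau> \<xi> \<and>
    L2norm time_space (\<lambda>x. (case x of (r, \<omega>) \<Rightarrow> simple_process n \<tau> \<xi> r \<omega>) - zero_ext s t \<phi> x) \<le> e"
proof (cases "s = t")
  case True
  have m: "zero_ext s t \<phi> \<in> borel_measurable time_space"
    using \<phi> unfolding L2_F_iff[OF st(1,3)] square_integrable_def by blast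
  \<comment> \<open>The slab over a single instant is null, so the partition with
    \<open>n = 0\<close> and the empty sum already represent the process exactly.\<close>
  have "AE x in time_space. fst x \<noteq> s"
  proof (rule AE_I[of _ _ "{s} \<times> space P"])
    show "emeasure time_space ({s} \<times> space P) = 0" by (subst emeasure_pair_measure_Times) auto
  qed (auto simp: space_pair_measure)
  then have "AE x in time_space. zero_ext s t \<phi> x = 0"
    by eventually_elim (use True in \<open>auto simp: zero_ext_def split: prod.split\<close>)
  then have "L2norm time_space (zero_ext s t \<phi>) = L2norm time_space (\<lambda>_. 0 :: 'b)"
    using m by (intro L2norm_cong_AE) auto
  then have "L2norm time_space (\<lambda>x. (case x of (r, \<omega>) \<Rightarrow> simple_process 0 (\<lambda>_. s) (\<lambda>_ _. 0) r \<omega>) - zero_ext s t \<phi> x) \<le> e"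
    using e by (simp add: simple_process_def L2norm_def case_prod_unfold)
  moreover have "simple_integrand s t 0 (\<lambda>_. s) (\<lambda>_ _. 0 :: 'b)"
    using True by (simp add: simple_integrand_def)
  ultimately show ?thesis by blast
next
  case False
  then have st': "s < t" using st by simp
  have sq: "square_integrable time_space (zero_ext s t \<phi>)" using \<phi> unfolding L2_F_iff[OF st(1,3)] by blast
  obtain k where k: "L2norm time_space (\<lambda>x. truncate (real k) (zero_ext s t \<phi> x) - zero_ext s t \<phi> x) < e / 2"
    using order_tendstoD(2)[OF truncate_tendsto_L2[OF sq], of "e / 2"] e by (auto simp: eventually_sequentially)
  define \<psi> where "\<psi> r \<omega> = truncate (real k) (\<phi> r \<omega>)" for r \<omega>
  have \<psi>: "L2_F s t \<psi>" unfolding \<psi>_def by (rule L2_F_truncate[OF \<phi> st(1,3)])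
  have z: "zero_ext s t \<psi> = (\<lambda>x. truncate (real k) (zero_ext s t \<phi> x))"
    unfolding \<psi>_def[abs_def] by (rule zero_ext_truncate)
  have \<psi>b: "norm (\<psi> r \<omega>) \<le> real k" for r \<omega> unfolding \<psi>_def by (rule norm_truncate_le) simp
  note A = simple_approximation_bounded[OF \<psi> st(1) st' st(3) \<psi>b]
  let ?\<tau> = "\<lambda>n k. s + real k * mesh s t n"
    and ?\<xi> = "\<lambda>n k \<omega>. delayed_average s (mesh s t n) (\<lambda>q. zero_ext s t \<psi> (q, \<omega>)) k"
  obtain n where n: "L2norm time_space (\<lambda>x. (case x of (r, \<omega>) \<Rightarrow> simple_process (Suc n) (?\<tau> n) (?\<xi> n) r \<omega>) - zero_ext s t \<psi> x) < e / 2"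
    using order_tendstoD(2)[OF A(2), of "e / 2"] e by (auto simp: eventually_sequentially)
  have "L2norm time_space (\<lambda>x. (case x of (r, \<omega>) \<Rightarrow> simple_process (Suc n) (?\<tau> n) (?\<xi> n) r \<omega>) - zero_ext s t \<phi> x)
     \<le> L2norm time_space (\<lambda>x. (case x of (r, \<omega>) \<Rightarrow> simple_process (Suc n) (?\<tau> n) (?\<xi> n) r \<omega>) - zero_ext s t \<psi> x)
      + L2norm time_space (\<lambda>x. zero_ext s t \<psi> x - zero_ext s t \<phi> x)"
    by (rule L2norm_triangle_diff[OF square_integrable_simple_process[OF A(1) st(1,3)] _ sq])
      (use \<psi> in \<open>simp add: L2_F_iff[OF st(1,3)]\<close>)
  also have "\<dots> \<le> e" using n k unfolding z by simp
  finally show ?thesis using A(1)[of n] by blast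
qed

lemma L2norm_simple_ito_diff:
  fixes \<xi> \<xi>' :: "nat \<Rightarrow> 'w \<Rightarrow> 'b::{real_inner, second_countable_topology}"
  assumes si: "simple_integrand s t n \<tau> \<xi>" "0 \<le> s" "t \<le> T"
    and si': "simple_integrand s' t' m \<tau>' \<xi>'" "0 \<le> s'" "t' \<le> T"
  shows "L2norm P (\<lambda>\<omega>. simple_ito n \<tau> \<xi> \<omega> - simple_ito m \<tau>' \<xi>' \<omega>) =
    L2norm time_space (\<lambda>x. (\<lambda>(r, \<omega>). simple_process n \<tau> \<xi> r \<omega>) x - (\<lambda>(r, \<omega>). simple_process m \<tau>' \<xi>' r \<omega>) x)"
proof -
  have "(L2norm P (\<lambda>\<omega>. simple_ito n \<tau> \<xi> \<omega> - simple_ito m \<tau>' \<xi>' \<omega>))\<^sup>2 =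
    (L2norm time_space (\<lambda>x. (\<lambda>(r, \<omega>). simple_process n \<tau> \<xi> r \<omega>) x - (\<lambda>(r, \<omega>). simple_process m \<tau>' \<xi>' r \<omega>) x))\<^sup>2"
    unfolding L2norm_diff_squared[OF square_integrable_simple_ito[OF si] square_integrable_simple_ito[OF si']]
      L2norm_diff_squared[OF square_integrable_simple_process[OF si] square_integrable_simple_process[OF si']]
    by (simp only: simple_ito_inner[OF si si] simple_ito_inner[OF si si'] simple_ito_inner[OF si' si'])
  then show ?thesis by (simp add: power2_eq_iff_nonneg)
qed

text \<open>Simple integrands are chosen with error \<open>(1/2)^k\<close>. The isometry transfers
  this rate to their integrals, which therefore converge both almost surely and in mean
  square.\<close>

lemma ito_integral_exists:
  fixes \<phi> :: "real \<Rightarrow> 'w \<Rightarrow> 'b::{real_inner, banach, second_countable_topology}"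
  assumes \<phi>: "L2_F s t \<phi>" and st: "0 \<le> s" "s \<le> t" "t \<le> T"
  shows "\<exists>I. has_ito_integral s t \<phi> I"
proof -
  let ?sp = "\<lambda>n \<tau> \<xi> x. (\<lambda>(r, \<omega>). simple_process n \<tau> \<xi> r \<omega>) x :: 'b"
  let ?Q = "\<lambda>p k. simple_integrand s t (fst p) (fst (snd p)) (snd (snd p)) \<and>
    L2norm time_space (\<lambda>x. ?sp (fst p) (fst (snd p)) (snd (snd p)) x - zero_ext s t \<phi> x) \<le> (1/2)^k"
  have "\<exists>p. ?Q p k" for k :: nat
  proof -
    obtain n \<tau> \<xi> where "simple_integrand s t n \<tau> \<xi>"
      "L2norm time_space (\<lambda>x. ?sp n \<tau> \<xi> x - zero_ext s t \<phi> x) \<le> (1/2)^k"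
      using simple_approximation[OF \<phi> st, of "(1/2)^k"] by auto
    then show ?thesis by (intro exI[of _ "(n, \<tau>, \<xi>)"]) simp
  qed
  then have "\<forall>k::nat. \<exists>p. ?Q p k" by (rule allI)
  from choice[OF this] obtain p where p: "\<forall>k::nat. ?Q (p k) k" by (rule exE)
  define n \<tau> \<xi> where "n k = fst (p k)" and "\<tau> k = fst (snd (p k))" and "\<xi> k = snd (snd (p k))" for k
  have si: "simple_integrand s t (n k) (\<tau> k) (\<xi> k)"
    and close: "L2norm time_space (\<lambda>x. ?sp (n k) (\<tau> k) (\<xi> k) x - zero_ext s t \<phi> x) \<le> (1/2)^k" for k
    using p by (simp_all add: n_def \<tau>_def \<xi>_def)
  have sq: "square_integrable time_space (zero_ext s t \<phi>)" using \<phi> unfolding L2_F_iff[OF st(1,3)] by blast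
  note sqp = square_integrable_simple_process[OF si st(1,3)] and sqi = square_integrable_simple_ito[OF si st(1,3)]
  let ?I = "\<lambda>k. simple_ito (n k) (\<tau> k) (\<xi> k)"
  have fast: "L2norm P (\<lambda>\<omega>. ?I (Suc k) \<omega> - ?I k \<omega>) \<le> 2 * (1/2)^k" for k
  proof -
    have "L2norm P (\<lambda>\<omega>. ?I (Suc k) \<omega> - ?I k \<omega>) \<le>
        L2norm time_space (\<lambda>x. ?sp (n (Suc k)) (\<tau> (Suc k)) (\<xi> (Suc k)) x - zero_ext s t \<phi> x)
        + L2norm time_space (\<lambda>x. zero_ext s t \<phi> x - ?sp (n k) (\<tau> k) (\<xi> k) x)"
      unfolding L2norm_simple_ito_diff[OF si st(1,3) si st(1,3)] by (rule L2norm_triangle_diff[OF sqp sq sqp])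
    also have "\<dots> \<le> (1/2)^Suc k + (1/2)^k"
      using close[of "Suc k"] close[of k] L2norm_minus_commute[of time_space "zero_ext s t \<phi>"] by (intro add_mono) auto
    also have "\<dots> \<le> 2 * (1/2)^k" by simp
    finally show ?thesis .
  qed
  \<comment> \<open>The pointwise limit of \<open>F t\<close>-measurable functions, with the default
    of \<open>lim\<close> where there is none, is \<open>F t\<close>-measurable everywhere; changing
    it on a null set is avoided.\<close>
  define I where "I \<omega> = lim (\<lambda>k. ?I k \<omega>)" for \<omega>
  have IF: "I \<in> borel_measurable (F t)"
    unfolding I_def by (intro borel_measurable_lim_metric simple_ito_measurable[OF si st(1,3)])
  have IP: "I \<in> borel_measurable P" by (rule measurable_F_P[OF IF]) (use st in auto)
  have "AE \<omega> in P. convergent (\<lambda>k. ?I k \<omega>)" by (rule fast_Cauchy_AE_convergent[OF sqi fast])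
  then have lim: "AE \<omega> in P. (\<lambda>k. ?I k \<omega>) \<longlonglongrightarrow> I \<omega>"
    unfolding I_def by eventually_elim (simp add: convergent_LIMSEQ_iff)
  note L = fast_Cauchy_L2_limit[OF sqi IP fast lim]
  have pow: "(\<lambda>k. c * (1/2::real)^k) \<longlonglongrightarrow> 0" for c
    by (intro tendsto_mult_right_zero LIMSEQ_power_zero) simp
  have c1: "(\<lambda>k. L2norm time_space (\<lambda>x. ?sp (n k) (\<tau> k) (\<xi> k) x - zero_ext s t \<phi> x)) \<longlonglongrightarrow> 0"
    by (rule tendsto_sandwich[OF _ _ tendsto_const pow[of 1]]) (use close in auto)
  have c2: "(\<lambda>k. L2norm P (\<lambda>\<omega>. ?I k \<omega> - I \<omega>)) \<longlonglongrightarrow> 0"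
    by (rule tendsto_sandwich[OF _ _ tendsto_const pow[of 4]])
      (use L(2) L2norm_minus_commute[of P I] in auto)
  have eq: "(\<integral>\<^sup>+ (r, \<omega>). ennreal ((norm (simple_process (n k) (\<tau> k) (\<xi> k) r \<omega> - \<phi> r \<omega>))\<^sup>2) \<partial>dt_dP s t) =
      (\<integral>\<^sup>+ x. ennreal ((norm (?sp (n k) (\<tau> k) (\<xi> k) x - zero_ext s t \<phi> x))\<^sup>2) \<partial>time_space)" for k
    unfolding nn_integral_dt_dP
    by (intro nn_integral_cong) (auto simp: indicator_def simple_process_outside[OF si st(1,3)])
  have "has_ito_integral s t \<phi> I"
    unfolding has_ito_integral_def
  proof (intro conjI exI allI)
    show "L2_F s t \<phi>" by fact
    show "L2_rv t I" using IF L(1) by (simp add: L2_rv_def strongly_measurable_iff_borel square_integrable_def)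
    show "simple_integrand s t (n k) (\<tau> k) (\<xi> k)" for k by (rule si)
    show "(\<lambda>k. \<integral>\<^sup>+ (r, \<omega>). ennreal ((norm (simple_process (n k) (\<tau> k) (\<xi> k) r \<omega> - \<phi> r \<omega>))\<^sup>2) \<partial>dt_dP s t) \<longlonglongrightarrow> 0"
      unfolding eq using c1 by (subst tendsto_L2norm_iff_nn_integral[symmetric]) (intro square_integrable_diff sqp sq)
    show "(\<lambda>k. \<integral>\<^sup>+ \<omega>. ennreal ((norm (?I k \<omega> - I \<omega>))\<^sup>2) \<partial>P) \<longlonglongrightarrow> 0"
      using c2 by (subst tendsto_L2norm_iff_nn_integral[symmetric]) (intro square_integrable_diff sqi L(1))
  qed
  then show ?thesis by blast
qed

end

section \<open>Mild solutions\<close>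

text \<open>Strong continuity bounds every orbit on a compact time interval; uniform boundedness
  turns this into one bound on the operator norms.\<close>

lemma C0_semigroup_bounded:
  assumes S: "C0_semigroup S"
  obtains K where "0 \<le> K" "\<And>r. r \<in> {0..b} \<Longrightarrow> norm (S r) \<le> K"
proof -
  have "\<exists>c. \<forall>r\<in>{0..b}. norm (S r x) \<le> c" for x
  proof -
    have "continuous_on {0..b} (\<lambda>t. S t x)"
      using S unfolding C0_semigroup_def by (auto intro: continuous_on_subset)
    then have "bounded ((\<lambda>t. S t x) ` {0..b})"
      by (rule compact_imp_bounded[OF compact_continuous_image]) simp
    then show ?thesis by (auto simp: bounded_iff)
  qed
  from uniform_boundedness[OF this] obtain c where "\<forall>r\<in>{0..b}. norm (S r) \<le> c" by blast
  then show ?thesis by (intro that[of "\<bar>c\<bar>"]) force+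
qed

text \<open>Negative times are clamped to 0, so the map is continuous on the whole product and hence
  Borel. Joint continuity needs the local bound on the operator norms in addition to continuity of
  each orbit.\<close>

lemma C0_semigroup_jointly_continuous:
  assumes S: "C0_semigroup S"
  shows "continuous_on UNIV (\<lambda>(s, x). S (max 0 s) x)"
  unfolding continuous_on_sequentially
proof (intro allI ballI impI)
  fix z :: "nat \<Rightarrow> real \<times> 'a" and a assume z: "(\<forall>n. z n \<in> UNIV) \<and> z \<longlonglongrightarrow> a"
  define s x where "s n = max 0 (fst (z n))" and "x n = snd (z n)" for n
  define s' x' where "s' = max 0 (fst a)" and "x' = snd a"
  have s: "s \<longlonglongrightarrow> s'" and x: "x \<longlonglongrightarrow> x'"
    unfolding s_def x_def s'_def x'_def using z by (auto intro!: tendsto_intros)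
  have s0: "0 \<le> s n" "0 \<le> s'" for n by (simp_all add: s_def s'_def)
  obtain b where b: "\<And>n. norm (s n) \<le> b"
    using convergent_imp_Bseq[of s] s by (auto simp: convergent_def Bseq_def)
  obtain K where K: "0 \<le> K" "\<And>r. r \<in> {0..b} \<Longrightarrow> norm (S r) \<le> K" using C0_semigroup_bounded[OF S] by blast
  have "s n \<in> {0..b}" for n using s0 b[of n] by simp
  note Kn = K(2)[OF this]
  have "(\<lambda>n. S (s n) (x n - x')) \<longlonglongrightarrow> 0"
  proof (rule Lim_null_comparison)
    have "norm (S (s n) (x n - x')) \<le> K * norm (x n - x')" for n
      by (rule order_trans[OF norm_blinfun mult_right_mono[OF Kn]]) simp
    then show "\<forall>\<^sub>F n in sequentially. norm (S (s n) (x n - x')) \<le> K * norm (x n - x')" by simp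
    have "(\<lambda>n. x n - x') \<longlonglongrightarrow> 0" using x by (simp add: LIM_zero)
    then show "(\<lambda>n. K * norm (x n - x')) \<longlonglongrightarrow> 0"
      by (intro tendsto_mult_right_zero tendsto_norm_zero)
  qed
  moreover have "(\<lambda>n. S (s n) x') \<longlonglongrightarrow> S s' x'"
    using S unfolding C0_semigroup_def
    by (intro continuous_on_tendsto_compose[OF _ s, of "{0..}" "\<lambda>t. S t x'"]) (auto simp: s0)
  ultimately have "(\<lambda>n. S (s n) (x n - x') + S (s n) x') \<longlonglongrightarrow> 0 + S s' x'" by (rule tendsto_add)
  then have "(\<lambda>n. S (s n) (x n)) \<longlonglongrightarrow> S s' x'" by (simp add: blinfun.diff_right)
  then show "((\<lambda>(s, x). S (max 0 s) x) \<circ> z) \<longlonglongrightarrow> (case a of (s, x) \<Rightarrow> S (max 0 s) x)"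
    by (simp add: comp_def s_def x_def s'_def x'_def case_prod_unfold)
qed

context usual_filtration
begin

text \<open>Cauchy-Schwarz in time against the indicator of \<open>{0..T}\<close>, path by path; the
  norm of that indicator is the factor \<open>sqrt T\<close>.\<close>

lemma time_integral_L2:
  fixes f :: "real \<times> 'w \<Rightarrow> 'b::{banach, second_countable_topology}"
  assumes f: "square_integrable time_space f" and out: "\<And>r \<omega>. r \<notin> {0..T} \<Longrightarrow> f (r, \<omega>) = 0"
  shows "AE \<omega> in P. integrable lborel (\<lambda>r. f (r, \<omega>))"
    "square_integrable P (\<lambda>\<omega>. \<integral>r. f (r, \<omega>) \<partial>lborel)"
    "L2norm P (\<lambda>\<omega>. \<integral>r. f (r, \<omega>) \<partial>lborel) \<le> sqrt T * L2norm time_space f"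
proof -
  have fm[measurable]: "f \<in> borel_measurable time_space" using f by (simp add: square_integrable_def)
  define V where "V \<omega> = (\<integral>r. f (r, \<omega>) \<partial>lborel)" for \<omega>
  have Vm[measurable]: "V \<in> borel_measurable P"
    unfolding V_def by (rule lborel.borel_measurable_lebesgue_integral) measurable
  have n2: "integrable time_space (\<lambda>(r, \<omega>). (norm (f (r, \<omega>)))\<^sup>2)"
    using f by (simp add: square_integrable_def case_prod_unfold)
  note sn = time_space.AE_integrable_snd[OF n2] time_space.integrable_snd[OF n2] time_space.integral_snd[OF n2]
  have one: "square_integrable lborel (indicator {0..T} :: real \<Rightarrow> real)"
    unfolding square_integrable_def by (auto simp: indicator_def[abs_def] power2_eq_square emeasure_lborel_Icc_eq
        intro!: Bochner_Integration.integrable_cong[THEN iffD1, OF refl _ integrable_real_indicator[of "{0..T}"]])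
  have L1: "L2norm lborel (indicator {0..T} :: real \<Rightarrow> real) = sqrt T"
  proof -
    have "(\<integral>r. (norm (indicator {0..T} r :: real))\<^sup>2 \<partial>lborel) = (\<integral>r. indicator {0..T} r \<partial>lborel)"
      by (intro Bochner_Integration.integral_cong) (auto simp: indicator_def)
    then show ?thesis using T_pos by (simp add: L2norm_def)
  qed
  have fib: "AE \<omega> in P. integrable lborel (\<lambda>r. f (r, \<omega>)) \<and> (norm (V \<omega>))\<^sup>2 \<le> T * (\<integral>r. (norm (f (r, \<omega>)))\<^sup>2 \<partial>lborel)"
    using sn(1) AE_space
  proof eventually_elim
    case (elim \<omega>)
    have "(\<lambda>r. f (r, \<omega>)) \<in> borel_measurable lborel" using elim(2) by measurable
    then have sq: "square_integrable lborel (\<lambda>r. f (r, \<omega>))" using elim(1) by (simp add: square_integrable_def)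
    have eq: "norm (indicator {0..T} r :: real) * norm (f (r, \<omega>)) = norm (f (r, \<omega>))" for r
      using out[of r \<omega>] by (auto simp: indicator_def)
    have i: "integrable lborel (\<lambda>r. norm (f (r, \<omega>)))"
      using square_integrable_norm_mult[OF one sq] unfolding eq .
    then have int: "integrable lborel (\<lambda>r. f (r, \<omega>))"
      using sq by (simp add: integrable_norm_iff square_integrable_def)
    have "norm (V \<omega>) \<le> (\<integral>r. norm (f (r, \<omega>)) \<partial>lborel)" unfolding V_def by (rule integral_norm_bound)
    also have "\<dots> \<le> sqrt T * L2norm lborel (\<lambda>r. f (r, \<omega>))"
      using Cauchy_Schwarz_integral[OF one sq] unfolding eq L1 .
    finally have "(norm (V \<omega>))\<^sup>2 \<le> (sqrt T * L2norm lborel (\<lambda>r. f (r, \<omega>)))\<^sup>2" by (intro power_mono) auto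
    then show ?case using int T_pos by (simp add: power_mult_distrib L2norm_squared)
  qed
  then show "AE \<omega> in P. integrable lborel (\<lambda>r. f (r, \<omega>))" by eventually_elim simp
  have iT: "integrable P (\<lambda>\<omega>. T * (\<integral>r. (norm (f (r, \<omega>)))\<^sup>2 \<partial>lborel))" using sn(2) by simp
  have iV: "integrable P (\<lambda>\<omega>. (norm (V \<omega>))\<^sup>2)"
  proof (rule Bochner_Integration.integrable_bound[OF iT])
    show "AE \<omega> in P. norm ((norm (V \<omega>))\<^sup>2) \<le> norm (T * (\<integral>r. (norm (f (r, \<omega>)))\<^sup>2 \<partial>lborel))"
      using fib by eventually_elim (auto intro: order_trans[OF _ abs_ge_self])
  qed measurable
  then show "square_integrable P (\<lambda>\<omega>. \<integral>r. f (r, \<omega>) \<partial>lborel)"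
    using Vm unfolding square_integrable_def V_def by simp
  have "(L2norm P V)\<^sup>2 \<le> expectation (\<lambda>\<omega>. T * (\<integral>r. (norm (f (r, \<omega>)))\<^sup>2 \<partial>lborel))"
    unfolding L2norm_squared
    by (rule integral_mono_AE[OF iV iT]) (use fib in eventually_elim, simp)
  also have "\<dots> = T * (L2norm time_space f)\<^sup>2"
    unfolding L2norm_squared using sn(3) by (simp add: case_prod_unfold)
  also have "\<dots> = (sqrt T * L2norm time_space f)\<^sup>2" using T_pos by (simp add: power_mult_distrib)
  finally show "L2norm P (\<lambda>\<omega>. \<integral>r. f (r, \<omega>) \<partial>lborel) \<le> sqrt T * L2norm time_space f"
    unfolding V_def[symmetric] by (rule power2_le_imp_le) (use T_pos in simp)
qed

lemma L2norm_zero_ext_squared: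
  fixes \<phi> :: "real \<Rightarrow> 'w \<Rightarrow> 'b::{real_normed_vector, second_countable_topology}"
  assumes "square_integrable time_space (zero_ext s t \<phi>)"
  shows "(L2norm time_space (zero_ext s t \<phi>))\<^sup>2 = (LINT r:{s..t}|lborel. (L2norm P (\<phi> r))\<^sup>2)"
proof -
  have "integrable (dt_dP s t) (\<lambda>(r, \<omega>). (norm (\<phi> r \<omega>))\<^sup>2)"
    using assms unfolding integrable_norm_squared_dt_dP_iff square_integrable_def by blast
  from integral_dt_dP_iterated(2)[OF this] show ?thesis
    unfolding L2norm_dt_dP[symmetric] by (simp add: L2norm_squared case_prod_unfold)
qed

end

section \<open>Convolutions with the semigroup and mild solutions\<close>

context brownian_motion
begin

context
  fixes S :: "real \<Rightarrow> 'h::{real_inner, banach, second_countable_topology} \<Rightarrow>\<^sub>L 'h"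
  assumes S: "C0_semigroup S"
begin

lemma zero_ext_semigroup:
  "zero_ext 0 t (\<lambda>r \<omega>. S (t - r) (\<psi> r \<omega>)) = (\<lambda>x. S (max 0 (t - fst x)) (zero_ext 0 t \<psi> x))"
  by (auto simp: zero_ext_def fun_eq_iff indicator_def max_def)

lemma semigroup_compose_measurable:
  assumes "f \<in> borel_measurable N" "g \<in> borel_measurable N"
  shows "(\<lambda>x. S (max 0 (g x)) (f x)) \<in> borel_measurable N"
proof -
  have "(\<lambda>(s, x). S (max 0 s) x) \<in> borel_measurable (borel \<Otimes>\<^sub>M borel)"
    unfolding borel_prod by (rule borel_measurable_continuous_onI[OF C0_semigroup_jointly_continuous[OF S]])
  from measurable_compose[OF measurable_Pair[OF assms(2,1)] this] show ?thesis by simp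
qed

lemma L2_F_semigroup:
  assumes \<psi>: "L2_F 0 t \<psi>" and t: "t \<in> {0..T}"
  shows "L2_F 0 t (\<lambda>r \<omega>. S (t - r) (\<psi> r \<omega>))"
proof -
  have p: "prog_measurable 0 t \<psi>" and sq: "square_integrable time_space (zero_ext 0 t \<psi>)"
    using \<psi> t unfolding L2_F_iff[of 0 t, OF order_refl] by (auto simp: L2_F_iff)
  have p': "prog_measurable 0 t (\<lambda>r \<omega>. S (t - r) (\<psi> r \<omega>))"
    unfolding prog_measurable_iff
  proof
    fix q assume q: "q \<in> {0..t}"
    have "zero_ext 0 q (\<lambda>r \<omega>. S (t - r) (\<psi> r \<omega>)) = (\<lambda>x. S (max 0 (t - fst x)) (zero_ext 0 q \<psi> x))"
      using q by (auto simp: zero_ext_def fun_eq_iff indicator_def max_def)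
    also have "\<dots> \<in> borel_measurable (borel \<Otimes>\<^sub>M F q)"
      by (intro semigroup_compose_measurable prog_measurable_zero_ext[OF p q]) measurable
    finally show "zero_ext 0 q (\<lambda>r \<omega>. S (t - r) (\<psi> r \<omega>)) \<in> borel_measurable (borel \<Otimes>\<^sub>M F q)" .
  qed
  obtain K where K: "0 \<le> K" "\<And>r. r \<in> {0..t} \<Longrightarrow> norm (S r) \<le> K" using C0_semigroup_bounded[OF S] by blast
  have "square_integrable time_space (zero_ext 0 t (\<lambda>r \<omega>. S (t - r) (\<psi> r \<omega>)))"
  proof (rule square_integrable_bound[OF sq])
    show "zero_ext 0 t (\<lambda>r \<omega>. S (t - r) (\<psi> r \<omega>)) \<in> borel_measurable time_space"
      unfolding zero_ext_semigroup using sq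
      by (intro semigroup_compose_measurable) (auto simp: square_integrable_def)
    show "AE x in time_space. norm (zero_ext 0 t (\<lambda>r \<omega>. S (t - r) (\<psi> r \<omega>)) x) \<le> K * norm (zero_ext 0 t \<psi> x)"
    proof (rule AE_I2)
      fix x :: "real \<times> 'w"
      have "norm (S (t - r) y) \<le> K * norm y" if "r \<in> {0..t}" for r y
        by (rule order_trans[OF norm_blinfun mult_right_mono[OF K(2)]]) (use that in auto)
      then show "norm (zero_ext 0 t (\<lambda>r \<omega>. S (t - r) (\<psi> r \<omega>)) x) \<le> K * norm (zero_ext 0 t \<psi> x)"
        by (cases x) (auto simp: indicator_def)
    qed
  qed
  with p' show ?thesis using t by (subst L2_F_iff) auto
qed

text \<open>The integrand of the variation-of-constants formula for time \<open>t\<close>. It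
  depends on \<open>t\<close> through the semigroup and through the interval, and the extension by
  zero makes both dependences comparable in one norm.\<close>

definition convolved :: "real \<Rightarrow> (real \<Rightarrow> 'w \<Rightarrow> 'h) \<Rightarrow> real \<times> 'w \<Rightarrow> 'h"
  where "convolved t \<psi> = zero_ext 0 t (\<lambda>r \<omega>. S (t - r) (\<psi> r \<omega>))"

lemma square_integrable_convolved:
  assumes "L2_F 0 t \<psi>" "t \<in> {0..T}"
  shows "square_integrable time_space (convolved t \<psi>)"
  using L2_F_semigroup[OF assms] assms(2) unfolding convolved_def by (simp add: L2_F_iff)

text \<open>Dominated convergence on the product space, with a multiple of the squared norm of
  \<open>\<psi>\<close> as majorant: strong continuity handles times before \<open>t\<close>, and
  times after \<open>t\<close> are eventually outside the support.\<close>

lemma convolved_tendsto: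
  assumes \<psi>: "L2_F 0 T \<psi>" and t: "t \<in> {0..T}" "\<And>n. \<tau> n \<in> {0..T}" and lim: "\<tau> \<longlonglongrightarrow> t"
  shows "(\<lambda>n. L2norm time_space (\<lambda>x. convolved (\<tau> n) \<psi> x - convolved t \<psi> x)) \<longlonglongrightarrow> 0"
proof -
  have sub: "L2_F 0 q \<psi>" if "q \<in> {0..T}" for q using L2_F_subinterval[OF \<psi>] that by simp
  have sqT: "square_integrable time_space (zero_ext 0 T \<psi>)" using \<psi> by (simp add: L2_F_iff)
  note cm = square_integrable_convolved[OF sub, THEN square_integrable_measurable]
  obtain K where K: "0 \<le> K" "\<And>r. r \<in> {0..T} \<Longrightarrow> norm (S r) \<le> K" using C0_semigroup_bounded[OF S] by blast
  have bd: "norm (convolved q \<psi> x) \<le> K * norm (zero_ext 0 T \<psi> x)" if q: "q \<in> {0..T}" for q x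
  proof -
    have "norm (S (q - r) y) \<le> K * norm y" if "r \<in> {0..q}" for r y
      by (rule order_trans[OF norm_blinfun mult_right_mono[OF K(2)]]) (use that q in auto)
    then show ?thesis using q K(1) by (cases x) (auto simp: indicator_def convolved_def)
  qed
  have "(\<lambda>n. \<integral>x. (norm (convolved (\<tau> n) \<psi> x - convolved t \<psi> x))\<^sup>2 \<partial>time_space) \<longlonglongrightarrow> (\<integral>x. 0 \<partial>time_space)"
  proof (rule integral_dominated_convergence[where w="\<lambda>x. (2 * K)\<^sup>2 * (norm (zero_ext 0 T \<psi> x))\<^sup>2"])
    show "(\<lambda>x. (norm (convolved (\<tau> n) \<psi> x - convolved t \<psi> x))\<^sup>2) \<in> borel_measurable time_space" for n
    proof -
      note [measurable] = cm[OF t(1) t(1)] cm[OF t(2) t(2)]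
      show ?thesis by measurable
    qed
    show "integrable time_space (\<lambda>x. (2 * K)\<^sup>2 * (norm (zero_ext 0 T \<psi> x))\<^sup>2)"
      using sqT by (simp add: square_integrable_def)
    show "AE x in time_space. norm ((norm (convolved (\<tau> n) \<psi> x - convolved t \<psi> x))\<^sup>2) \<le> (2 * K)\<^sup>2 * (norm (zero_ext 0 T \<psi> x))\<^sup>2" for n
    proof (rule AE_I2)
      fix x
      have "norm (convolved (\<tau> n) \<psi> x - convolved t \<psi> x) \<le> 2 * K * norm (zero_ext 0 T \<psi> x)"
        using norm_triangle_ineq4[of "convolved (\<tau> n) \<psi> x" "convolved t \<psi> x"] bd[OF t(1), of x] bd[OF t(2)[of n], of x]
        by linarith
      then have "(norm (convolved (\<tau> n) \<psi> x - convolved t \<psi> x))\<^sup>2 \<le> (2 * K * norm (zero_ext 0 T \<psi> x))\<^sup>2"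
        by (intro power_mono) auto
      then show "norm ((norm (convolved (\<tau> n) \<psi> x - convolved t \<psi> x))\<^sup>2) \<le> (2 * K)\<^sup>2 * (norm (zero_ext 0 T \<psi> x))\<^sup>2"
        by (simp add: power_mult_distrib)
    qed
    \<comment> \<open>At the instant \<open>t\<close> itself the indicators of
      \<open>{0..\<tau> n}\<close> need not converge.\<close>
    have "AE x in time_space. fst x \<noteq> t"
    proof (rule AE_I[of _ _ "{t} \<times> space P"])
      show "emeasure time_space ({t} \<times> space P) = 0" by (subst emeasure_pair_measure_Times) auto
    qed (auto simp: space_pair_measure)
    then show "AE x in time_space. (\<lambda>n. (norm (convolved (\<tau> n) \<psi> x - convolved t \<psi> x))\<^sup>2) \<longlonglongrightarrow> 0"
    proof eventually_elim
      case (elim x)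
      obtain r \<omega> where x: "x = (r, \<omega>)" by (cases x)
      have "(\<lambda>n. convolved (\<tau> n) \<psi> x) \<longlonglongrightarrow> convolved t \<psi> x"
      proof (cases "r < t")
        case True
        have ev: "\<forall>\<^sub>F n in sequentially. r < \<tau> n" by (rule order_tendstoD(1)[OF lim True])
        have "(\<lambda>n. S (max 0 (\<tau> n - r)) (indicator {0..} r *\<^sub>R \<psi> r \<omega>)) \<longlonglongrightarrow> S (max 0 (t - r)) (indicator {0..} r *\<^sub>R \<psi> r \<omega>)"
          using S unfolding C0_semigroup_def
          by (intro continuous_on_tendsto_compose[of "{0..}" "\<lambda>s. S s (indicator {0..} r *\<^sub>R \<psi> r \<omega>)"])
            (auto intro!: tendsto_intros lim)
        also have "S (max 0 (t - r)) (indicator {0..} r *\<^sub>R \<psi> r \<omega>) = convolved t \<psi> x"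
          using True by (auto simp: convolved_def x indicator_def max_def)
        finally show ?thesis
          by (rule Lim_transform_eventually) (use ev in eventually_elim, auto simp: convolved_def x indicator_def max_def)
      next
        case False
        then have "t < r" using elim x by simp
        then have "\<forall>\<^sub>F n in sequentially. \<tau> n < r" by (rule order_tendstoD(2)[OF lim])
        then have "\<forall>\<^sub>F n in sequentially. convolved (\<tau> n) \<psi> x = convolved t \<psi> x"
          by eventually_elim (use \<open>t < r\<close> in \<open>auto simp: convolved_def x\<close>)
        then show ?thesis by (rule tendsto_eventually)
      qed
      then have "(\<lambda>n. (norm (convolved (\<tau> n) \<psi> x - convolved t \<psi> x))\<^sup>2) \<longlonglongrightarrow> (norm (convolved t \<psi> x - convolved t \<psi> x))\<^sup>2"
        by (intro tendsto_power tendsto_norm tendsto_diff tendsto_const)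
      then show ?case by simp
    qed
  qed auto
  from tendsto_real_sqrt[OF this] show ?thesis by (simp add: L2norm_def)
qed

text \<open>Two times and two pairs of coefficients are kept general because both specialisations
  occur: equal coefficients at different times give mean square continuity, and different
  coefficients at one time give the Lipschitz estimate.\<close>

lemma mild_terms_difference:
  assumes \<psi>1: "L2_F 0 t \<psi>1" "t \<in> {0..T}" and \<psi>1': "L2_F 0 t' \<psi>1'" "t' \<in> {0..T}"
    and I: "has_ito_integral 0 t (\<lambda>r \<omega>. S (t - r) (\<psi>2 r \<omega>)) I"
    and I': "has_ito_integral 0 t' (\<lambda>r \<omega>. S (t' - r) (\<psi>2' r \<omega>)) I'"
  defines "X \<equiv> \<lambda>\<omega>. (LINT r:{0..t}|lborel. S (t - r) (\<psi>1 r \<omega>)) + I \<omega>"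
    and "X' \<equiv> \<lambda>\<omega>. (LINT r:{0..t'}|lborel. S (t' - r) (\<psi>1' r \<omega>)) + I' \<omega>"
  shows "square_integrable P X" "square_integrable P X'"
    "L2norm P (\<lambda>\<omega>. X \<omega> - X' \<omega>) \<le> sqrt T * L2norm time_space (\<lambda>x. convolved t \<psi>1 x - convolved t' \<psi>1' x)
      + L2norm time_space (\<lambda>x. convolved t \<psi>2 x - convolved t' \<psi>2' x)"
    "AE \<omega> in P. set_integrable lborel {0..t} (\<lambda>r. S (t - r) (\<psi>1 r \<omega>))"
proof -
  note sq = square_integrable_convolved[OF \<psi>1] and sq' = square_integrable_convolved[OF \<psi>1']
  define V V' where "V \<omega> = (\<integral>r. convolved t \<psi>1 (r, \<omega>) \<partial>lborel)" and "V' \<omega> = (\<integral>r. convolved t' \<psi>1' (r, \<omega>) \<partial>lborel)" for \<omega>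
  have X: "X = (\<lambda>\<omega>. V \<omega> + I \<omega>)" and X': "X' = (\<lambda>\<omega>. V' \<omega> + I' \<omega>)"
    by (auto simp: X_def X'_def V_def V'_def convolved_def set_lebesgue_integral_def)
  have out: "r \<notin> {0..T} \<Longrightarrow> convolved t \<psi>1 (r, \<omega>) = 0" and out': "r \<notin> {0..T} \<Longrightarrow> convolved t' \<psi>1' (r, \<omega>) = 0" for r \<omega>
    using \<psi>1(2) \<psi>1'(2) by (auto simp: convolved_def indicator_def)
  have TI: "AE \<omega> in P. integrable lborel (\<lambda>r. convolved t \<psi>1 (r, \<omega>))"
    by (rule time_integral_L2(1)[OF sq]) (rule out)
  have TI': "AE \<omega> in P. integrable lborel (\<lambda>r. convolved t' \<psi>1' (r, \<omega>))"
    by (rule time_integral_L2(1)[OF sq']) (rule out')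
  have Isq: "square_integrable P I" by (rule has_ito_integralD(2)[OF I]) (use \<psi>1(2) in auto)
  have Isq': "square_integrable P I'" by (rule has_ito_integralD(2)[OF I']) (use \<psi>1'(2) in auto)
  have V: "square_integrable P V"
    unfolding V_def by (rule time_integral_L2(2)[OF sq]) (rule out)
  have V': "square_integrable P V'"
    unfolding V'_def by (rule time_integral_L2(2)[OF sq']) (rule out')
  note Vsq = V V'
  show "square_integrable P X" "square_integrable P X'"
    unfolding X X' by (intro square_integrable_add Vsq Isq Isq')+
  show "AE \<omega> in P. set_integrable lborel {0..t} (\<lambda>r. S (t - r) (\<psi>1 r \<omega>))"
    using TI by eventually_elim (simp add: convolved_def set_integrable_def)
  have sqd: "square_integrable time_space (\<lambda>x. convolved t \<psi>1 x - convolved t' \<psi>1' x)"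
    by (rule square_integrable_diff[OF sq sq'])
  have TD: "square_integrable P (\<lambda>\<omega>. \<integral>r. convolved t \<psi>1 (r, \<omega>) - convolved t' \<psi>1' (r, \<omega>) \<partial>lborel)"
    "L2norm P (\<lambda>\<omega>. \<integral>r. convolved t \<psi>1 (r, \<omega>) - convolved t' \<psi>1' (r, \<omega>) \<partial>lborel) \<le>
      sqrt T * L2norm time_space (\<lambda>x. convolved t \<psi>1 x - convolved t' \<psi>1' x)"
    using time_integral_L2(2,3)[OF sqd] out out' by auto
  have "AE \<omega> in P. V \<omega> - V' \<omega> = (\<integral>r. convolved t \<psi>1 (r, \<omega>) - convolved t' \<psi>1' (r, \<omega>) \<partial>lborel)"
    using TI TI' by eventually_elim (simp add: V_def V'_def)
  then have "L2norm P (\<lambda>\<omega>. V \<omega> - V' \<omega>) = L2norm P (\<lambda>\<omega>. \<integral>r. convolved t \<psi>1 (r, \<omega>) - convolved t' \<psi>1' (r, \<omega>) \<partial>lborel)"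
    using Vsq TD(1) by (intro L2norm_cong_AE borel_measurable_diff) (auto simp: square_integrable_def)
  with TD(2) have 1: "L2norm P (\<lambda>\<omega>. V \<omega> - V' \<omega>) \<le> sqrt T * L2norm time_space (\<lambda>x. convolved t \<psi>1 x - convolved t' \<psi>1' x)"
    by simp
  have 2: "L2norm P (\<lambda>\<omega>. I \<omega> - I' \<omega>) = L2norm time_space (\<lambda>x. convolved t \<psi>2 x - convolved t' \<psi>2' x)"
    unfolding convolved_def by (rule ito_isometry[OF I _ _ I']) (use \<psi>1(2) \<psi>1'(2) in auto)
  have "L2norm P (\<lambda>\<omega>. X \<omega> - X' \<omega>) = L2norm P (\<lambda>\<omega>. (V \<omega> - V' \<omega>) + (I \<omega> - I' \<omega>))"
    unfolding X X' by (simp add: algebra_simps)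
  also have "\<dots> \<le> L2norm P (\<lambda>\<omega>. V \<omega> - V' \<omega>) + L2norm P (\<lambda>\<omega>. I \<omega> - I' \<omega>)"
    by (intro L2norm_triangle square_integrable_diff Vsq Isq Isq')
  finally show "L2norm P (\<lambda>\<omega>. X \<omega> - X' \<omega>) \<le> sqrt T * L2norm time_space (\<lambda>x. convolved t \<psi>1 x - convolved t' \<psi>1' x)
      + L2norm time_space (\<lambda>x. convolved t \<psi>2 x - convolved t' \<psi>2' x)"
    using 1 2 by linarith
qed

text \<open>The coefficients are given processes here, so the variation-of-constants formula itself
  defines the solution at each time. Since the Ito integrals are chosen separately for every time,
  joint measurability is not automatic and is restored by a progressive modification.\<close>

lemma mild_solution_exists:
  assumes \<psi>1: "L2_F 0 T \<psi>1" and \<psi>2: "L2_F 0 T \<psi>2"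
  shows "\<exists>\<theta>. mild_solution S 0 (\<lambda>_. 0) \<psi>1 \<psi>2 \<theta>"
proof -
  have sub1: "L2_F 0 q \<psi>1" and sub2: "L2_F 0 q \<psi>2" if "q \<in> {0..T}" for q
    using L2_F_subinterval \<psi>1 \<psi>2 that by auto
  have "\<forall>t. \<exists>I. t \<in> {0..T} \<longrightarrow> has_ito_integral 0 t (\<lambda>r \<omega>. S (t - r) (\<psi>2 r \<omega>)) I"
    using ito_integral_exists[OF L2_F_semigroup[OF sub2]] by auto
  from choice[OF this] obtain I where I: "\<And>t. t \<in> {0..T} \<Longrightarrow> has_ito_integral 0 t (\<lambda>r \<omega>. S (t - r) (\<psi>2 r \<omega>)) (I t)"
    by blast
  define X where "X t \<omega> = (LINT r:{0..t}|lborel. S (t - r) (\<psi>1 r \<omega>)) + I t \<omega>" for t \<omega>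
  note D = mild_terms_difference[OF sub1 _ sub1 _ I I, folded X_def]
  have adapted: "X t \<in> borel_measurable (F t)" if t: "t \<in> {0..T}" for t
  proof -
    have p: "prog_measurable 0 t \<psi>1" using sub1[OF t] by (simp add: L2_F_def)
    have [measurable]: "convolved t \<psi>1 \<in> borel_measurable (borel \<Otimes>\<^sub>M F t)"
      unfolding convolved_def zero_ext_semigroup
      by (intro semigroup_compose_measurable prog_measurable_zero_ext[OF p]) (use t in \<open>auto\<close>)
    have "(\<lambda>\<omega>. \<integral>r. convolved t \<psi>1 (r, \<omega>) \<partial>lborel) \<in> borel_measurable (F t)"
      by (rule lborel.borel_measurable_lebesgue_integral) measurable
    moreover have "I t \<in> borel_measurable (F t)" by (rule has_ito_integralD(3)[OF I[OF t]]) (use t in auto)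
    ultimately have "(\<lambda>\<omega>. (\<integral>r. convolved t \<psi>1 (r, \<omega>) \<partial>lborel) + I t \<omega>) \<in> borel_measurable (F t)" by measurable
    then show ?thesis by (simp add: X_def[abs_def] convolved_def set_lebesgue_integral_def)
  qed
  have cont: "((\<lambda>q. L2norm P (\<lambda>\<omega>. X q \<omega> - X t \<omega>)) \<longlongrightarrow> 0) (at t within {0..T})" if t: "t \<in> {0..T}" for t
    unfolding tendsto_at_iff_sequentially comp_def
  proof (intro allI impI)
    fix \<tau> :: "nat \<Rightarrow> real" assume "\<forall>n. \<tau> n \<in> {0..T} - {t}" and lim: "\<tau> \<longlonglongrightarrow> t"
    then have \<tau>: "\<tau> n \<in> {0..T}" for n by auto
    let ?b = "\<lambda>n. sqrt T * L2norm time_space (\<lambda>x. convolved (\<tau> n) \<psi>1 x - convolved t \<psi>1 x)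
      + L2norm time_space (\<lambda>x. convolved (\<tau> n) \<psi>2 x - convolved t \<psi>2 x)"
    have "?b \<longlonglongrightarrow> sqrt T * 0 + 0"
      by (intro tendsto_intros convolved_tendsto \<psi>1 \<psi>2 t \<tau> lim)
    then have b: "?b \<longlonglongrightarrow> 0" by simp
    show "(\<lambda>n. L2norm P (\<lambda>\<omega>. X (\<tau> n) \<omega> - X t \<omega>)) \<longlonglongrightarrow> 0"
      by (rule tendsto_sandwich[OF _ _ tendsto_const b])
        (use D(3)[OF \<tau> \<tau> t t \<tau> t] in auto)
  qed
  have sq: "square_integrable P (X t)" if t: "t \<in> {0..T}" for t by (rule D(1)[OF t t t t t t])
  obtain \<theta> where \<theta>: "C_F 0 T \<theta>" "\<And>r. r \<in> {0..T} \<Longrightarrow> AE \<omega> in P. \<theta> r \<omega> = X r \<omega>"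
    using progressive_modification[OF adapted sq cont] by blast
  have "mild_solution S 0 (\<lambda>_. 0) \<psi>1 \<psi>2 \<theta>"
    unfolding mild_solution_def
  proof (intro conjI ballI)
    fix t assume t: "t \<in> {0..T}"
    show "\<exists>I. has_ito_integral 0 t (\<lambda>r \<omega>. S (t - r) (\<psi>2 r \<omega>)) I \<and>
      (AE \<omega> in P. set_integrable lborel {0..t} (\<lambda>r. S (t - r) (\<psi>1 r \<omega>)) \<and>
        \<theta> t \<omega> = S (t - 0) 0 + (LINT r:{0..t}|lborel. S (t - r) (\<psi>1 r \<omega>)) + I \<omega>)"
    proof (intro exI conjI)
      show "has_ito_integral 0 t (\<lambda>r \<omega>. S (t - r) (\<psi>2 r \<omega>)) (I t)" by (rule I[OF t])
      show "AE \<omega> in P. set_integrable lborel {0..t} (\<lambda>r. S (t - r) (\<psi>1 r \<omega>)) \<and>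
        \<theta> t \<omega> = S (t - 0) 0 + (LINT r:{0..t}|lborel. S (t - r) (\<psi>1 r \<omega>)) + I t \<omega>"
        using D(4)[OF t t t t t t] \<theta>(2)[OF t] by eventually_elim (simp add: X_def)
    qed
  qed (rule \<theta>(1))
  then show ?thesis by blast
qed

text \<open>The common initial value cancels, leaving the difference of the two integral terms. The
  bound is over \<open>{0..t}\<close> only, which is what later allows iteration in time.\<close>

lemma mild_solution_estimate:
  obtains K where "0 \<le> K"
    "\<And>\<zeta> \<psi>1 \<psi>2 \<psi>1' \<psi>2' \<theta> \<theta>' t. L2_F 0 T \<psi>1 \<Longrightarrow> L2_F 0 T \<psi>2 \<Longrightarrow> L2_F 0 T \<psi>1' \<Longrightarrow> L2_F 0 T \<psi>2' \<Longrightarrow>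
      mild_solution S 0 \<zeta> \<psi>1 \<psi>2 \<theta> \<Longrightarrow> mild_solution S 0 \<zeta> \<psi>1' \<psi>2' \<theta>' \<Longrightarrow> t \<in> {0..T} \<Longrightarrow>
      L2norm P (\<lambda>\<omega>. \<theta> t \<omega> - \<theta>' t \<omega>) \<le> K * (L2norm time_space (zero_ext 0 t (\<lambda>r \<omega>. \<psi>1 r \<omega> - \<psi>1' r \<omega>))
        + L2norm time_space (zero_ext 0 t (\<lambda>r \<omega>. \<psi>2 r \<omega> - \<psi>2' r \<omega>)))"
proof -
  obtain K where K: "0 \<le> K" "\<And>r. r \<in> {0..T} \<Longrightarrow> norm (S r) \<le> K" using C0_semigroup_bounded[OF S] by blast
  have le: "L2norm time_space (\<lambda>x. convolved t \<psi> x - convolved t \<psi>' x) \<le>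
      K * L2norm time_space (zero_ext 0 t (\<lambda>r \<omega>. \<psi> r \<omega> - \<psi>' r \<omega>))"
    if \<psi>: "L2_F 0 T \<psi>" "L2_F 0 T \<psi>'" and t: "t \<in> {0..T}" for \<psi> \<psi>' t
  proof -
    have s: "L2_F 0 t \<psi>" "L2_F 0 t \<psi>'" using L2_F_subinterval \<psi> t by auto
    have sq: "square_integrable time_space (zero_ext 0 t (\<lambda>r \<omega>. \<psi> r \<omega> - \<psi>' r \<omega>))"
      using L2_F_diff[OF s] t by (simp add: L2_F_iff)
    have sqc: "square_integrable time_space (\<lambda>x. convolved t \<psi> x - convolved t \<psi>' x)"
      by (intro square_integrable_diff square_integrable_convolved s t)
    have "(L2norm time_space (\<lambda>x. convolved t \<psi> x - convolved t \<psi>' x))\<^sup>2 \<le>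
        (\<integral>x. K\<^sup>2 * (norm (zero_ext 0 t (\<lambda>r \<omega>. \<psi> r \<omega> - \<psi>' r \<omega>) x))\<^sup>2 \<partial>time_space)"
      unfolding L2norm_squared
    proof (rule integral_mono)
      show "integrable time_space (\<lambda>x. (norm (convolved t \<psi> x - convolved t \<psi>' x))\<^sup>2)"
        using sqc by (simp add: square_integrable_def)
      show "integrable time_space (\<lambda>x. K\<^sup>2 * (norm (zero_ext 0 t (\<lambda>r \<omega>. \<psi> r \<omega> - \<psi>' r \<omega>) x))\<^sup>2)"
        using sq by (simp add: square_integrable_def)
      fix x :: "real \<times> 'w"
      have "norm (S (t - r) y) \<le> K * norm y" if "r \<in> {0..t}" for r y
        by (rule order_trans[OF norm_blinfun mult_right_mono[OF K(2)]]) (use that t in auto)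
      then have "norm (convolved t \<psi> x - convolved t \<psi>' x) \<le> K * norm (zero_ext 0 t (\<lambda>r \<omega>. \<psi> r \<omega> - \<psi>' r \<omega>) x)"
        by (cases x) (auto simp: indicator_def convolved_def blinfun.diff_right[symmetric])
      then have "(norm (convolved t \<psi> x - convolved t \<psi>' x))\<^sup>2 \<le> (K * norm (zero_ext 0 t (\<lambda>r \<omega>. \<psi> r \<omega> - \<psi>' r \<omega>) x))\<^sup>2"
        by (intro power_mono) auto
      then show "(norm (convolved t \<psi> x - convolved t \<psi>' x))\<^sup>2 \<le> K\<^sup>2 * (norm (zero_ext 0 t (\<lambda>r \<omega>. \<psi> r \<omega> - \<psi>' r \<omega>) x))\<^sup>2"
        by (simp add: power_mult_distrib)
    qed
    also have "\<dots> = (K * L2norm time_space (zero_ext 0 t (\<lambda>r \<omega>. \<psi> r \<omega> - \<psi>' r \<omega>)))\<^sup>2"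
      by (simp add: power_mult_distrib L2norm_squared)
    finally show ?thesis by (rule power2_le_imp_le) (use K in simp)
  qed
  show ?thesis
  \<comment> \<open>\<open>K\<close> bounds the semigroup, \<open>sqrt T\<close> comes from the time
    integral and 1 from the Ito isometry.\<close>
  proof (rule that[of "K * (sqrt T + 1)"])
    show "0 \<le> K * (sqrt T + 1)" using K T_pos by simp
    fix \<zeta> :: "'w \<Rightarrow> 'h" and \<psi>1 \<psi>2 \<psi>1' \<psi>2' \<theta> \<theta>' :: "real \<Rightarrow> 'w \<Rightarrow> 'h" and t
    assume \<psi>: "L2_F 0 T \<psi>1" "L2_F 0 T \<psi>2" "L2_F 0 T \<psi>1'" "L2_F 0 T \<psi>2'"
      and m: "mild_solution S 0 \<zeta> \<psi>1 \<psi>2 \<theta>" and m': "mild_solution S 0 \<zeta> \<psi>1' \<psi>2' \<theta>'" and t: "t \<in> {0..T}"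
    obtain I where I: "has_ito_integral 0 t (\<lambda>r \<omega>. S (t - r) (\<psi>2 r \<omega>)) I"
      "AE \<omega> in P. \<theta> t \<omega> = S t (\<zeta> \<omega>) + (LINT r:{0..t}|lborel. S (t - r) (\<psi>1 r \<omega>)) + I \<omega>"
      using m t unfolding mild_solution_def by fastforce
    obtain I' where I': "has_ito_integral 0 t (\<lambda>r \<omega>. S (t - r) (\<psi>2' r \<omega>)) I'"
      "AE \<omega> in P. \<theta>' t \<omega> = S t (\<zeta> \<omega>) + (LINT r:{0..t}|lborel. S (t - r) (\<psi>1' r \<omega>)) + I' \<omega>"
      using m' t unfolding mild_solution_def by fastforce
    have s: "L2_F 0 t \<psi>1" "L2_F 0 t \<psi>1'" using L2_F_subinterval \<psi> t by auto
    note D = mild_terms_difference[OF s(1) t s(2) t I(1) I'(1)]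
    have \<theta>: "square_integrable P (\<theta> t)" "square_integrable P (\<theta>' t)"
      using m m' t unfolding mild_solution_def by (auto simp: C_F_iff)
    have "L2norm P (\<lambda>\<omega>. \<theta> t \<omega> - \<theta>' t \<omega>) = L2norm P (\<lambda>\<omega>. ((LINT r:{0..t}|lborel. S (t - r) (\<psi>1 r \<omega>)) + I \<omega>)
        - ((LINT r:{0..t}|lborel. S (t - r) (\<psi>1' r \<omega>)) + I' \<omega>))"
    proof (rule L2norm_cong_AE)
      show "AE \<omega> in P. \<theta> t \<omega> - \<theta>' t \<omega> = ((LINT r:{0..t}|lborel. S (t - r) (\<psi>1 r \<omega>)) + I \<omega>)
        - ((LINT r:{0..t}|lborel. S (t - r) (\<psi>1' r \<omega>)) + I' \<omega>)"
        using I(2) I'(2) by eventually_elim simp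
      show "(\<lambda>\<omega>. \<theta> t \<omega> - \<theta>' t \<omega>) \<in> borel_measurable P"
        using \<theta> by (intro borel_measurable_diff square_integrable_measurable)
      show "(\<lambda>\<omega>. ((LINT r:{0..t}|lborel. S (t - r) (\<psi>1 r \<omega>)) + I \<omega>)
        - ((LINT r:{0..t}|lborel. S (t - r) (\<psi>1' r \<omega>)) + I' \<omega>)) \<in> borel_measurable P"
        using D(1,2) by (intro borel_measurable_diff square_integrable_measurable)
    qed
    also have "\<dots> \<le> sqrt T * (K * L2norm time_space (zero_ext 0 t (\<lambda>r \<omega>. \<psi>1 r \<omega> - \<psi>1' r \<omega>)))
        + K * L2norm time_space (zero_ext 0 t (\<lambda>r \<omega>. \<psi>2 r \<omega> - \<psi>2' r \<omega>))"
      using T_pos by (intro order_trans[OF D(3)] add_mono mult_left_mono le \<psi> t) auto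
    also have "\<dots> \<le> K * (sqrt T + 1) * (L2norm time_space (zero_ext 0 t (\<lambda>r \<omega>. \<psi>1 r \<omega> - \<psi>1' r \<omega>))
        + L2norm time_space (zero_ext 0 t (\<lambda>r \<omega>. \<psi>2 r \<omega> - \<psi>2' r \<omega>)))"
      using K(1) T_pos by (simp add: algebra_simps)
    finally show "L2norm P (\<lambda>\<omega>. \<theta> t \<omega> - \<theta>' t \<omega>) \<le> K * (sqrt T + 1) * (L2norm time_space (zero_ext 0 t (\<lambda>r \<omega>. \<psi>1 r \<omega> - \<psi>1' r \<omega>))
        + L2norm time_space (zero_ext 0 t (\<lambda>r \<omega>. \<psi>2 r \<omega> - \<psi>2' r \<omega>)))" .
  qed
qed

end

end

section \<open>The state equation\<close>

context usual_filtration
begin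

text \<open>Fubini for the squared distance turns equality at each fixed time into equality almost
  everywhere on the product, the sense in which integrands over \<open>dt_dP\<close> are
  compared.\<close>

lemma modification_AE_eq:
  fixes \<phi> \<psi> :: "real \<Rightarrow> 'w \<Rightarrow> 'b::{real_normed_vector, second_countable_topology}"
  assumes \<phi>: "L2_F s t \<phi>" and \<psi>: "L2_F s t \<psi>" and st: "0 \<le> s" "s \<le> t" "t \<le> T"
    and eq: "\<And>r. r \<in> {s..t} \<Longrightarrow> AE \<omega> in P. \<phi> r \<omega> = \<psi> r \<omega>"
  shows "AE (r, \<omega>) in dt_dP s t. \<phi> r \<omega> = \<psi> r \<omega>"
proof -
  have d: "L2_F s t (\<lambda>r \<omega>. \<phi> r \<omega> - \<psi> r \<omega>)" by (rule L2_F_diff[OF \<phi> \<psi> st])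
  then have sq: "square_integrable time_space (zero_ext s t (\<lambda>r \<omega>. \<phi> r \<omega> - \<psi> r \<omega>))"
    unfolding L2_F_iff[OF st(1,3)] by blast
  have "L2norm P (\<lambda>\<omega>. \<phi> r \<omega> - \<psi> r \<omega>) = 0" if "r \<in> {s..t}" for r
  proof -
    have "(\<integral>\<omega>. (norm (\<phi> r \<omega> - \<psi> r \<omega>))\<^sup>2 \<partial>P) = 0"
      by (rule integral_eq_zero_AE) (use eq[OF that] in eventually_elim, simp)
    then show ?thesis by (simp add: L2norm_def)
  qed
  then have "(LINT r:{s..t}|lborel. (L2norm P (\<lambda>\<omega>. \<phi> r \<omega> - \<psi> r \<omega>))\<^sup>2) = (LINT r:{s..t}|lborel. 0)"
    by (intro set_lebesgue_integral_cong) auto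
  then have "(L2norm time_space (zero_ext s t (\<lambda>r \<omega>. \<phi> r \<omega> - \<psi> r \<omega>)))\<^sup>2 = 0"
    unfolding L2norm_zero_ext_squared[OF sq] by (simp add: set_lebesgue_integral_def)
  then have "AE x in time_space. zero_ext s t (\<lambda>r \<omega>. \<phi> r \<omega> - \<psi> r \<omega>) x = 0"
    using L2norm_eq_0_iff[OF sq] by simp
  then show ?thesis
    unfolding AE_dt_dP_iff by eventually_elim (auto simp: zero_ext_def split: prod.splits)
qed

lemma L2_F_inner_integrable:
  fixes \<phi> \<psi> :: "real \<Rightarrow> 'w \<Rightarrow> 'b::real_inner"
  assumes \<phi>: "L2_F s t \<phi>" and \<psi>: "L2_F s t \<psi>" and st: "0 \<le> s" "s \<le> t" "t \<le> T"
  shows "integrable (dt_dP s t) (\<lambda>(r, \<omega>). \<phi> r \<omega> \<bullet> \<psi> r \<omega>)"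
proof (rule Bochner_Integration.integrable_bound)
  show "integrable (dt_dP s t) (\<lambda>x. (case x of (r, \<omega>) \<Rightarrow> (norm (\<phi> r \<omega>))\<^sup>2) + (case x of (r, \<omega>) \<Rightarrow> (norm (\<psi> r \<omega>))\<^sup>2))"
    using \<phi> \<psi> by (simp add: L2_F_def)
  have "prog_measurable s t (\<lambda>r \<omega>. \<phi> r \<omega> \<bullet> \<psi> r \<omega>)"
    by (rule prog_measurable_continuous2[where h="(\<bullet>)"])
      (use \<phi> \<psi> in \<open>auto intro!: continuous_intros simp: L2_F_def case_prod_unfold\<close>)
  from strongly_measurable_dt_dP[OF this st]
  show "(\<lambda>(r, \<omega>). \<phi> r \<omega> \<bullet> \<psi> r \<omega>) \<in> borel_measurable (dt_dP s t)"
    unfolding strongly_measurable_def by (rule conjunct1)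
  have "\<bar>x \<bullet> y\<bar> \<le> (norm x)\<^sup>2 + (norm y)\<^sup>2" for x y :: 'b
  proof -
    have "2 * (norm x * norm y) \<le> (norm x)\<^sup>2 + (norm y)\<^sup>2"
      using zero_le_power2[of "norm x - norm y"] unfolding power2_diff by simp
    moreover have "0 \<le> norm x * norm y" by simp
    ultimately show ?thesis using Cauchy_Schwarz_ineq2[of x y] by linarith
  qed
  then show "AE x in dt_dP s t. norm (case x of (r, \<omega>) \<Rightarrow> \<phi> r \<omega> \<bullet> \<psi> r \<omega>)
      \<le> norm ((case x of (r, \<omega>) \<Rightarrow> (norm (\<phi> r \<omega>))\<^sup>2) + (case x of (r, \<omega>) \<Rightarrow> (norm (\<psi> r \<omega>))\<^sup>2))"
    by (intro AE_I2) (auto simp: case_prod_unfold intro: order_trans[OF _ abs_ge_self])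
qed

lemma C_F_add_scaleR:
  fixes \<phi> \<psi> :: "real \<Rightarrow> 'w \<Rightarrow> 'b::{real_normed_vector, second_countable_topology}"
  assumes \<phi>: "C_F s t \<phi>" and \<psi>: "C_F s t \<psi>" and st: "0 \<le> s" "t \<le> T"
  shows "C_F s t (\<lambda>r \<omega>. \<phi> r \<omega> + c *\<^sub>R \<psi> r \<omega>)"
  unfolding C_F_iff[OF st]
proof (intro conjI ballI)
  note D = \<phi>[unfolded C_F_iff[OF st]] and E = \<psi>[unfolded C_F_iff[OF st]]
  show "prog_measurable s t (\<lambda>r \<omega>. \<phi> r \<omega> + c *\<^sub>R \<psi> r \<omega>)"
    by (rule prog_measurable_continuous2[where h="\<lambda>x y. x + c *\<^sub>R y"])
      (use D E in \<open>auto intro!: continuous_intros simp: case_prod_unfold\<close>)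
  fix r assume r: "r \<in> {s..t}"
  show "square_integrable P (\<lambda>\<omega>. \<phi> r \<omega> + c *\<^sub>R \<psi> r \<omega>)"
    using D E r by (intro square_integrable_add square_integrable_scaleR) auto
  show "((\<lambda>q. L2norm P (\<lambda>\<omega>. \<phi> q \<omega> + c *\<^sub>R \<psi> q \<omega> - (\<phi> r \<omega> + c *\<^sub>R \<psi> r \<omega>))) \<longlongrightarrow> 0) (at r within {s..t})"
  proof (rule tendsto_sandwich[OF _ _ tendsto_const])
    show "((\<lambda>q. L2norm P (\<lambda>\<omega>. \<phi> q \<omega> - \<phi> r \<omega>) + \<bar>c\<bar> * L2norm P (\<lambda>\<omega>. \<psi> q \<omega> - \<psi> r \<omega>)) \<longlongrightarrow> 0) (at r within {s..t})"
    proof -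
      have "((\<lambda>q. L2norm P (\<lambda>\<omega>. \<phi> q \<omega> - \<phi> r \<omega>)) \<longlongrightarrow> 0) (at r within {s..t})"
        "((\<lambda>q. L2norm P (\<lambda>\<omega>. \<psi> q \<omega> - \<psi> r \<omega>)) \<longlongrightarrow> 0) (at r within {s..t})" using D E r by blast+
      from tendsto_add[OF this(1) tendsto_mult_right_zero[OF this(2), of "\<bar>c\<bar>"]] show ?thesis by simp
    qed
    show "\<forall>\<^sub>F q in at r within {s..t}. L2norm P (\<lambda>\<omega>. \<phi> q \<omega> + c *\<^sub>R \<psi> q \<omega> - (\<phi> r \<omega> + c *\<^sub>R \<psi> r \<omega>))
        \<le> L2norm P (\<lambda>\<omega>. \<phi> q \<omega> - \<phi> r \<omega>) + \<bar>c\<bar> * L2norm P (\<lambda>\<omega>. \<psi> q \<omega> - \<psi> r \<omega>)"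
      unfolding eventually_at_filter
    proof (intro always_eventually allI impI)
      fix q assume q: "q \<in> {s..t}"
      have sq: "square_integrable P (\<lambda>\<omega>. \<phi> q \<omega> - \<phi> r \<omega>)" "square_integrable P (\<lambda>\<omega>. \<psi> q \<omega> - \<psi> r \<omega>)"
        using D E q r by (auto intro: square_integrable_diff)
      have "(\<lambda>\<omega>. \<phi> q \<omega> + c *\<^sub>R \<psi> q \<omega> - (\<phi> r \<omega> + c *\<^sub>R \<psi> r \<omega>)) = (\<lambda>\<omega>. (\<phi> q \<omega> - \<phi> r \<omega>) + c *\<^sub>R (\<psi> q \<omega> - \<psi> r \<omega>))"
        by (auto simp: algebra_simps)
      moreover have "L2norm P (\<lambda>\<omega>. c *\<^sub>R (\<psi> q \<omega> - \<psi> r \<omega>)) = \<bar>c\<bar> * L2norm P (\<lambda>\<omega>. \<psi> q \<omega> - \<psi> r \<omega>)"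
        by (simp add: L2norm_def power_mult_distrib real_sqrt_mult)
      ultimately show "L2norm P (\<lambda>\<omega>. \<phi> q \<omega> + c *\<^sub>R \<psi> q \<omega> - (\<phi> r \<omega> + c *\<^sub>R \<psi> r \<omega>))
        \<le> L2norm P (\<lambda>\<omega>. \<phi> q \<omega> - \<phi> r \<omega>) + \<bar>c\<bar> * L2norm P (\<lambda>\<omega>. \<psi> q \<omega> - \<psi> r \<omega>)"
        using L2norm_triangle[OF sq(1) square_integrable_scaleR[OF sq(2)], of c] by simp
    qed
  qed simp
qed

text \<open>A curve that is right continuous with left limits is bounded near every point, and by
  compactness on the whole interval. This is what makes \<open>Y\<close> square integrable in
  time.\<close>

lemma D_F_imp_L2_F:
  fixes \<phi> :: "real \<Rightarrow> 'w \<Rightarrow> 'b::{real_normed_vector, second_countable_topology}"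
  assumes \<phi>: "D_F s t \<phi>" and st: "0 \<le> s" "s \<le> t" "t \<le> T"
  shows "L2_F s t \<phi>"
proof -
  have p: "prog_measurable s t \<phi>" using \<phi> by (simp add: D_F_def)
  have T: "T \<in> {0..T}" using T_pos by simp
  have rv: "square_integrable P \<xi>" if "L2_rv T \<xi>" for \<xi> :: "'w \<Rightarrow> 'b"
    using that measurable_F_P[OF _ T] by (auto simp: L2_rv_def strongly_measurable_iff_borel square_integrable_def)
  have sq: "square_integrable P (\<phi> r)" if "r \<in> {s..t}" for r using \<phi> that rv by (auto simp: D_F_def)
  have near: "\<forall>\<^sub>F q in at r within A. L2norm P (\<phi> q) \<le> L2norm P \<xi> + 1"
    if \<xi>: "square_integrable P \<xi>" and A: "A \<subseteq> {s..t}"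
      and lim: "((\<lambda>q. \<integral>\<omega>. (norm (\<phi> q \<omega> - \<xi> \<omega>))\<^sup>2 \<partial>P) \<longlongrightarrow> 0) (at r within A)" for r A and \<xi> :: "'w \<Rightarrow> 'b"
  proof -
    have "((\<lambda>q. L2norm P (\<lambda>\<omega>. \<phi> q \<omega> - \<xi> \<omega>)) \<longlongrightarrow> 0) (at r within A)"
      using tendsto_real_sqrt[OF lim] by (simp add: L2norm_def)
    then have "\<forall>\<^sub>F q in at r within A. L2norm P (\<lambda>\<omega>. \<phi> q \<omega> - \<xi> \<omega>) < 1"
      by (rule order_tendstoD) simp
    moreover have "\<forall>\<^sub>F q in at r within A. q \<in> A" by (simp add: eventually_at_filter)
    ultimately show ?thesis
    proof eventually_elim
      case (elim q)
      then have "square_integrable P (\<phi> q)" using sq A by blast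
      from L2norm_triangle[OF square_integrable_diff[OF this \<xi>] \<xi>] elim show ?case by simp
    qed
  qed
  have local: "\<exists>d>0. \<exists>c. \<forall>q\<in>{s..t}. \<bar>q - r\<bar> < d \<longrightarrow> L2norm P (\<phi> q) \<le> c" if r: "r \<in> {s..t}" for r
  proof -
    have "\<exists>d>0. \<exists>c. \<forall>q\<in>{r<..t}. \<bar>q - r\<bar> < d \<longrightarrow> L2norm P (\<phi> q) \<le> c"
    proof (cases "r < t")
      case True
      then have "((\<lambda>q. \<integral>\<omega>. (norm (\<phi> q \<omega> - \<phi> r \<omega>))\<^sup>2 \<partial>P) \<longlongrightarrow> 0) (at r within {r<..t})"
        using \<phi> r by (simp add: D_F_def)
      from near[OF sq[OF r] _ this] r show ?thesis
        unfolding eventually_at by (fastforce simp: dist_real_def)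
    qed (auto intro: exI[of _ 1])
    then obtain d1 c1 where 1: "d1 > 0" "\<And>q. q \<in> {r<..t} \<Longrightarrow> \<bar>q - r\<bar> < d1 \<Longrightarrow> L2norm P (\<phi> q) \<le> c1" by blast
    have "\<exists>d>0. \<exists>c. \<forall>q\<in>{s..<r}. \<bar>q - r\<bar> < d \<longrightarrow> L2norm P (\<phi> q) \<le> c"
    proof (cases "s < r")
      case True
      then have "r \<in> {s<..t}" using r by simp
      then obtain \<xi> where "L2_rv T \<xi>" "((\<lambda>q. \<integral>\<omega>. (norm (\<phi> q \<omega> - \<xi> \<omega>))\<^sup>2 \<partial>P) \<longlongrightarrow> 0) (at r within {s..<r})"
        using \<phi> unfolding D_F_def by blast
      from near[OF rv[OF this(1)] _ this(2)] r show ?thesis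
        unfolding eventually_at by (fastforce simp: dist_real_def)
    qed (auto intro: exI[of _ 1])
    then obtain d2 c2 where 2: "d2 > 0" "\<And>q. q \<in> {s..<r} \<Longrightarrow> \<bar>q - r\<bar> < d2 \<Longrightarrow> L2norm P (\<phi> q) \<le> c2" by blast
    have "L2norm P (\<phi> q) \<le> max (L2norm P (\<phi> r)) (max c1 c2)" if q: "q \<in> {s..t}" "\<bar>q - r\<bar> < min d1 d2" for q
    proof -
      consider "q = r" | "q \<in> {r<..t}" | "q \<in> {s..<r}" using q by fastforce
      then show ?thesis
      proof cases
        case 2
        then show ?thesis using 1(2)[of q] q by (simp add: le_max_iff_disj)
      next
        case 3
        then show ?thesis using 2(2)[of q] q by (simp add: le_max_iff_disj)
      qed simp
    qed
    then show ?thesis using 1(1) 2(1) by (intro exI[of _ "min d1 d2"] conjI exI[of _ "max (L2norm P (\<phi> r)) (max c1 c2)"]) auto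
  qed
  have "\<exists>c. \<forall>r\<in>{s..t}. L2norm P (\<phi> r) \<le> c"
  proof (rule ccontr)
    assume "\<not> ?thesis"
    then have "\<forall>n::nat. \<exists>r. r \<in> {s..t} \<and> real n < L2norm P (\<phi> r)" by (meson not_le)
    from choice[OF this] obtain \<rho> where \<rho>: "\<And>n::nat. \<rho> n \<in> {s..t}" "\<And>n. real n < L2norm P (\<phi> (\<rho> n))" by blast
    obtain l \<sigma> where l: "l \<in> {s..t}" "strict_mono (\<sigma> :: nat \<Rightarrow> nat)" "(\<rho> \<circ> \<sigma>) \<longlonglongrightarrow> l"
      using compact_Icc[of s t, unfolded compact_def] \<rho>(1) by blast
    obtain d c where d: "d > 0" "\<And>q. q \<in> {s..t} \<Longrightarrow> \<bar>q - l\<bar> < d \<Longrightarrow> L2norm P (\<phi> q) \<le> c" using local[OF l(1)] by blast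
    obtain N where N: "\<And>n. n \<ge> N \<Longrightarrow> \<bar>\<rho> (\<sigma> n) - l\<bar> < d"
      using l(3) d(1) unfolding lim_sequentially by (auto simp: dist_real_def)
    obtain K where "c \<le> real K" using real_arch_simple by blast
    \<comment> \<open>A strictly increasing index map satisfies \<open>n <= \<sigma> n\<close>. At
      \<open>max N K\<close> the point is close enough to \<open>l\<close> for the bound
      \<open>c\<close>, while its norm exceeds an index that is at least \<open>c\<close>.\<close>
    then have "c \<le> real (\<sigma> (max N K))"
      using seq_suble[OF l(2), of "max N K"] by (meson le_trans max.cobounded2 of_nat_le_iff order_trans)
    then show False
      using \<rho>(2)[of "\<sigma> (max N K)"] d(2)[OF \<rho>(1) N, of "max N K"] by simp
  qed
  then obtain c where "\<And>r. r \<in> {s..t} \<Longrightarrow> L2norm P (\<phi> r) \<le> c" by blast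
  then show ?thesis using L2_F_of_bounded_L2norm[OF p sq _ st] by blast
qed

end

section \<open>Uniqueness, existence and linearity of states\<close>

context slq
begin

lemma semigroup_S: "C0_semigroup S"
  using generator by (simp add: generates_C0_semigroup_def)

lemma T0: "0 \<le> (0::real)" "0 \<le> T" "T \<le> T"
  using T_pos by auto

abbreviation drift :: "(real \<Rightarrow> 'w \<Rightarrow> 'h) \<Rightarrow> (real \<Rightarrow> 'w \<Rightarrow> 'u) \<Rightarrow> real \<Rightarrow> 'w \<Rightarrow> 'h"
  where "drift X u \<equiv> \<lambda>t \<omega>. A\<^sub>1 t \<omega> (X t \<omega>) + B t \<omega> (u t \<omega>)"

abbreviation diffusion :: "(real \<Rightarrow> 'w \<Rightarrow> 'h) \<Rightarrow> (real \<Rightarrow> 'w \<Rightarrow> 'u) \<Rightarrow> real \<Rightarrow> 'w \<Rightarrow> 'h"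
  where "diffusion X u \<equiv> \<lambda>t \<omega>. C t \<omega> (X t \<omega>) + D t \<omega> (u t \<omega>)"

lemmas L2_F_blinfun = L2_F_bounded_bilinear(1)[OF bounded_bilinear_blinfun_apply _ _ T0]
lemmas L2_F_adjoint = L2_F_bounded_bilinear(1)[OF bounded_bilinear_adjoint _ _ T0]

lemma L2_F_drift: "L2_F 0 T X \<Longrightarrow> L2_F 0 T u \<Longrightarrow> L2_F 0 T (drift X u)"
  by (intro L2_F_add T0 L2_F_blinfun Linf_A\<^sub>1 Linf_B)

lemma L2_F_diffusion: "L2_F 0 T X \<Longrightarrow> L2_F 0 T u \<Longrightarrow> L2_F 0 T (diffusion X u)"
  by (intro L2_F_add T0 L2_F_blinfun Linf_C Linf_D)

lemma is_state_C_F: "is_state \<eta> u X \<Longrightarrow> C_F 0 T X"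
  by (simp add: is_state_def mild_solution_def)

lemma is_state_L2_F: "is_state \<eta> u X \<Longrightarrow> L2_F 0 T X"
  by (rule C_F_imp_L2_F[OF is_state_C_F T0])

lemma L2norm_blinfun_le:
  fixes K :: "real \<Rightarrow> 'w \<Rightarrow> 'h \<Rightarrow>\<^sub>L 'h"
  assumes K: "Linf_F 0 T K"
  obtains c where "0 \<le> c" "\<And>\<phi> t. L2_F 0 T \<phi> \<Longrightarrow> t \<in> {0..T} \<Longrightarrow>
    L2norm time_space (zero_ext 0 t (\<lambda>r \<omega>. K r \<omega> (\<phi> r \<omega>))) \<le> c * L2norm time_space (zero_ext 0 t \<phi>)"
proof -
  \<comment> \<open>Any process would do: it only instantiates the premise of the lemma, whose bound
    on the operators does not mention it.\<close>
  have "L2_F 0 T (\<lambda>_ _. 0 :: 'h)" by (rule C_F_imp_L2_F[OF C_F_zero T0]) (use T0 in auto)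
  from L2_F_bounded_bilinear(2)[OF bounded_bilinear_blinfun_apply K this T0]
  obtain c where c: "0 \<le> c" "AE x in dt_dP 0 T. \<forall>y. norm (K (fst x) (snd x) y) \<le> c * norm y"
    by (auto simp: case_prod_unfold)
  show ?thesis
  proof (rule that[OF c(1)])
    fix \<phi> :: "real \<Rightarrow> 'w \<Rightarrow> 'h" and t assume \<phi>: "L2_F 0 T \<phi>" and t: "t \<in> {0..T}"
    have sq: "square_integrable time_space (zero_ext 0 t \<phi>)"
      "square_integrable time_space (zero_ext 0 t (\<lambda>r \<omega>. K r \<omega> (\<phi> r \<omega>)))"
      using L2_F_subinterval[OF \<phi>, of t] L2_F_subinterval[OF L2_F_blinfun[OF K \<phi>], of t] t by (auto simp: L2_F_iff)
    have "(L2norm time_space (zero_ext 0 t (\<lambda>r \<omega>. K r \<omega> (\<phi> r \<omega>))))\<^sup>2 \<le>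
        (\<integral>x. c\<^sup>2 * (norm (zero_ext 0 t \<phi> x))\<^sup>2 \<partial>time_space)"
      unfolding L2norm_squared
    proof (rule integral_mono_AE)
      show "integrable time_space (\<lambda>x. (norm (zero_ext 0 t (\<lambda>r \<omega>. K r \<omega> (\<phi> r \<omega>)) x))\<^sup>2)"
        "integrable time_space (\<lambda>x. c\<^sup>2 * (norm (zero_ext 0 t \<phi> x))\<^sup>2)"
        using sq by (auto simp: square_integrable_def)
      show "AE x in time_space. (norm (zero_ext 0 t (\<lambda>r \<omega>. K r \<omega> (\<phi> r \<omega>)) x))\<^sup>2 \<le> c\<^sup>2 * (norm (zero_ext 0 t \<phi> x))\<^sup>2"
        using c(2) unfolding AE_dt_dP_iff
      proof eventually_elim
        case (elim x)
        have "norm (zero_ext 0 t (\<lambda>r \<omega>. K r \<omega> (\<phi> r \<omega>)) x) \<le> c * norm (zero_ext 0 t \<phi> x)"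
          using elim t by (cases x) (auto simp: indicator_def)
        then have "(norm (zero_ext 0 t (\<lambda>r \<omega>. K r \<omega> (\<phi> r \<omega>)) x))\<^sup>2 \<le> (c * norm (zero_ext 0 t \<phi> x))\<^sup>2"
          by (intro power_mono) auto
        then show ?case by (simp add: power_mult_distrib)
      qed
    qed
    also have "\<dots> = (c * L2norm time_space (zero_ext 0 t \<phi>))\<^sup>2"
      by (simp add: power_mult_distrib L2norm_squared)
    finally show "L2norm time_space (zero_ext 0 t (\<lambda>r \<omega>. K r \<omega> (\<phi> r \<omega>))) \<le> c * L2norm time_space (zero_ext 0 t \<phi>)"
      by (rule power2_le_imp_le) (use c(1) in simp)
  qed
qed

text \<open>The control enters additively and cancels, so only \<open>A\<^sub>1\<close> and
  \<open>C\<close> act on the difference. Squaring the Lipschitz bound yields a Volterra inequality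
  in time.\<close>

lemma state_map_estimate:
  obtains \<kappa> where "0 \<le> \<kappa>"
    "\<And>\<zeta> u X X' \<theta> \<theta>' t. L2_F 0 T u \<Longrightarrow> L2_F 0 T X \<Longrightarrow> L2_F 0 T X' \<Longrightarrow>
      mild_solution S 0 \<zeta> (drift X u) (diffusion X u) \<theta> \<Longrightarrow>
      mild_solution S 0 \<zeta> (drift X' u) (diffusion X' u) \<theta>' \<Longrightarrow> t \<in> {0..T} \<Longrightarrow>
      (L2norm P (\<lambda>\<omega>. \<theta> t \<omega> - \<theta>' t \<omega>))\<^sup>2 \<le> \<kappa> * (LINT r:{0..t}|lborel. (L2norm P (\<lambda>\<omega>. X r \<omega> - X' r \<omega>))\<^sup>2)"
proof -
  obtain K where K: "0 \<le> K"
    "\<And>\<zeta> \<psi>1 \<psi>2 \<psi>1' \<psi>2' \<theta> \<theta>' t. L2_F 0 T \<psi>1 \<Longrightarrow> L2_F 0 T \<psi>2 \<Longrightarrow> L2_F 0 T \<psi>1' \<Longrightarrow> L2_F 0 T \<psi>2' \<Longrightarrow>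
      mild_solution S 0 \<zeta> \<psi>1 \<psi>2 \<theta> \<Longrightarrow> mild_solution S 0 \<zeta> \<psi>1' \<psi>2' \<theta>' \<Longrightarrow> t \<in> {0..T} \<Longrightarrow>
      L2norm P (\<lambda>\<omega>. \<theta> t \<omega> - \<theta>' t \<omega>) \<le> K * (L2norm time_space (zero_ext 0 t (\<lambda>r \<omega>. \<psi>1 r \<omega> - \<psi>1' r \<omega>))
        + L2norm time_space (zero_ext 0 t (\<lambda>r \<omega>. \<psi>2 r \<omega> - \<psi>2' r \<omega>)))"
    using mild_solution_estimate[OF semigroup_S] by blast
  obtain a where a: "0 \<le> a" "\<And>\<phi> t. L2_F 0 T \<phi> \<Longrightarrow> t \<in> {0..T} \<Longrightarrow>
    L2norm time_space (zero_ext 0 t (\<lambda>r \<omega>. A\<^sub>1 r \<omega> (\<phi> r \<omega>))) \<le> a * L2norm time_space (zero_ext 0 t \<phi>)"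
    using L2norm_blinfun_le[OF Linf_A\<^sub>1] by blast
  obtain c where c: "0 \<le> c" "\<And>\<phi> t. L2_F 0 T \<phi> \<Longrightarrow> t \<in> {0..T} \<Longrightarrow>
    L2norm time_space (zero_ext 0 t (\<lambda>r \<omega>. C r \<omega> (\<phi> r \<omega>))) \<le> c * L2norm time_space (zero_ext 0 t \<phi>)"
    using L2norm_blinfun_le[OF Linf_C] by blast
  show ?thesis
  proof (rule that[of "(K * (a + c))\<^sup>2"])
    fix \<zeta> :: "'w \<Rightarrow> 'h" and u :: "real \<Rightarrow> 'w \<Rightarrow> 'u" and X X' \<theta> \<theta>' :: "real \<Rightarrow> 'w \<Rightarrow> 'h" and t
    assume u: "L2_F 0 T u" and X: "L2_F 0 T X" "L2_F 0 T X'"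
      and m: "mild_solution S 0 \<zeta> (drift X u) (diffusion X u) \<theta>" "mild_solution S 0 \<zeta> (drift X' u) (diffusion X' u) \<theta>'"
      and t: "t \<in> {0..T}"
    let ?d = "\<lambda>r \<omega>. X r \<omega> - X' r \<omega>"
    have d: "L2_F 0 T ?d" by (rule L2_F_diff[OF X T0])
    have eq: "(\<lambda>r \<omega>. drift X u r \<omega> - drift X' u r \<omega>) = (\<lambda>r \<omega>. A\<^sub>1 r \<omega> (?d r \<omega>))"
      "(\<lambda>r \<omega>. diffusion X u r \<omega> - diffusion X' u r \<omega>) = (\<lambda>r \<omega>. C r \<omega> (?d r \<omega>))"
      by (simp_all add: blinfun.diff_right)
    have "L2norm P (\<lambda>\<omega>. \<theta> t \<omega> - \<theta>' t \<omega>) \<le>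
        K * (L2norm time_space (zero_ext 0 t (\<lambda>r \<omega>. A\<^sub>1 r \<omega> (?d r \<omega>))) + L2norm time_space (zero_ext 0 t (\<lambda>r \<omega>. C r \<omega> (?d r \<omega>))))"
      using K(2)[OF L2_F_drift[OF X(1) u] L2_F_diffusion[OF X(1) u] L2_F_drift[OF X(2) u] L2_F_diffusion[OF X(2) u] m t]
      unfolding eq .
    also have "\<dots> \<le> K * (a * L2norm time_space (zero_ext 0 t ?d) + c * L2norm time_space (zero_ext 0 t ?d))"
      by (intro mult_left_mono add_mono a(2) c(2) d t K(1))
    also have "\<dots> = K * (a + c) * L2norm time_space (zero_ext 0 t ?d)" by (simp add: algebra_simps)
    finally have "(L2norm P (\<lambda>\<omega>. \<theta> t \<omega> - \<theta>' t \<omega>))\<^sup>2 \<le> (K * (a + c) * L2norm time_space (zero_ext 0 t ?d))\<^sup>2"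
      by (intro power_mono) auto
    also have "\<dots> = (K * (a + c))\<^sup>2 * (LINT r:{0..t}|lborel. (L2norm P (?d r))\<^sup>2)"
    proof -
      have "square_integrable time_space (zero_ext 0 t ?d)"
        using L2_F_subinterval[OF d, of t] t by (auto simp: L2_F_iff)
      then show ?thesis unfolding power_mult_distrib by (simp add: L2norm_zero_ext_squared)
    qed
    finally show "(L2norm P (\<lambda>\<omega>. \<theta> t \<omega> - \<theta>' t \<omega>))\<^sup>2 \<le> (K * (a + c))\<^sup>2 * (LINT r:{0..t}|lborel. (L2norm P (?d r))\<^sup>2)" .
  qed simp
qed

text \<open>Two sequences are compared so that one lemma serves twice: constant sequences give
  uniqueness, and a sequence against its own shift gives convergence.\<close>

lemma Picard_bound:
  assumes \<kappa>: "0 \<le> \<kappa>" and \<Phi>: "\<And>k. C_F 0 T (\<Phi> k)" "\<And>k. C_F 0 T (\<Psi> k)"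
    and step: "\<And>k t. t \<in> {0..T} \<Longrightarrow> (L2norm P (\<lambda>\<omega>. \<Phi> (Suc k) t \<omega> - \<Psi> (Suc k) t \<omega>))\<^sup>2
      \<le> \<kappa> * (LINT r:{0..t}|lborel. (L2norm P (\<lambda>\<omega>. \<Phi> k r \<omega> - \<Psi> k r \<omega> :: 'h))\<^sup>2)"
  obtains c where "0 \<le> c" "\<And>k t. t \<in> {0..T} \<Longrightarrow> L2norm P (\<lambda>\<omega>. \<Phi> k t \<omega> - \<Psi> k t \<omega>) \<le> c * (1/2)^k"
proof -
  let ?e = "\<lambda>k t. (L2norm P (\<lambda>\<omega>. \<Phi> k t \<omega> - \<Psi> k t \<omega>))\<^sup>2"
  have cont: "continuous_on {0..T} (?e k)" for k
    by (intro continuous_on_power C_F_continuous_on_L2norm_diff \<Phi> T0)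
  have "bounded (?e 0 ` {0..T})"
    by (rule compact_imp_bounded[OF compact_continuous_image[OF cont]]) simp
  then obtain c where "\<forall>x\<in>?e 0 ` {0..T}. norm x \<le> c" unfolding bounded_iff by blast
  then have "norm (?e 0 t) \<le> c" if "t \<in> {0..T}" for t using that by blast
  then have c: "?e 0 t \<le> \<bar>c\<bar>" if "t \<in> {0..T}" for t
    using that unfolding real_norm_def by (meson abs_ge_self order_trans)
  \<comment> \<open>Square root of the initial bound \<open>\<bar>c\<bar>\<close> times the
    exponential from \<open>power_over_fact_le_geometric\<close>, because the iteration controls
    squared distances.\<close>
  let ?C = "sqrt (\<bar>c\<bar> * exp (4 * (\<kappa> * T)))"
  have "L2norm P (\<lambda>\<omega>. \<Phi> k t \<omega> - \<Psi> k t \<omega>) \<le> ?C * (1/2)^k" if t: "t \<in> {0..T}" for k t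
  proof (rule power2_le_imp_le)
    have "?e k t \<le> \<bar>c\<bar> * (\<kappa> * t)^k / fact k"
      by (rule iterated_Gronwall[OF \<kappa> _ cont c step t]) auto
    also have "\<dots> \<le> \<bar>c\<bar> * ((\<kappa> * T)^k / fact k)"
      using t \<kappa> by (simp add: mult_left_mono power_mono divide_right_mono)
    also have "\<dots> \<le> \<bar>c\<bar> * (exp (4 * (\<kappa> * T)) * (1/2)^(2 * k))"
      using T_pos \<kappa> by (intro mult_left_mono power_over_fact_le_geometric) auto
    also have "\<dots> = (?C * (1/2)^k)\<^sup>2" by (simp add: power_mult_distrib power_mult[symmetric] mult.commute)
    finally show "?e k t \<le> (?C * (1/2)^k)\<^sup>2" .
  qed simp
  then show ?thesis by (intro that[of ?C]) auto
qed

lemma L2norm_geometric_zero: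
  assumes "\<And>k. L2norm N f \<le> c * (1/2)^k"
  shows "L2norm N f = 0"
proof -
  have "(\<lambda>k. c * (1/2::real)^k) \<longlonglongrightarrow> 0"
    by (intro tendsto_mult_right_zero LIMSEQ_power_zero) simp
  then have "L2norm N f \<le> 0" by (rule LIMSEQ_le_const) (use assms in auto)
  then show ?thesis using L2norm_nonneg[of N f] by linarith
qed

lemma is_state_unique:
  assumes u: "admissible_control u" and X: "is_state \<eta> u X" and X': "is_state \<eta> u X'" and t: "t \<in> {0..T}"
  shows "AE \<omega> in P. X t \<omega> = X' t \<omega>"
proof -
  obtain \<kappa> where \<kappa>: "0 \<le> \<kappa>"
    "\<And>\<zeta> u X X' \<theta> \<theta>' t. L2_F 0 T u \<Longrightarrow> L2_F 0 T X \<Longrightarrow> L2_F 0 T X' \<Longrightarrow>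
      mild_solution S 0 \<zeta> (drift X u) (diffusion X u) \<theta> \<Longrightarrow>
      mild_solution S 0 \<zeta> (drift X' u) (diffusion X' u) \<theta>' \<Longrightarrow> t \<in> {0..T} \<Longrightarrow>
      (L2norm P (\<lambda>\<omega>. \<theta> t \<omega> - \<theta>' t \<omega>))\<^sup>2 \<le> \<kappa> * (LINT r:{0..t}|lborel. (L2norm P (\<lambda>\<omega>. X r \<omega> - X' r \<omega>))\<^sup>2)"
    using state_map_estimate by blast
  have u': "L2_F 0 T u" using u by (simp add: admissible_control_def)
  have step: "(L2norm P (\<lambda>\<omega>. X t \<omega> - X' t \<omega>))\<^sup>2 \<le> \<kappa> * (LINT r:{0..t}|lborel. (L2norm P (\<lambda>\<omega>. X r \<omega> - X' r \<omega>))\<^sup>2)"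
    if "t \<in> {0..T}" for t
    by (rule \<kappa>(2)[OF u' is_state_L2_F[OF X] is_state_L2_F[OF X'] X[unfolded is_state_def] X'[unfolded is_state_def] that])
  \<comment> \<open>Each state is a fixed point of its own equation, so constant sequences satisfy
    the recursion; a constant distance bounded by a vanishing geometric sequence is 0.\<close>
  obtain c where c: "\<And>k t. t \<in> {0..T} \<Longrightarrow> L2norm P (\<lambda>\<omega>. X t \<omega> - X' t \<omega>) \<le> c * (1/2)^k"
    using Picard_bound[of \<kappa> "\<lambda>_. X" "\<lambda>_. X'", OF \<kappa>(1) is_state_C_F[OF X] is_state_C_F[OF X'] step] by blast
  have "square_integrable P (\<lambda>\<omega>. X t \<omega> - X' t \<omega>)"
    using is_state_C_F[OF X] is_state_C_F[OF X'] t by (intro square_integrable_diff) (auto simp: C_F_iff)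
  from L2norm_eq_0_iff[OF this] L2norm_geometric_zero[OF c[OF t]] show ?thesis by simp
qed

text \<open>Picard iteration started at 0. Initial value 0 is the case of the variation: this state
  is added in multiples to the one that belongs to the optimal pair.\<close>

lemma is_state_zero_exists:
  assumes u: "admissible_control u"
  shows "\<exists>\<phi>. is_state 0 u \<phi>"
proof -
  obtain \<kappa> where \<kappa>: "0 \<le> \<kappa>"
    "\<And>\<zeta> u X X' \<theta> \<theta>' t. L2_F 0 T u \<Longrightarrow> L2_F 0 T X \<Longrightarrow> L2_F 0 T X' \<Longrightarrow>
      mild_solution S 0 \<zeta> (drift X u) (diffusion X u) \<theta> \<Longrightarrow>
      mild_solution S 0 \<zeta> (drift X' u) (diffusion X' u) \<theta>' \<Longrightarrow> t \<in> {0..T} \<Longrightarrow>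
      (L2norm P (\<lambda>\<omega>. \<theta> t \<omega> - \<theta>' t \<omega>))\<^sup>2 \<le> \<kappa> * (LINT r:{0..t}|lborel. (L2norm P (\<lambda>\<omega>. X r \<omega> - X' r \<omega>))\<^sup>2)"
    using state_map_estimate by blast
  have u': "L2_F 0 T u" using u by (simp add: admissible_control_def)
  define next_state where "next_state X = (SOME \<theta>. mild_solution S 0 (\<lambda>_. 0) (drift X u) (diffusion X u) \<theta>)" for X
  have nxt: "mild_solution S 0 (\<lambda>_. 0) (drift X u) (diffusion X u) (next_state X)" if "L2_F 0 T X" for X
    unfolding next_state_def
    by (rule someI_ex[OF mild_solution_exists[OF semigroup_S L2_F_drift[OF that u'] L2_F_diffusion[OF that u']]])
  define \<Phi> where "\<Phi> k = (next_state ^^ k) (\<lambda>_ _. 0)" for k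
  have C: "C_F 0 T (\<Phi> k)" for k
  proof (induction k)
    case 0
    show ?case unfolding \<Phi>_def by (simp add: C_F_zero)
  next
    case (Suc k)
    then show ?case using nxt[OF C_F_imp_L2_F[OF Suc T0]] by (simp add: \<Phi>_def mild_solution_def)
  qed
  note L = C_F_imp_L2_F[OF C T0]
  have m: "mild_solution S 0 (\<lambda>_. 0) (drift (\<Phi> k) u) (diffusion (\<Phi> k) u) (\<Phi> (Suc k))" for k
    using nxt[OF L[of k]] by (simp add: \<Phi>_def)
  have step: "(L2norm P (\<lambda>\<omega>. \<Phi> (Suc (Suc k)) t \<omega> - \<Phi> (Suc k) t \<omega>))\<^sup>2
      \<le> \<kappa> * (LINT r:{0..t}|lborel. (L2norm P (\<lambda>\<omega>. \<Phi> (Suc k) r \<omega> - \<Phi> k r \<omega>))\<^sup>2)" if "t \<in> {0..T}" for k t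
    by (rule \<kappa>(2)[OF u' L L m m that])
  obtain c where c: "0 \<le> c" "\<And>k t. t \<in> {0..T} \<Longrightarrow> L2norm P (\<lambda>\<omega>. \<Phi> (Suc k) t \<omega> - \<Phi> k t \<omega>) \<le> c * (1/2)^k"
    using Picard_bound[of \<kappa> "\<lambda>k. \<Phi> (Suc k)" \<Phi>, OF \<kappa>(1) C C step] by blast
  have sq: "square_integrable P (\<Phi> k t)" if "t \<in> {0..T}" for k t
    using C[of k] that by (simp add: C_F_iff)
  \<comment> \<open>A pointwise limit of progressive processes is progressive, again with the
    default of \<open>lim\<close> on the divergent set.\<close>
  define \<phi> where "\<phi> t \<omega> = lim (\<lambda>k. \<Phi> k t \<omega>)" for t \<omega>
  have lim: "square_integrable P (\<phi> t)" "L2norm P (\<lambda>\<omega>. \<phi> t \<omega> - \<Phi> k t \<omega>) \<le> 2 * c * (1/2)^k" if t: "t \<in> {0..T}" for k t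
  proof -
    have "AE \<omega> in P. convergent (\<lambda>k. \<Phi> k t \<omega>)" by (rule fast_Cauchy_AE_convergent[OF sq[OF t] c(2)[OF t]])
    then have ae: "AE \<omega> in P. (\<lambda>k. \<Phi> k t \<omega>) \<longlonglongrightarrow> \<phi> t \<omega>"
      unfolding \<phi>_def by eventually_elim (simp add: convergent_LIMSEQ_iff)
    have "\<phi> t \<in> borel_measurable P"
      unfolding \<phi>_def by (intro borel_measurable_lim_metric square_integrable_measurable sq t)
    note R = fast_Cauchy_L2_limit[OF sq[OF t] this c(2)[OF t] ae]
    show "square_integrable P (\<phi> t)" "L2norm P (\<lambda>\<omega>. \<phi> t \<omega> - \<Phi> k t \<omega>) \<le> 2 * c * (1/2)^k" by (rule R)+
  qed
  have prog: "prog_measurable 0 T \<phi>"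
    unfolding prog_measurable_iff
  proof
    fix r assume r: "r \<in> {0..T}"
    have "(\<lambda>x. indicator {0..r} (fst x) *\<^sub>R lim (\<lambda>k. zero_ext 0 r (\<Phi> k) x)) \<in> borel_measurable (borel \<Otimes>\<^sub>M F r)"
      using C prog_measurable_zero_ext[OF _ r]
      by (intro borel_measurable_scaleR borel_measurable_lim_metric) (auto simp: C_F_def)
    also have "(\<lambda>x. indicator {0..r} (fst x) *\<^sub>R lim (\<lambda>k. zero_ext 0 r (\<Phi> k) x)) = zero_ext 0 r \<phi>"
      by (auto simp: zero_ext_def \<phi>_def fun_eq_iff indicator_def)
    finally show "zero_ext 0 r \<phi> \<in> borel_measurable (borel \<Otimes>\<^sub>M F r)" .
  qed
  have L\<phi>: "L2_F 0 T \<phi>"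
  proof (rule L2_F_of_bounded_L2norm[OF prog lim(1) _ T0])
    show "L2norm P (\<phi> t) \<le> 2 * c" if "t \<in> {0..T}" for t using lim(2)[OF that, of 0] by (simp add: \<Phi>_def)
  qed
  \<comment> \<open>One more iteration step, applied to the limit. Showing that it returns
    \<open>\<phi>\<close> at every time almost surely is the fixed point property.\<close>
  obtain \<theta> where \<theta>: "mild_solution S 0 (\<lambda>_. 0) (drift \<phi> u) (diffusion \<phi> u) \<theta>" using nxt[OF L\<phi>] by blast
  have C\<theta>: "C_F 0 T \<theta>" using \<theta> by (simp add: mild_solution_def)
  have sq\<theta>: "square_integrable P (\<theta> t)" if "t \<in> {0..T}" for t using C\<theta> that by (simp add: C_F_iff)
  have eq: "AE \<omega> in P. \<phi> t \<omega> = \<theta> t \<omega>" if t: "t \<in> {0..T}" for t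
  proof -
    \<comment> \<open>From the Volterra bound: \<open>\<kappa>\<close> times the integral over at
      most \<open>T\<close> of the squared uniform error \<open>2 c (1/2)^k\<close>.\<close>
    let ?c = "sqrt (\<kappa> * T) * (2 * c)"
    have 1: "L2norm P (\<lambda>\<omega>. \<theta> t \<omega> - \<Phi> (Suc k) t \<omega>) \<le> ?c * (1/2)^k" for k
    proof (rule power2_le_imp_le)
      have d: "L2_F 0 t (\<lambda>r \<omega>. \<phi> r \<omega> - \<Phi> k r \<omega>)"
        using L2_F_subinterval[OF L2_F_diff[OF L\<phi> L T0], of t] t by simp
      have i: "set_integrable lborel {0..t} (\<lambda>r. (L2norm P (\<lambda>\<omega>. \<phi> r \<omega> - \<Phi> k r \<omega>))\<^sup>2)"
        using integral_dt_dP_iterated(5)[of 0 t "\<lambda>r \<omega>. (norm (\<phi> r \<omega> - \<Phi> k r \<omega>))\<^sup>2"] d by (simp add: L2norm_squared L2_F_def)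
      have "(L2norm P (\<lambda>\<omega>. \<theta> t \<omega> - \<Phi> (Suc k) t \<omega>))\<^sup>2 \<le> \<kappa> * (LINT r:{0..t}|lborel. (L2norm P (\<lambda>\<omega>. \<phi> r \<omega> - \<Phi> k r \<omega>))\<^sup>2)"
        by (rule \<kappa>(2)[OF u' L\<phi> L \<theta> m t])
      also have "\<dots> \<le> \<kappa> * (LINT r:{0..t}|lborel. (2 * c * (1/2)^k)\<^sup>2)"
      proof (intro mult_left_mono set_integral_mono i \<kappa>(1))
        show "set_integrable lborel {0..t} (\<lambda>r. (2 * c * (1/2)^k)\<^sup>2)"
          unfolding set_integrable_def by (auto simp: emeasure_lborel_Icc_eq)
        show "(L2norm P (\<lambda>\<omega>. \<phi> r \<omega> - \<Phi> k r \<omega>))\<^sup>2 \<le> (2 * c * (1/2)^k)\<^sup>2" if "r \<in> {0..t}" for r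
          using that t by (intro power_mono lim(2)) auto
      qed
      also have "\<dots> \<le> \<kappa> * (T * (2 * c * (1/2)^k)\<^sup>2)"
        unfolding set_lebesgue_integral_def using t by (intro mult_left_mono \<kappa>(1)) (auto intro: mult_right_mono)
      also have "\<dots> = (?c * (1/2)^k)\<^sup>2" using \<kappa>(1) T_pos by (simp add: power_mult_distrib)
      finally show "(L2norm P (\<lambda>\<omega>. \<theta> t \<omega> - \<Phi> (Suc k) t \<omega>))\<^sup>2 \<le> (?c * (1/2)^k)\<^sup>2" .
    qed (use c(1) \<kappa>(1) T_pos in simp)
    have "L2norm P (\<lambda>\<omega>. \<phi> t \<omega> - \<theta> t \<omega>) \<le> (2 * c + ?c) * (1/2)^k" for k
    proof -
      have "L2norm P (\<lambda>\<omega>. \<phi> t \<omega> - \<theta> t \<omega>) \<le> L2norm P (\<lambda>\<omega>. \<phi> t \<omega> - \<Phi> (Suc k) t \<omega>) + L2norm P (\<lambda>\<omega>. \<theta> t \<omega> - \<Phi> (Suc k) t \<omega>)"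
        using L2norm_triangle_diff[OF lim(1)[OF t] sq[OF t] sq\<theta>[OF t], of "Suc k"] L2norm_minus_commute[of P "\<Phi> (Suc k) t"] by simp
      also have "\<dots> \<le> 2 * c * (1/2)^Suc k + ?c * (1/2)^k" by (intro add_mono lim(2) t 1)
      also have "\<dots> \<le> 2 * c * (1/2)^k + ?c * (1/2)^k" using c(1) by simp
      finally show ?thesis by (simp add: algebra_simps)
    qed
    then have "L2norm P (\<lambda>\<omega>. \<phi> t \<omega> - \<theta> t \<omega>) = 0" by (rule L2norm_geometric_zero)
    then show ?thesis using L2norm_eq_0_iff[OF square_integrable_diff[OF lim(1)[OF t] sq\<theta>[OF t]]] by simp
  qed
  \<comment> \<open>The coefficients already contain \<open>\<phi>\<close>, so
    \<open>\<theta>\<close> has to be replaced only on the left-hand side of the equation, where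
    almost sure equality at each time suffices; the integrals stay untouched.\<close>
  have "mild_solution S 0 (\<lambda>_. 0) (drift \<phi> u) (diffusion \<phi> u) \<phi>"
    unfolding mild_solution_def
  proof (intro conjI ballI)
    show "C_F 0 T \<phi>"
      by (rule C_F_modification[OF _ _ prog eq T0(1,3)]) (use C\<theta> in \<open>auto simp: C_F_iff\<close>)
    fix t assume t: "t \<in> {0..T}"
    obtain I where I: "has_ito_integral 0 t (\<lambda>r \<omega>. S (t - r) (diffusion \<phi> u r \<omega>)) I"
      "AE \<omega> in P. set_integrable lborel {0..t} (\<lambda>r. S (t - r) (drift \<phi> u r \<omega>)) \<and>
        \<theta> t \<omega> = S (t - 0) 0 + (LINT r:{0..t}|lborel. S (t - r) (drift \<phi> u r \<omega>)) + I \<omega>"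
      using \<theta> t unfolding mild_solution_def by blast
    have "AE \<omega> in P. set_integrable lborel {0..t} (\<lambda>r. S (t - r) (drift \<phi> u r \<omega>)) \<and>
        \<phi> t \<omega> = S (t - 0) 0 + (LINT r:{0..t}|lborel. S (t - r) (drift \<phi> u r \<omega>)) + I \<omega>"
      using I(2) eq[OF t] by eventually_elim simp
    with I(1) show "\<exists>I. has_ito_integral 0 t (\<lambda>r \<omega>. S (t - r) (diffusion \<phi> u r \<omega>)) I \<and>
      (AE \<omega> in P. set_integrable lborel {0..t} (\<lambda>r. S (t - r) (drift \<phi> u r \<omega>)) \<and>
        \<phi> t \<omega> = S (t - 0) 0 + (LINT r:{0..t}|lborel. S (t - r) (drift \<phi> u r \<omega>)) + I \<omega>)" by blast
  qed
  then show ?thesis unfolding is_state_def by blast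
qed

text \<open>The definition asks for an Ito integral of the combined diffusion. Its existence is
  established first, and linearity then identifies it almost surely with the combination of the
  given integrals.\<close>

lemma is_state_linear:
  assumes u: "admissible_control u" and w: "admissible_control w"
    and X: "is_state \<eta> u X" and \<phi>: "is_state 0 w \<phi>"
  shows "is_state \<eta> (\<lambda>t \<omega>. u t \<omega> + c *\<^sub>R w t \<omega>) (\<lambda>t \<omega>. X t \<omega> + c *\<^sub>R \<phi> t \<omega>)"
proof -
  let ?X = "\<lambda>t \<omega>. X t \<omega> + c *\<^sub>R \<phi> t \<omega>" and ?u = "\<lambda>t \<omega>. u t \<omega> + c *\<^sub>R w t \<omega>"
  have u': "L2_F 0 T u" "L2_F 0 T w" using u w by (simp_all add: admissible_control_def)
  have eq: "S q (drift ?X ?u r \<omega>) = S q (drift X u r \<omega>) + c *\<^sub>R S q (drift \<phi> w r \<omega>)"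
    "S q (diffusion ?X ?u r \<omega>) = S q (diffusion X u r \<omega>) + c *\<^sub>R S q (diffusion \<phi> w r \<omega>)" for q r \<omega>
    by (simp_all add: blinfun.add_right blinfun.scaleR_right scaleR_add_right)
  have "mild_solution S 0 (\<lambda>_. \<eta>) (drift ?X ?u) (diffusion ?X ?u) ?X"
    unfolding mild_solution_def
  proof (intro conjI ballI)
    show "C_F 0 T ?X" by (rule C_F_add_scaleR[OF is_state_C_F[OF X] is_state_C_F[OF \<phi>] T0(1,3)])
    fix t assume t: "t \<in> {0..T}"
    obtain I where I: "has_ito_integral 0 t (\<lambda>r \<omega>. S (t - r) (diffusion X u r \<omega>)) I"
      "AE \<omega> in P. set_integrable lborel {0..t} (\<lambda>r. S (t - r) (drift X u r \<omega>)) \<and>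
        X t \<omega> = S (t - 0) \<eta> + (LINT r:{0..t}|lborel. S (t - r) (drift X u r \<omega>)) + I \<omega>"
      using X t unfolding is_state_def mild_solution_def by blast
    obtain J where J: "has_ito_integral 0 t (\<lambda>r \<omega>. S (t - r) (diffusion \<phi> w r \<omega>)) J"
      "AE \<omega> in P. set_integrable lborel {0..t} (\<lambda>r. S (t - r) (drift \<phi> w r \<omega>)) \<and>
        \<phi> t \<omega> = S (t - 0) 0 + (LINT r:{0..t}|lborel. S (t - r) (drift \<phi> w r \<omega>)) + J \<omega>"
      using \<phi> t unfolding is_state_def mild_solution_def by blast
    have "L2_F 0 t (\<lambda>r \<omega>. S (t - r) (diffusion X u r \<omega>) + c *\<^sub>R S (t - r) (diffusion \<phi> w r \<omega>))"
      using I(1) J(1) t by (intro L2_F_add L2_F_scaleR) (auto simp: has_ito_integral_def)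
    from ito_integral_exists[OF this] t
    obtain K where K: "has_ito_integral 0 t (\<lambda>r \<omega>. S (t - r) (diffusion X u r \<omega>) + c *\<^sub>R S (t - r) (diffusion \<phi> w r \<omega>)) K"
      by auto
    have lin: "AE \<omega> in P. K \<omega> = I \<omega> + c *\<^sub>R J \<omega>"
      by (rule ito_linear[OF _ _ I(1) J(1) K]) (use t in auto)
    have "AE \<omega> in P. set_integrable lborel {0..t} (\<lambda>r. S (t - r) (drift ?X ?u r \<omega>)) \<and>
        ?X t \<omega> = S (t - 0) \<eta> + (LINT r:{0..t}|lborel. S (t - r) (drift ?X ?u r \<omega>)) + K \<omega>"
      using I(2) J(2) lin
    proof eventually_elim
      case (elim \<omega>)
      have i: "set_integrable lborel {0..t} (\<lambda>r. S (t - r) (drift X u r \<omega>))"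
        "set_integrable lborel {0..t} (\<lambda>r. c *\<^sub>R S (t - r) (drift \<phi> w r \<omega>))"
        using elim set_integrable_scaleR_right[of c lborel "{0..t}"] by auto
      have "(LINT r:{0..t}|lborel. S (t - r) (drift ?X ?u r \<omega>)) =
          (LINT r:{0..t}|lborel. S (t - r) (drift X u r \<omega>)) + c *\<^sub>R (LINT r:{0..t}|lborel. S (t - r) (drift \<phi> w r \<omega>))"
        unfolding eq set_integral_add(2)[OF i] set_integral_scaleR_right ..
      moreover have "set_integrable lborel {0..t} (\<lambda>r. S (t - r) (drift ?X ?u r \<omega>))"
        unfolding eq by (rule set_integral_add(1)[OF i])
      ultimately show ?case using elim by (simp add: scaleR_add_right)
    qed
    with K show "\<exists>I. has_ito_integral 0 t (\<lambda>r \<omega>. S (t - r) (diffusion ?X ?u r \<omega>)) I \<and>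
      (AE \<omega> in P. set_integrable lborel {0..t} (\<lambda>r. S (t - r) (drift ?X ?u r \<omega>)) \<and>
        ?X t \<omega> = S (t - 0) \<eta> + (LINT r:{0..t}|lborel. S (t - r) (drift ?X ?u r \<omega>)) + I \<omega>)"
      unfolding eq by blast
  qed
  then show ?thesis unfolding is_state_def .
qed

end

section \<open>The first variation of the cost\<close>

lemma self_adjoint_quadratic:
  fixes K :: "'a::{real_inner, banach} \<Rightarrow>\<^sub>L 'a"
  assumes "self_adjoint K"
  shows "K (a + c *\<^sub>R b) \<bullet> (a + c *\<^sub>R b) = K a \<bullet> a + 2 * c * (K a \<bullet> b) + c\<^sup>2 * (K b \<bullet> b)"
proof -
  have "K b \<bullet> a = K a \<bullet> b"
    using assms adjoint_blinfun[of K b a] by (simp add: self_adjoint_def inner_commute)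
  then show ?thesis
    by (simp add: blinfun.add_right blinfun.scaleR_right inner_add_left inner_add_right power2_eq_square algebra_simps)
qed

context slq
begin

lemma square_integrable_G:
  assumes x: "square_integrable P x"
  shows "square_integrable P (\<lambda>\<omega>. G \<omega> (x \<omega>))"
proof -
  have "T \<in> {0..T}" using T_pos by simp
  then have "(\<lambda>\<omega>. \<omega>) \<in> measurable P (F T)"
    using subalgebra_F[of T] by (auto simp: measurable_def subalgebra_def)
  then have G: "strongly_measurable P G"
    using Linf_G strongly_measurable_compose[of "F T" G "\<lambda>\<omega>. \<omega>" P] by (simp add: Linf_rv_def)
  have x': "strongly_measurable P x" using x by (simp add: strongly_measurable_iff_borel square_integrable_def)
  have "strongly_measurable P (\<lambda>\<omega>. G \<omega> (x \<omega>))"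
    by (rule strongly_measurable_continuous2[OF G x', where h=blinfun_apply])
      (auto intro!: continuous_intros simp: case_prod_unfold)
  then have m: "(\<lambda>\<omega>. G \<omega> (x \<omega>)) \<in> borel_measurable P" by (simp add: strongly_measurable_def)
  obtain k where k: "AE \<omega> in P. norm (G \<omega>) \<le> k" using Linf_G by (auto simp: Linf_rv_def)
  then have "AE \<omega> in P. norm (G \<omega> (x \<omega>)) \<le> k * norm (x \<omega>)"
    by eventually_elim (rule order_trans[OF norm_blinfun mult_right_mono], auto)
  then show ?thesis by (rule square_integrable_bound[OF x m])
qed

lemma is_state_terminal: "is_state \<eta> u X \<Longrightarrow> square_integrable P (X T)"
  using is_state_C_F[of \<eta> u X] T_pos by (auto simp: C_F_iff)

text \<open>The polar form of twice the cost, with time and expectation merged into one integral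
  over the product space.\<close>

definition bilinear_cost ::
    "(real \<Rightarrow> 'w \<Rightarrow> 'h) \<Rightarrow> (real \<Rightarrow> 'w \<Rightarrow> 'u) \<Rightarrow> (real \<Rightarrow> 'w \<Rightarrow> 'h) \<Rightarrow> (real \<Rightarrow> 'w \<Rightarrow> 'u) \<Rightarrow> real"
  where "bilinear_cost X u \<phi> w =
    (\<integral>(t, \<omega>). M t \<omega> (X t \<omega>) \<bullet> \<phi> t \<omega> + R t \<omega> (u t \<omega>) \<bullet> w t \<omega> \<partial>dt_dP 0 T)
    + expectation (\<lambda>\<omega>. G \<omega> (X T \<omega>) \<bullet> \<phi> T \<omega>)"

lemma bilinear_cost_integrable:
  assumes "L2_F 0 T X" "L2_F 0 T u" "L2_F 0 T \<phi>" "L2_F 0 T w"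
  shows "integrable (dt_dP 0 T) (\<lambda>(t, \<omega>). M t \<omega> (X t \<omega>) \<bullet> \<phi> t \<omega> + R t \<omega> (u t \<omega>) \<bullet> w t \<omega>)"
  using Bochner_Integration.integrable_add[OF L2_F_inner_integrable[OF L2_F_blinfun[OF Linf_M assms(1)] assms(3) T0]
      L2_F_inner_integrable[OF L2_F_blinfun[OF Linf_R assms(2)] assms(4) T0]]
  by (simp add: case_prod_unfold)

text \<open>\<open>cost\<close> is evaluated at the chosen \<open>state\<close>. Uniqueness replaces
  it by any given state: almost everywhere on the product in the running term, and almost surely at
  time \<open>T\<close> in the terminal term.\<close>

lemma cost_eq_bilinear_cost:
  assumes u: "admissible_control u" and X: "is_state \<eta> u X"
  shows "cost \<eta> u = 1 / 2 * bilinear_cost X u X u"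
proof -
  define X' where "X' = state \<eta> u"
  have X': "is_state \<eta> u X'" unfolding X'_def state_def using X by (rule someI[of "is_state \<eta> u"])
  have u': "L2_F 0 T u" using u by (simp add: admissible_control_def)
  note L = is_state_L2_F[OF X] and L' = is_state_L2_F[OF X']
  note eqt = is_state_unique[OF u X' X]
  have eq: "AE (t, \<omega>) in dt_dP 0 T. X' t \<omega> = X t \<omega>" by (rule modification_AE_eq[OF L' L T0 eqt])
  let ?q = "\<lambda>X t \<omega>. M t \<omega> (X t \<omega>) \<bullet> X t \<omega> + R t \<omega> (u t \<omega>) \<bullet> u t \<omega>"
  note i' = bilinear_cost_integrable[OF L' u' L' u'] and i = bilinear_cost_integrable[OF L u' L u']
  have g: "integrable P (\<lambda>\<omega>. G \<omega> (X T \<omega>) \<bullet> X T \<omega>)" if "is_state \<eta> u X" for X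
    by (intro square_integrable_inner square_integrable_G is_state_terminal[OF that])
  have 1: "(\<integral>(t, \<omega>). ?q X' t \<omega> \<partial>dt_dP 0 T) = (\<integral>(t, \<omega>). ?q X t \<omega> \<partial>dt_dP 0 T)"
  proof (rule integral_cong_AE)
    show "AE x in dt_dP 0 T. (case x of (t, \<omega>) \<Rightarrow> ?q X' t \<omega>) = (case x of (t, \<omega>) \<Rightarrow> ?q X t \<omega>)"
      using eq by eventually_elim auto
  qed (use i i' in auto)
  have "T \<in> {0..T}" using T_pos by simp
  from eqt[OF this] have 2: "expectation (\<lambda>\<omega>. G \<omega> (X' T \<omega>) \<bullet> X' T \<omega>) = expectation (\<lambda>\<omega>. G \<omega> (X T \<omega>) \<bullet> X T \<omega>)"
    using g[OF X] g[OF X'] by (intro integral_cong_AE) auto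
  have "(\<integral>\<omega>. (LINT t:{0..T}|lborel. ?q X' t \<omega>) + G \<omega> (X' T \<omega>) \<bullet> X' T \<omega> \<partial>P) =
      (\<integral>(t, \<omega>). ?q X' t \<omega> \<partial>dt_dP 0 T) + expectation (\<lambda>\<omega>. G \<omega> (X' T \<omega>) \<bullet> X' T \<omega>)"
    using Bochner_Integration.integral_add[OF integral_dt_dP_iterated(3)[OF i'] g[OF X']]
    unfolding integral_dt_dP_iterated(1)[OF i'] .
  then show ?thesis
    unfolding cost_def bilinear_cost_def X'_def[symmetric] Let_def 1 2 by simp
qed

text \<open>Self-adjointness merges the two mixed terms into one with factor 2. It holds only
  outside null sets, so the integrands are compared almost everywhere.\<close>

lemma bilinear_cost_expand:
  assumes u: "L2_F 0 T u" and w: "L2_F 0 T w" and X: "is_state \<eta> u X" and \<phi>: "is_state \<eta>' w \<phi>"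
  shows "bilinear_cost (\<lambda>t \<omega>. X t \<omega> + c *\<^sub>R \<phi> t \<omega>) (\<lambda>t \<omega>. u t \<omega> + c *\<^sub>R w t \<omega>)
      (\<lambda>t \<omega>. X t \<omega> + c *\<^sub>R \<phi> t \<omega>) (\<lambda>t \<omega>. u t \<omega> + c *\<^sub>R w t \<omega>) =
    bilinear_cost X u X u + 2 * c * bilinear_cost X u \<phi> w + c\<^sup>2 * bilinear_cost \<phi> w \<phi> w"
proof -
  note LX = is_state_L2_F[OF X] and L\<phi> = is_state_L2_F[OF \<phi>]
  note SX = is_state_terminal[OF X] and S\<phi> = is_state_terminal[OF \<phi>]
  let ?X = "\<lambda>t \<omega>. X t \<omega> + c *\<^sub>R \<phi> t \<omega>" and ?u = "\<lambda>t \<omega>. u t \<omega> + c *\<^sub>R w t \<omega>"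
  have L: "L2_F 0 T ?X" "L2_F 0 T ?u" by (intro L2_F_add L2_F_scaleR LX L\<phi> u w T0)+
  let ?q = "\<lambda>X u \<phi> w x. case x of (t, \<omega>) \<Rightarrow> M t \<omega> (X t \<omega>) \<bullet> \<phi> t \<omega> + R t \<omega> (u t \<omega>) \<bullet> w t \<omega>"
  note i = bilinear_cost_integrable[OF LX u LX u] bilinear_cost_integrable[OF LX u L\<phi> w] bilinear_cost_integrable[OF L\<phi> w L\<phi> w]
  note i' = bilinear_cost_integrable[OF L L]
  have "(\<integral>x. ?q ?X ?u ?X ?u x \<partial>dt_dP 0 T) = (\<integral>x. ?q X u X u x + 2 * c * ?q X u \<phi> w x + c\<^sup>2 * ?q \<phi> w \<phi> w x \<partial>dt_dP 0 T)"
  proof (rule integral_cong_AE)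
    show "AE x in dt_dP 0 T. ?q ?X ?u ?X ?u x = ?q X u X u x + 2 * c * ?q X u \<phi> w x + c\<^sup>2 * ?q \<phi> w \<phi> w x"
      using M_self_adjoint R_self_adjoint
    proof eventually_elim
      case (elim x)
      obtain t \<omega> where x: "x = (t, \<omega>)" by (cases x)
      have "self_adjoint (M t \<omega>)" "self_adjoint (R t \<omega>)" using elim by (simp_all add: x)
      note [simp] = this[THEN self_adjoint_quadratic]
      show ?case unfolding x by (simp add: distrib_left)
    qed
    show "?q ?X ?u ?X ?u \<in> borel_measurable (dt_dP 0 T)" using i' by (rule borel_measurable_integrable)
    show "(\<lambda>x. ?q X u X u x + 2 * c * ?q X u \<phi> w x + c\<^sup>2 * ?q \<phi> w \<phi> w x) \<in> borel_measurable (dt_dP 0 T)"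
      using i[THEN borel_measurable_integrable] by (intro borel_measurable_add borel_measurable_times borel_measurable_const)
  qed
  also have "\<dots> = (\<integral>x. ?q X u X u x \<partial>dt_dP 0 T) + 2 * c * (\<integral>x. ?q X u \<phi> w x \<partial>dt_dP 0 T) + c\<^sup>2 * (\<integral>x. ?q \<phi> w \<phi> w x \<partial>dt_dP 0 T)"
    using i by simp
  finally have 1: "(\<integral>x. ?q ?X ?u ?X ?u x \<partial>dt_dP 0 T) =
    (\<integral>x. ?q X u X u x \<partial>dt_dP 0 T) + 2 * c * (\<integral>x. ?q X u \<phi> w x \<partial>dt_dP 0 T) + c\<^sup>2 * (\<integral>x. ?q \<phi> w \<phi> w x \<partial>dt_dP 0 T)" .
  note G = square_integrable_inner[OF square_integrable_G[OF SX] SX] square_integrable_inner[OF square_integrable_G[OF SX] S\<phi>]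
    square_integrable_inner[OF square_integrable_G[OF S\<phi>] S\<phi>]
  have SX': "square_integrable P (?X T)" by (intro square_integrable_add square_integrable_scaleR SX S\<phi>)
  have "expectation (\<lambda>\<omega>. G \<omega> (?X T \<omega>) \<bullet> ?X T \<omega>) =
      expectation (\<lambda>\<omega>. G \<omega> (X T \<omega>) \<bullet> X T \<omega> + 2 * c * (G \<omega> (X T \<omega>) \<bullet> \<phi> T \<omega>) + c\<^sup>2 * (G \<omega> (\<phi> T \<omega>) \<bullet> \<phi> T \<omega>))"
  proof (rule integral_cong_AE)
    show "AE \<omega> in P. G \<omega> (?X T \<omega>) \<bullet> ?X T \<omega> = G \<omega> (X T \<omega>) \<bullet> X T \<omega> + 2 * c * (G \<omega> (X T \<omega>) \<bullet> \<phi> T \<omega>) + c\<^sup>2 * (G \<omega> (\<phi> T \<omega>) \<bullet> \<phi> T \<omega>)"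
      using G_self_adjoint by eventually_elim (rule self_adjoint_quadratic)
    show "(\<lambda>\<omega>. G \<omega> (?X T \<omega>) \<bullet> ?X T \<omega>) \<in> borel_measurable P"
      by (intro borel_measurable_integrable square_integrable_inner square_integrable_G SX')
    show "(\<lambda>\<omega>. G \<omega> (X T \<omega>) \<bullet> X T \<omega> + 2 * c * (G \<omega> (X T \<omega>) \<bullet> \<phi> T \<omega>) + c\<^sup>2 * (G \<omega> (\<phi> T \<omega>) \<bullet> \<phi> T \<omega>)) \<in> borel_measurable P"
      using G[THEN borel_measurable_integrable] by (intro borel_measurable_add borel_measurable_times borel_measurable_const)
  qed
  also have "\<dots> = expectation (\<lambda>\<omega>. G \<omega> (X T \<omega>) \<bullet> X T \<omega>) + 2 * c * expectation (\<lambda>\<omega>. G \<omega> (X T \<omega>) \<bullet> \<phi> T \<omega>)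
      + c\<^sup>2 * expectation (\<lambda>\<omega>. G \<omega> (\<phi> T \<omega>) \<bullet> \<phi> T \<omega>)"
    using G by simp
  finally show ?thesis unfolding bilinear_cost_def 1 by (simp add: algebra_simps)
qed

lemma first_variation_zero:
  assumes opt: "optimal_control \<eta> u" and X: "is_state \<eta> u X"
    and w: "admissible_control w" and \<phi>: "is_state 0 w \<phi>"
  shows "bilinear_cost X u \<phi> w = 0"
proof -
  have u: "admissible_control u" using opt by (simp add: optimal_control_def)
  then have u': "L2_F 0 T u" and w': "L2_F 0 T w" using w by (simp_all add: admissible_control_def)
  have "2 * bilinear_cost X u \<phi> w = 0"
  proof (rule quadratic_nonneg_imp_linear_zero)
    fix c :: real
    let ?u = "\<lambda>t \<omega>. u t \<omega> + c *\<^sub>R w t \<omega>" and ?X = "\<lambda>t \<omega>. X t \<omega> + c *\<^sub>R \<phi> t \<omega>"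
    have a: "admissible_control ?u"
      unfolding admissible_control_def by (intro L2_F_add L2_F_scaleR u' w' T0)
    have s: "is_state \<eta> ?u ?X" by (rule is_state_linear[OF u w X \<phi>])
    have "cost \<eta> u \<le> cost \<eta> ?u" using opt a by (simp add: optimal_control_def)
    then show "0 \<le> bilinear_cost \<phi> w \<phi> w * c\<^sup>2 + 2 * bilinear_cost X u \<phi> w * c"
      unfolding cost_eq_bilinear_cost[OF u X] cost_eq_bilinear_cost[OF a s] bilinear_cost_expand[OF u' w' X \<phi>]
      by (simp add: algebra_simps)
  qed
  then show ?thesis by simp
qed

text \<open>The transposition identity at time 0 with zero initial value, taking the full drift and
  diffusion of \<open>\<phi>\<close> as test coefficients. The \<open>A\<^sub>1\<close> and
  \<open>C\<close> parts cancel against the driver of the backward equation, so the control enters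
  only through the adjoints of \<open>B\<close> and \<open>D\<close>.\<close>

lemma adjoint_duality:
  assumes X: "is_state \<eta> u X" and w: "admissible_control w" and \<phi>: "is_state 0 w \<phi>"
    and YZ: "transposition_solution S (\<lambda>\<omega>. - G \<omega> (X T \<omega>))
      (\<lambda>t \<omega> y z. - adjoint (A\<^sub>1 t \<omega>) y - adjoint (C t \<omega>) z + M t \<omega> (X t \<omega>)) Y Z"
  shows "- expectation (\<lambda>\<omega>. G \<omega> (X T \<omega>) \<bullet> \<phi> T \<omega>) =
    (\<integral>(t, \<omega>). M t \<omega> (X t \<omega>) \<bullet> \<phi> t \<omega> + (adjoint (B t \<omega>) (Y t \<omega>) + adjoint (D t \<omega>) (Z t \<omega>)) \<bullet> w t \<omega> \<partial>dt_dP 0 T)"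
proof -
  have w': "L2_F 0 T w" using w by (simp add: admissible_control_def)
  note L\<phi> = is_state_L2_F[OF \<phi>] and LX = is_state_L2_F[OF X]
  have Y: "L2_F 0 T Y" by (rule D_F_imp_L2_F[OF _ T0]) (use YZ in \<open>simp add: transposition_solution_def\<close>)
  have Z: "L2_F 0 T Z" using YZ by (simp add: transposition_solution_def)
  let ?f = "\<lambda>t \<omega>. - adjoint (A\<^sub>1 t \<omega>) (Y t \<omega>) - adjoint (C t \<omega>) (Z t \<omega>) + M t \<omega> (X t \<omega>)"
  have f: "L2_F 0 T ?f"
  proof -
    have "L2_F 0 T (\<lambda>t \<omega>. (-1) *\<^sub>R adjoint (A\<^sub>1 t \<omega>) (Y t \<omega>) - adjoint (C t \<omega>) (Z t \<omega>) + M t \<omega> (X t \<omega>))"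
      by (intro L2_F_add L2_F_diff L2_F_scaleR L2_F_adjoint[OF Linf_A\<^sub>1 Y] L2_F_adjoint[OF Linf_C Z] L2_F_blinfun[OF Linf_M LX] T0)
    then show ?thesis by simp
  qed
  note dr = L2_F_drift[OF L\<phi> w'] and di = L2_F_diffusion[OF L\<phi> w']
  have "L2_rv 0 (\<lambda>_. 0 :: 'h)" by (simp add: L2_rv_def strongly_measurable_iff_borel)
  moreover have "mild_solution S 0 (\<lambda>_. 0) (drift \<phi> w) (diffusion \<phi> w) \<phi>" using \<phi> by (simp add: is_state_def)
  moreover have "0 \<in> {0..T}" using T_pos by simp
  ultimately have eq: "expectation (\<lambda>\<omega>. \<phi> T \<omega> \<bullet> - G \<omega> (X T \<omega>)) - (\<integral>\<omega>. (LINT s:{0..T}|lborel. \<phi> s \<omega> \<bullet> ?f s \<omega>) \<partial>P) =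
      expectation (\<lambda>\<omega>. 0 \<bullet> Y 0 \<omega>) + (\<integral>\<omega>. (LINT s:{0..T}|lborel. drift \<phi> w s \<omega> \<bullet> Y s \<omega>) \<partial>P)
      + (\<integral>\<omega>. (LINT s:{0..T}|lborel. diffusion \<phi> w s \<omega> \<bullet> Z s \<omega>) \<partial>P)"
    using YZ L2_F_imp_L1_F_L2[OF dr] di unfolding transposition_solution_def by blast
  note i = L2_F_inner_integrable[OF L\<phi> f T0] L2_F_inner_integrable[OF dr Y T0] L2_F_inner_integrable[OF di Z T0]
  have "- expectation (\<lambda>\<omega>. G \<omega> (X T \<omega>) \<bullet> \<phi> T \<omega>) = expectation (\<lambda>\<omega>. \<phi> T \<omega> \<bullet> - G \<omega> (X T \<omega>))"
    by (simp add: inner_commute)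
  also have "\<dots> = (\<integral>x. (case x of (t, \<omega>) \<Rightarrow> \<phi> t \<omega> \<bullet> ?f t \<omega>) \<partial>dt_dP 0 T)
      + (\<integral>x. (case x of (t, \<omega>) \<Rightarrow> drift \<phi> w t \<omega> \<bullet> Y t \<omega>) \<partial>dt_dP 0 T)
      + (\<integral>x. (case x of (t, \<omega>) \<Rightarrow> diffusion \<phi> w t \<omega> \<bullet> Z t \<omega>) \<partial>dt_dP 0 T)"
    using eq unfolding integral_dt_dP_iterated(1)[OF i(1)] integral_dt_dP_iterated(1)[OF i(2)] integral_dt_dP_iterated(1)[OF i(3)]
    by simp
  also have "\<dots> = (\<integral>x. (case x of (t, \<omega>) \<Rightarrow> \<phi> t \<omega> \<bullet> ?f t \<omega>) + (case x of (t, \<omega>) \<Rightarrow> drift \<phi> w t \<omega> \<bullet> Y t \<omega>)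
      + (case x of (t, \<omega>) \<Rightarrow> diffusion \<phi> w t \<omega> \<bullet> Z t \<omega>) \<partial>dt_dP 0 T)"
    using i by simp
  also have "\<dots> = (\<integral>(t, \<omega>). M t \<omega> (X t \<omega>) \<bullet> \<phi> t \<omega> + (adjoint (B t \<omega>) (Y t \<omega>) + adjoint (D t \<omega>) (Z t \<omega>)) \<bullet> w t \<omega> \<partial>dt_dP 0 T)"
  proof (intro Bochner_Integration.integral_cong refl, clarify)
    fix t \<omega>
    show "\<phi> t \<omega> \<bullet> ?f t \<omega> + drift \<phi> w t \<omega> \<bullet> Y t \<omega> + diffusion \<phi> w t \<omega> \<bullet> Z t \<omega> =
      M t \<omega> (X t \<omega>) \<bullet> \<phi> t \<omega> + (adjoint (B t \<omega>) (Y t \<omega>) + adjoint (D t \<omega>) (Z t \<omega>)) \<bullet> w t \<omega>"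
      using inner_commute[of "M t \<omega> (X t \<omega>)" "\<phi> t \<omega>"] inner_commute[of "adjoint (B t \<omega>) (Y t \<omega>)" "w t \<omega>"]
        inner_commute[of "adjoint (D t \<omega>) (Z t \<omega>)" "w t \<omega>"]
      by (simp add: inner_add_left inner_add_right inner_diff_right adjoint_blinfun)
  qed
  finally show ?thesis .
qed

lemma stationarity:
  assumes opt: "optimal_pair \<eta> X u"
    and YZ: "transposition_solution S (\<lambda>\<omega>. - G \<omega> (X T \<omega>))
      (\<lambda>t \<omega> y z. - adjoint (A\<^sub>1 t \<omega>) y - adjoint (C t \<omega>) z + M t \<omega> (X t \<omega>)) Y Z"
  shows "AE (t, \<omega>) in dt_dP 0 T. R t \<omega> (u t \<omega>) - adjoint (B t \<omega>) (Y t \<omega>) - adjoint (D t \<omega>) (Z t \<omega>) = 0"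
proof -
  have X: "is_state \<eta> u X" and o: "optimal_control \<eta> u" using opt by (simp_all add: optimal_pair_def)
  have u: "L2_F 0 T u" using o by (simp add: optimal_control_def admissible_control_def)
  have Y: "L2_F 0 T Y" by (rule D_F_imp_L2_F[OF _ T0]) (use YZ in \<open>simp add: transposition_solution_def\<close>)
  have Z: "L2_F 0 T Z" using YZ by (simp add: transposition_solution_def)
  define w where "w t \<omega> = R t \<omega> (u t \<omega>) - adjoint (B t \<omega>) (Y t \<omega>) - adjoint (D t \<omega>) (Z t \<omega>)" for t \<omega>
  note Ru = L2_F_blinfun[OF Linf_R u] and BY = L2_F_adjoint[OF Linf_B Y] and DZ = L2_F_adjoint[OF Linf_D Z]
  have w: "L2_F 0 T w" unfolding w_def by (intro L2_F_diff Ru BY DZ T0)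
  then have a: "admissible_control w" by (simp add: admissible_control_def)
  obtain \<phi> where \<phi>: "is_state 0 w \<phi>" using is_state_zero_exists[OF a] by blast
  note L\<phi> = is_state_L2_F[OF \<phi>] and LX = is_state_L2_F[OF X]
  let ?g = "\<lambda>t \<omega>. adjoint (B t \<omega>) (Y t \<omega>) + adjoint (D t \<omega>) (Z t \<omega>)"
  have g: "L2_F 0 T ?g" by (intro L2_F_add BY DZ T0)
  have i1: "integrable (dt_dP 0 T) (\<lambda>(t, \<omega>). M t \<omega> (X t \<omega>) \<bullet> \<phi> t \<omega> + R t \<omega> (u t \<omega>) \<bullet> w t \<omega>)"
    by (rule bilinear_cost_integrable[OF LX u L\<phi> w])
  have i2: "integrable (dt_dP 0 T) (\<lambda>(t, \<omega>). M t \<omega> (X t \<omega>) \<bullet> \<phi> t \<omega> + ?g t \<omega> \<bullet> w t \<omega>)"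
    using Bochner_Integration.integrable_add[OF L2_F_inner_integrable[OF L2_F_blinfun[OF Linf_M LX] L\<phi> T0] L2_F_inner_integrable[OF g w T0]]
    by (simp add: case_prod_unfold)
  have "(\<integral>(t, \<omega>). M t \<omega> (X t \<omega>) \<bullet> \<phi> t \<omega> + R t \<omega> (u t \<omega>) \<bullet> w t \<omega> \<partial>dt_dP 0 T) =
      (\<integral>(t, \<omega>). M t \<omega> (X t \<omega>) \<bullet> \<phi> t \<omega> + ?g t \<omega> \<bullet> w t \<omega> \<partial>dt_dP 0 T)"
    using first_variation_zero[OF o X a \<phi>] adjoint_duality[OF X a \<phi> YZ] unfolding bilinear_cost_def by linarith
  \<comment> \<open>The terms with \<open>M\<close> occur in both integrands and cancel; what
    remains is the inner product of \<open>w\<close> with itself.\<close>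
  then have "0 = (\<integral>x. (case x of (t, \<omega>) \<Rightarrow> M t \<omega> (X t \<omega>) \<bullet> \<phi> t \<omega> + R t \<omega> (u t \<omega>) \<bullet> w t \<omega>)
      - (case x of (t, \<omega>) \<Rightarrow> M t \<omega> (X t \<omega>) \<bullet> \<phi> t \<omega> + ?g t \<omega> \<bullet> w t \<omega>) \<partial>dt_dP 0 T)"
    using Bochner_Integration.integral_diff[OF i1 i2] by simp
  also have "\<dots> = (\<integral>(t, \<omega>). (norm (w t \<omega>))\<^sup>2 \<partial>dt_dP 0 T)"
  proof (intro Bochner_Integration.integral_cong refl)
    fix x :: "real \<times> 'w"
    obtain t \<omega> where x: "x = (t, \<omega>)" by (cases x)
    have "R t \<omega> (u t \<omega>) \<bullet> w t \<omega> - ?g t \<omega> \<bullet> w t \<omega> = w t \<omega> \<bullet> w t \<omega>"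
      unfolding inner_diff_left[symmetric] by (simp add: w_def algebra_simps)
    then show "(case x of (t, \<omega>) \<Rightarrow> M t \<omega> (X t \<omega>) \<bullet> \<phi> t \<omega> + R t \<omega> (u t \<omega>) \<bullet> w t \<omega>)
      - (case x of (t, \<omega>) \<Rightarrow> M t \<omega> (X t \<omega>) \<bullet> \<phi> t \<omega> + ?g t \<omega> \<bullet> w t \<omega>) = (case x of (t, \<omega>) \<Rightarrow> (norm (w t \<omega>))\<^sup>2)"
      unfolding x power2_norm_eq_inner by simp
  qed
  finally have zero: "(\<integral>(t, \<omega>). (norm (w t \<omega>))\<^sup>2 \<partial>dt_dP 0 T) = 0" by simp
  have "integrable (dt_dP 0 T) (\<lambda>(t, \<omega>). (norm (w t \<omega>))\<^sup>2)" using w by (simp add: L2_F_def)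
  then have "AE x in dt_dP 0 T. (case x of (t, \<omega>) \<Rightarrow> (norm (w t \<omega>))\<^sup>2) = 0"
    using zero by (subst (asm) integral_nonneg_eq_0_iff_AE) (auto simp: case_prod_unfold)
  then show ?thesis unfolding w_def by eventually_elim (auto split: prod.splits)
qed

end

theorem theorem7p2:
  fixes P :: "'w measure" and T :: real and F :: "real \<Rightarrow> 'w measure"
    and W :: "real \<Rightarrow> 'w \<Rightarrow> real"
    and A :: "'h::{real_inner, banach, second_countable_topology} \<Rightarrow> 'h" and domA :: "'h set"
    and S :: "real \<Rightarrow> 'h \<Rightarrow>\<^sub>L 'h"
    and A\<^sub>1 C :: "real \<Rightarrow> 'w \<Rightarrow> 'h \<Rightarrow>\<^sub>L 'h"
    and B D :: "real \<Rightarrow> 'w \<Rightarrow> 'u::{real_inner, banach} \<Rightarrow>\<^sub>L 'h"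
    and M :: "real \<Rightarrow> 'w \<Rightarrow> 'h \<Rightarrow>\<^sub>L 'h"
    and R :: "real \<Rightarrow> 'w \<Rightarrow> 'u \<Rightarrow>\<^sub>L 'u"
    and G :: "'w \<Rightarrow> 'h \<Rightarrow>\<^sub>L 'h"
    and \<eta> :: 'h and X :: "real \<Rightarrow> 'w \<Rightarrow> 'h" and u :: "real \<Rightarrow> 'w \<Rightarrow> 'u"
    and Y Z :: "real \<Rightarrow> 'w \<Rightarrow> 'h"
  assumes setting: "slq P T F W A domA S A\<^sub>1 C B D M R G"
    and solvable: "slq.solvable_at P T F W S A\<^sub>1 C B D M R G \<eta>"
    and optimal: "slq.optimal_pair P T F W S A\<^sub>1 C B D M R G \<eta> X u"
    and adjoint_eq: "brownian_motion.transposition_solution P T F W S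
      (\<lambda>\<omega>. - G \<omega> (X T \<omega>))
      (\<lambda>t \<omega> y z. - adjoint (A\<^sub>1 t \<omega>) y - adjoint (C t \<omega>) z + M t \<omega> (X t \<omega>)) Y Z"
  shows "AE (t, \<omega>) in restrict_space lborel {0..T} \<Otimes>\<^sub>M P.
    R t \<omega> (u t \<omega>) - adjoint (B t \<omega>) (Y t \<omega>) - adjoint (D t \<omega>) (Z t \<omega>) = 0"
proof -
  interpret slq P T F W A domA S A\<^sub>1 C B D M R G by (rule setting)
  show ?thesis using stationarity[OF optimal adjoint_eq] unfolding dt_dP_def .
qed

end
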